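(* Let $a\ge2$ be an integer, let $\lambda,\mu\in\mathbb{Q}$, and let $N\in\mathbb{N}$ be minimal such that $N\lambda,N\mu\in\mathbb{Z}$; if $a=2$, assume moreover $(\lambda,\mu)\notin\mathbb{Z}^2$. Let $D=q\frac{\partial}{\partial q}=\frac1{2\pi i}\frac{\partial}{\partial\tau}$. Then $$D^{a-1}\left(\widehat{\mathcal{E}}_{2-a}(\lambda\tau+\mu;\tau)\right)=\frac{(a-1)!}{(-2\pi i)^a}\sum_{\boldsymbol{m}=(m_1,m_2)\in(\mathbb{Z}/N\mathbb{Z})^2}e^{2\pi i(m_1\mu-m_2\lambda)}\,G_a^{[N,\boldsymbol m]}(\tau),$$ where $G_a^{[N,\boldsymbol m]}$ is the Eisenstein series of weight $a$ on $\Gamma(N)$ defined in the context. In particular, for $a\ge3$ and $\lambda=\mu=0$, $D^{a-1}\left(\widehat{\mathcal{E}}_{2-a}(0;\tau)\right)=2G_a(\tau)$.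
   Context: Write $\tau=u+iv$ with $v>0$, $z=x+iy\in\mathbb{C}$, $q=e^{2\pi i\tau}$, $\zeta=e^{2\pi i z}$; $\lfloor\cdot\rfloor$ floor, $\{t\}=t-\lfloor t\rfloor$, $B_n(t)$ the $n$-th Bernoulli polynomial, $B_n=B_n(0)$, $\Gamma^*(n,w)=\frac{\Gamma(n,w)}{\Gamma(n)}=e^{-w}\sum_{k=0}^{n-1}\frac{w^k}{k!}$ for integers $n\ge1$. Here $\frac{\partial}{\partial\tau}=\frac12\left(\frac{\partial}{\partial u}-i\frac{\partial}{\partial v}\right)$. For $a\ge2$ and $0\le y<v$ (with $z\notin\mathbb{Z}$ if $a=2$): $\mathcal{E}_{2-a}(z;\tau)=\sum_{n\in\mathbb{Z}\setminus\{0\}}\frac{\zeta^n}{n^{a-1}(1-q^n)}$. For $a\ge2$ and $z\in\mathbb{C}$ (with $z\notin\mathbb{Z}\tau+\mathbb{Z}$ if $a=2$): $$\widehat{\mathcal{E}}_{2-a}(z;\tau)=\mathcal{E}_{2-a}\left(z-\left\lfloor\tfrac yv\right\rfloor\tau;\tau\right)-\frac{(-4\pi v)^{a-1}B_a\left(\left\{\frac yv\right\}\right)}{a!}+\mathcal{E}^-_{2-a}(z;\tau),$$ $$\mathcal{E}^-_{2-a}(z;\tau)=\sum_{\substack{m\ge1\\ \ell\ge1+\lfloor y/v\rfloor}}\frac{\Gamma^*\left(a-1,4\pi m\left(\ell-\frac yv\right)v\right)}{m^{a-1}}e^{2\pi i m(z-\ell\tau)}+(-1)^a\sum_{\substack{m\ge1\\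 \ell\ge-\lfloor y/v\rfloor}}\frac{\Gamma^*\left(a-1,4\pi m\left(\ell+\frac yv\right)v\right)}{m^{a-1}}e^{-2\pi i m(z+\ell\tau)}.$$ For $k\ge2$, $N\in\mathbb{N}$, $\boldsymbol m=(m_1,m_2)\in(\mathbb{Z}/N\mathbb{Z})^2$: $$G_k^{[N,\boldsymbol m]}(\tau)=\sum_{\substack{(c,d)\equiv\boldsymbol m\ (\mathrm{mod}\ N)\\(c,d)\ne(0,0)}}\frac1{(c\tau+d)^k},$$ where for $k=2$ the (conditionally convergent) sum is taken by summing over $d$ first and then over $c$. For even $k\ge2$, $G_k(\tau)=-\frac{B_k}{2k}+\sum_{n\ge1}\sigma_{k-1}(n)q^n$ with $\sigma_\ell(n)=\sum_{d\mid n}d^\ell$; for $k$ odd, $G_k(\tau)=0$. *)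

theory Defs
  imports "HOL-Complex_Analysis.Complex_Analysis" "HOL-Number_Theory.Cong"
begin

text \<open>Bernoulli numbers with the convention $B_1 = -1/2$, so that $B_n = B_n(0)$.\<close>

fun bernoulli :: "nat \<Rightarrow> real" where
  "bernoulli 0 = 1"
| "bernoulli (Suc n) = (-1 / real (n + 2)) * (\<Sum>k\<le>n. real ((n + 2) choose k) * bernoulli k)"

definition bernpoly :: "nat \<Rightarrow> real \<Rightarrow> real" where
  "bernpoly n t = (\<Sum>k\<le>n. real (n choose k) * bernoulli k * t ^ (n - k))"

text \<open>The normalised incomplete Gamma function $\Gamma^*(n,w) = \Gamma(n,w)/\Gamma(n)$, for
  integers $n \ge 1$.\<close>

definition Gamma_star :: "nat \<Rightarrow> real \<Rightarrow> real" where
  "Gamma_star n w = exp (- w) * (\<Sum>k<n. w ^ k / fact k)"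

definition e2pi :: "complex \<Rightarrow> complex" where
  "e2pi w = exp (2 * of_real pi * \<i> * w)"

text \<open>In the next three definitions the argument \<open>a\<close> stands for the index $2-a$, and $a \ge 2$.

  \<open>calE a z \<tau>\<close> is $\sum_{n \ne 0} \zeta^n / (n^{a-1} (1 - q^n))$, meant for
  $0 \le {\rm Im}\, z < {\rm Im}\, \tau$. For $a = 2$ and real $z$ the part $n \ge 1$ converges
  only conditionally, so the sum is an ordinary series in $|n|$ on either side of $0$ and not
  an unordered sum.\<close>

definition calE :: "nat \<Rightarrow> complex \<Rightarrow> complex \<Rightarrow> complex" where
  "calE a z \<tau> =
     (let t = (\<lambda>n::int. e2pi z powi n / (of_int n ^ (a - 1) * (1 - e2pi \<tau> powi n)))
      in (\<Sum>n. t (int (Suc n))) + (\<Sum>n. t (- int (Suc n))))"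

text \<open>For $a = 2$ and integral ${\rm Im}\, z / {\rm Im}\, \tau$, the terms of the second sum with
  $l = -\lfloor {\rm Im}\, z / {\rm Im}\, \tau \rfloor$ are only conditionally summable over $m$.
  For each $m$ the sum over $l$ is absolutely convergent; the sum over $m$ is an ordinary
  series. In all other cases the double sums converge absolutely.\<close>

definition calE_minus :: "nat \<Rightarrow> complex \<Rightarrow> complex \<Rightarrow> complex" where
  "calE_minus a z \<tau> =
     (let v = Im \<tau>; r = Im z / Im \<tau>;
          t1 = (\<lambda>m l::int. of_real (Gamma_star (a - 1) (4 * pi * of_int m * (of_int l - r) * v))
                 / of_int m ^ (a - 1) * e2pi (of_int m * (z - of_int l * \<tau>)));
          t2 = (\<lambda>m l::int. of_real (Gamma_star (a - 1) (4 * pi * of_int m * (of_int l + r) * v))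
                 / of_int m ^ (a - 1) * e2pi (- of_int m * (z + of_int l * \<tau>)))
      in (\<Sum>m. \<Sum>\<^sub>\<infinity>l\<in>{1 + \<lfloor>r\<rfloor>..}. t1 (int (Suc m)) l)
         + (- 1) ^ a * (\<Sum>m. \<Sum>\<^sub>\<infinity>l\<in>{- \<lfloor>r\<rfloor>..}. t2 (int (Suc m)) l))"

definition calE_hat :: "nat \<Rightarrow> complex \<Rightarrow> complex \<Rightarrow> complex" where
  "calE_hat a z \<tau> =
     (let v = Im \<tau>; r = Im z / Im \<tau>
      in calE a (z - of_int \<lfloor>r\<rfloor> * \<tau>) \<tau>
         - of_real ((- 4 * pi * v) ^ (a - 1) * bernpoly a (frac r) / fact a)
         + calE_minus a z \<tau>)"

text \<open>The residue class of $(m_1, m_2)$ modulo $N$ is given by an integer representative.\<close>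

definition eisenstein_level :: "nat \<Rightarrow> nat \<Rightarrow> int \<times> int \<Rightarrow> complex \<Rightarrow> complex" where
  "eisenstein_level k N m \<tau> =
     (if k = 2 then
        (\<Sum>\<^sub>\<infinity>c\<in>{c. [c = fst m] (mod int N)}.
           \<Sum>\<^sub>\<infinity>d\<in>{d. [d = snd m] (mod int N) \<and> (c, d) \<noteq> (0, 0)}.
             1 / (of_int c * \<tau> + of_int d) ^ k)
      else
        (\<Sum>\<^sub>\<infinity>(c, d)\<in>{(c, d). [c = fst m] (mod int N) \<and> [d = snd m] (mod int N)
                         \<and> (c, d) \<noteq> (0, 0)}.
           1 / (of_int c * \<tau> + of_int d) ^ k))"

definition divisor_sum :: "nat \<Rightarrow> nat \<Rightarrow> nat" where
  "divisor_sum l n = (\<Sum>d | d dvd n. d ^ l)"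

definition eisenstein_G :: "nat \<Rightarrow> complex \<Rightarrow> complex" where
  "eisenstein_G k \<tau> =
     (if even k then
        - of_real (bernoulli k) / (2 * of_nat k)
        + (\<Sum>n. of_nat (divisor_sum (k - 1) (Suc n)) * e2pi \<tau> ^ Suc n)
      else 0)"

text \<open>The functions to which the following operators are applied are smooth but not holomorphic
  in $\tau = u + i v$.\<close>

definition partial_u :: "(complex \<Rightarrow> complex) \<Rightarrow> complex \<Rightarrow> complex" where
  "partial_u f \<tau> = vector_derivative (\<lambda>u::real. f (Complex u (Im \<tau>))) (at (Re \<tau>))"

definition partial_v :: "(complex \<Rightarrow> complex) \<Rightarrow> complex \<Rightarrow> complex" where
  "partial_v f \<tau> = vector_derivative (\<lambda>v::real. f (Complex (Re \<tau>) v)) (at (Im \<tau>))"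

definition wirtinger :: "(complex \<Rightarrow> complex) \<Rightarrow> complex \<Rightarrow> complex" where
  "wirtinger f \<tau> = 1 / 2 * (partial_u f \<tau> - \<i> * partial_v f \<tau>)"

definition Dop :: "(complex \<Rightarrow> complex) \<Rightarrow> complex \<Rightarrow> complex" where
  "Dop f \<tau> = 1 / (2 * of_real pi * \<i>) * wirtinger f \<tau>"

end

theory Submission
  imports Defs
begin

text \<open>Along $z = \lambda\tau + \mu$ every constituent of $\widehat{\mathcal E}_{2-a}$ becomes a
  sum over $m$ of values at $m\tau$ (or $-m\overline\tau$) of derivatives of the kernel
  $e^{2\pi i s w}/(1 - e^{2\pi i w}) = \sum_{l \ge 0} e^{2\pi i (l+s) w}$ with $0 < s \le 1$. In
  particular $\mathcal{E}^-_{2-a}$ is, up to a constant, a polynomial in $v$ of degree at most $a - 2$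
  with antiholomorphic coefficients, so it is annihilated by $D^{a-1}$. Since $D v = -1/(4\pi)$,
  what remains after applying $D^{a-1}$ is $-B_a(\{\lambda\})/a$ and two series of
  $(a-1)$-st derivatives of the kernel. On the side of the Eisenstein series, the sum over $d$ for
  fixed $c$ is identified with these: for $c \ne 0$ by the Lipschitz formula twisted by
  $e^{-2\pi i d \lambda}$, for $c = 0$ by its limit as $w \to 0$. The untwisted formula comes
  from differentiating the reflection formula of the Gamma function; the twist by a rational
  $\lambda$ follows by averaging over residue classes.\<close>

section \<open>The exponential function and the geometric kernel\<close>

text \<open>The exponents are kept in \<open>0 < s \<le> 1\<close>, with 1 instead of 0 for integral
  lam, because only positive exponents make the kernel decay, and the decay permits summation over
  all multiples of \<tau>. The price is the exponent 0, which occurs exactly for integral lam: its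
  terms are \<open>e2pi (\<plusminus> m * \<mu>) / m ^ (a - 1)\<close>, free of \<tau>. They add up
  to polylogarithm constants that D removes, but for a = 2 they converge only conditionally, and not
  at all for integral \<mu>; this is where the excluded case enters. Since \<open>Gamma_star\<close>
  is a truncated exponential, the nonholomorphic part is built from Taylor polynomials of the kernel
  series about \<open>- cnj \<tau>\<close>, taken at \<open>- \<tau>\<close>; their a - 1 terms
  account for the degree in v. In weight 2 the prescribed order of summation is exactly the one by
  rows. A row with c \<noteq> 0 is a kernel derivative at a height proportional to |c|, hence
  exponentially small. Both sides end as derivatives of the same \<open>kernel_series\<close>, so no
  Fourier coefficients have to be compared.\<close>

lemma e2pi_add: "e2pi (x + y) = e2pi x * e2pi y"
  by (simp add: e2pi_def distrib_left exp_add)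

lemma e2pi_diff: "e2pi (x - y) = e2pi x / e2pi y"
  by (simp add: e2pi_def right_diff_distrib exp_diff)

lemma e2pi_minus: "e2pi (- x) = inverse (e2pi x)"
  by (simp add: e2pi_def exp_minus)

lemma e2pi_0 [simp]: "e2pi 0 = 1"
  by (simp add: e2pi_def)

lemma e2pi_nz [simp]: "e2pi x \<noteq> 0"
  by (simp add: e2pi_def)

lemma e2pi_of_nat_mult: "e2pi (of_nat n * x) = e2pi x ^ n"
  by (simp add: e2pi_def exp_of_nat_mult [symmetric] algebra_simps)

lemma e2pi_of_int_mult: "e2pi (of_int n * x) = e2pi x powi n"
  by (cases n rule: int_cases4)
     (simp_all add: e2pi_of_nat_mult e2pi_minus power_int_minus)

lemma e2pi_of_int [simp]: "e2pi (of_int n) = 1"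
  using e2pi_of_int_mult[of n 1] by (simp add: e2pi_def)

lemma e2pi_of_nat [simp]: "e2pi (of_nat n) = 1"
  using e2pi_of_int[of "int n"] by simp

lemma norm_e2pi: "norm (e2pi w) = exp (- 2 * pi * Im w)"
  by (simp add: e2pi_def norm_exp_eq_Re)

lemma e2pi_neq_1: "Im w > 0 \<Longrightarrow> e2pi w \<noteq> 1"
  using norm_e2pi[of w] by auto

lemma norm_e2pi_less_1: "Im w > 0 \<Longrightarrow> norm (e2pi w) < 1"
  by (simp add: norm_e2pi)

lemma e2pi_eq_1_iff: "e2pi w = 1 \<longleftrightarrow> w \<in> \<int>"
proof
  assume "e2pi w = 1"
  then obtain n :: int where "Im w = 0" "2 * pi * Re w = of_int (2 * n) * pi"
    unfolding e2pi_def exp_eq_1 by auto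
  hence "w = of_int n" by (simp add: complex_eq_iff)
  thus "w \<in> \<int>" by simp
qed (auto elim!: Ints_cases)

lemma has_field_derivative_e2pi [derivative_intros]:
  "(f has_field_derivative f') (at x within A) \<Longrightarrow>
     ((\<lambda>x. e2pi (f x)) has_field_derivative 2 * of_real pi * \<i> * f' * e2pi (f x)) (at x within A)"
  unfolding e2pi_def by (auto intro!: derivative_eq_intros)

lemma holomorphic_on_e2pi [holomorphic_intros]:
  "f holomorphic_on A \<Longrightarrow> (\<lambda>x. e2pi (f x)) holomorphic_on A"
  unfolding e2pi_def by (intro holomorphic_intros)

definition upper_half_plane :: "complex set" where
  "upper_half_plane = {w. Im w > 0}"

lemma upper_half_plane_iff [simp]: "w \<in> upper_half_plane \<longleftrightarrow> Im w > 0"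
  by (simp add: upper_half_plane_def)

lemma open_upper_half_plane [simp]: "open upper_half_plane"
  by (simp add: upper_half_plane_def open_halfspace_Im_gt)

definition geom_kernel :: "real \<Rightarrow> complex \<Rightarrow> complex" where
  "geom_kernel s w = e2pi (of_real s * w) / (1 - e2pi w)"

lemma holomorphic_geom_kernel: "geom_kernel s holomorphic_on upper_half_plane"
proof -
  have "(\<lambda>w. e2pi (of_real s * w) / (1 - e2pi w)) holomorphic_on upper_half_plane"
    by (intro holomorphic_intros) (use e2pi_neq_1 in fastforce)
  thus ?thesis by (simp add: geom_kernel_def [abs_def])
qed

section \<open>The Lipschitz formula\<close>

text \<open>Both sides of Gamma(z) Gamma(1 - z) = pi / sin(pi z) are differentiated and the common
  nonzero factor pi / sin(pi z) is cancelled.\<close>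

lemma Digamma_reflection:
  fixes z :: complex
  assumes "z \<notin> \<int>"
  shows "Digamma z - Digamma (1 - z) = - (of_real pi * cot (of_real pi * z))"
proof -
  have nz: "sin (of_real pi * z) \<noteq> 0"
  proof
    assume "sin (of_real pi * z) = 0"
    then obtain n :: int where "of_real pi * z = of_real (real_of_int n * pi)"
      unfolding sin_eq_0 by blast
    hence "z = of_int n" by (simp add: field_simps)
    thus False using assms by simp
  qed
  have z: "z \<notin> \<int>\<^sub>\<le>\<^sub>0" "1 - z \<notin> \<int>\<^sub>\<le>\<^sub>0"
    using assms by (auto dest!: nonpos_Ints_Int elim!: Ints_cases simp: algebra_simps)
       (metis Ints_1 Ints_diff Ints_of_int add_diff_cancel_left' diff_add_cancel)
  have "((\<lambda>z. Gamma z * Gamma (1 - z)) has_field_derivative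
          Gamma z * Gamma (1 - z) * (Digamma z - Digamma (1 - z))) (at z)"
    using z by (auto intro!: derivative_eq_intros simp: algebra_simps)
  moreover have "((\<lambda>z. of_real pi / sin (of_real pi * z)) has_field_derivative
          - (of_real pi / sin (of_real pi * z) * (of_real pi * cot (of_real pi * z)))) (at z)"
    using nz by (auto intro!: derivative_eq_intros simp: cot_def divide_simps power2_eq_square)
  ultimately have "of_real pi / sin (of_real pi * z) * (Digamma z - Digamma (1 - z)) =
          - (of_real pi / sin (of_real pi * z) * (of_real pi * cot (of_real pi * z)))"
    unfolding Gamma_reflection_complex by (rule DERIV_unique)
  hence "of_real pi / sin (of_real pi * z) * (Digamma z - Digamma (1 - z)) =
           of_real pi / sin (of_real pi * z) * - (of_real pi * cot (of_real pi * z))"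
    by simp
  thus ?thesis using nz by (subst (asm) mult_left_cancel) auto
qed

text \<open>The summed form of the expansion -pi i - 2 pi i (q + q^2 + ...) of the cotangent in q =
  \<open>e2pi z\<close>. Here the kernel enters, with s = 1.\<close>

lemma cot_eq_geom_kernel:
  assumes "Im z > 0"
  shows "of_real pi * cot (of_real pi * z) =
           - (of_real pi * \<i>) - 2 * of_real pi * \<i> * geom_kernel 1 z"
proof -
  \<comment> \<open>A square root of \<open>e2pi z\<close>: sine and cosine are rational in it, and
    their quotient depends only on its square.\<close>
  define x where "x = exp (\<i> * (of_real pi * z))"
  have x: "x * x = e2pi z" "x \<noteq> 0" by (simp_all add: x_def e2pi_def exp_add [symmetric] algebra_simps)
  have "x * x \<noteq> 1" using e2pi_neq_1[OF assms] x by simp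
  have "cot (of_real pi * z) = \<i> * (x + inverse x) / (x - inverse x)"
  proof -
    have "p / 2 / (d / (2 * \<i>)) = \<i> * p / d" for p d :: complex by (simp add: divide_simps)
    thus ?thesis by (simp only: cot_def cos_exp_eq sin_exp_eq x_def [symmetric] exp_minus)
  qed
  also have "\<dots> = \<i> * (x * x + 1) / (x * x - 1)"
    using x \<open>x * x \<noteq> 1\<close> by (simp add: divide_simps)
  finally have "cot (of_real pi * z) = \<i> * (e2pi z + 1) / (e2pi z - 1)"
    by (simp only: x(1))
  moreover have "p * (\<i> * (y + 1) / (y - 1)) = - (p * \<i>) - 2 * p * \<i> * (y / (1 - y))"
    if "y \<noteq> 1" for p y :: complex
  proof -
    have "y / (1 - y) = - y / (y - 1)" using that by (simp add: divide_simps algebra_simps)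
    thus ?thesis using that by (simp add: field_simps)
  qed
  ultimately show ?thesis using e2pi_neq_1[OF assms] by (simp add: geom_kernel_def)
qed

text \<open>The n-th derivative of the Digamma reflection formula with the cotangent replaced by the
  kernel; \<open>n > 0\<close> removes the constant pi i.\<close>

lemma Polygamma_reflection:
  assumes "Im z > 0" "n > 0"
  shows "Polygamma n z - (-1) ^ n * Polygamma n (1 - z) =
           2 * of_real pi * \<i> * (deriv ^^ n) (geom_kernel 1) z"
proof -
  let ?H = upper_half_plane
  have notint: "w \<notin> \<int>" if "Im w > 0 \<or> Im w < 0" for w :: complex
    using that by (auto elim!: Ints_cases)
  \<comment> \<open>Both half planes are needed: \<open>1 - w\<close> lies in the lower one when w
    lies in the upper one.\<close>
  have holP: "Digamma holomorphic_on {w. Im w \<noteq> 0}"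
    by (intro holomorphic_intros) (auto elim!: nonpos_Ints_cases)
  have op: "open {w. Im w \<noteq> 0}"
    by (intro open_Collect_neq continuous_intros)
  have hol1: "Digamma holomorphic_on ?H"
    by (rule holomorphic_on_subset[OF holP]) auto
  have hol2: "(\<lambda>w. Digamma (-1 * w + 1)) holomorphic_on ?H"
    by (rule holomorphic_on_compose_gen[OF _ holP, unfolded o_def]) (auto intro!: holomorphic_intros)
  have "(deriv ^^ n) (\<lambda>w. Digamma w - Digamma (-1 * w + 1)) z =
        (deriv ^^ n) (\<lambda>w. of_real pi * \<i> + 2 * of_real pi * \<i> * geom_kernel 1 w) z"
  proof (rule higher_deriv_transform_within_open[of _ ?H])
    show "Digamma w - Digamma (- 1 * w + 1) = of_real pi * \<i> + 2 * of_real pi * \<i> * geom_kernel 1 w"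
      if "w \<in> ?H" for w
      using Digamma_reflection[OF notint[of w]] that cot_eq_geom_kernel[of w] by simp
  qed (use assms hol1 hol2 in \<open>auto intro!: holomorphic_intros holomorphic_geom_kernel\<close>)
  also have "(deriv ^^ n) (\<lambda>w. of_real pi * \<i> + 2 * of_real pi * \<i> * geom_kernel 1 w) z =
             2 * of_real pi * \<i> * (deriv ^^ n) (geom_kernel 1) z"
  proof -
    have hol: "geom_kernel 1 holomorphic_on ?H" by (rule holomorphic_geom_kernel)
    have "(deriv ^^ n) (\<lambda>w. of_real pi * \<i> + 2 * of_real pi * \<i> * geom_kernel 1 w) z =
          (deriv ^^ n) (\<lambda>w. of_real pi * \<i>) z + (deriv ^^ n) (\<lambda>w. 2 * of_real pi * \<i> * geom_kernel 1 w) z"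
      by (rule higher_deriv_add[of _ ?H]) (use assms in \<open>auto intro!: holomorphic_intros hol\<close>)
    also have "(deriv ^^ n) (\<lambda>w. 2 * of_real pi * \<i> * geom_kernel 1 w) z =
                 2 * of_real pi * \<i> * (deriv ^^ n) (geom_kernel 1) z"
      by (rule higher_deriv_cmult[OF hol]) (use assms in auto)
    finally show ?thesis using assms by simp
  qed
  also have "(deriv ^^ n) (\<lambda>w. Digamma w - Digamma (-1 * w + 1)) z =
             (deriv ^^ n) Digamma z - (-1) ^ n * (deriv ^^ n) Digamma (-1 * z + 1)"
  proof -
    have "(deriv ^^ n) (\<lambda>w. Digamma (-1 * w + 1)) z = (-1) ^ n * (deriv ^^ n) Digamma (-1 * z + 1)"
      by (rule higher_deriv_compose_linear'[OF holP _ op, where S = ?H]) (use assms in auto)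
    moreover have "(deriv ^^ n) (\<lambda>w. Digamma w - Digamma (-1 * w + 1)) z =
                     (deriv ^^ n) Digamma z - (deriv ^^ n) (\<lambda>w. Digamma (-1 * w + 1)) z"
      by (rule higher_deriv_diff[OF hol1 hol2]) (use assms in auto)
    ultimately show ?thesis by (simp only:)
  qed
  also have "(deriv ^^ n) Digamma z = Polygamma n z"
    using notint[of z] assms by (subst higher_deriv_Polygamma) (auto dest: nonpos_Ints_Int)
  also have "(deriv ^^ n) Digamma (-1 * z + 1) = Polygamma n (1 - z)"
    using notint[of "1 - z"] assms by (subst higher_deriv_Polygamma) (auto dest: nonpos_Ints_Int)
  finally show ?thesis .
qed

text \<open>Once k > 2 |z|, |z + k| is at least k / 2. The finitely many earlier terms, possibly
  with denominator zero, do not affect summability.\<close>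

lemma summable_norm_inverse_shift_power:
  fixes z :: complex
  assumes "n \<ge> 2"
  shows "summable (\<lambda>k. norm (inverse ((z + of_nat k) ^ n)))"
proof (rule summable_comparison_test_ev)
  show "summable (\<lambda>k. 2 ^ n * inverse (real k ^ n))"
    using inverse_power_summable[OF assms, where 'a = real] by (intro summable_mult) simp
  show "\<forall>\<^sub>F k in sequentially. norm (norm (inverse ((z + of_nat k) ^ n))) \<le> 2 ^ n * inverse (real k ^ n)"
    using eventually_gt_at_top[of "nat \<lceil>2 * norm z\<rceil>"]
  proof eventually_elim
    case (elim k)
    hence k: "real k > 2 * norm z" by linarith
    have "real k - norm z \<le> norm (z + of_nat k)"
      using norm_diff_ineq[of "of_nat k :: complex" z] by (simp add: add.commute)
    hence "real k / 2 \<le> norm (z + of_nat k)" using k by simp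
    moreover have "real k > 0" using k norm_ge_zero[of z] by linarith
    ultimately have "inverse (norm (z + of_nat k) ^ n) \<le> inverse ((real k / 2) ^ n)"
      by (intro le_imp_inverse_le power_mono) auto
    also have "\<dots> = 2 ^ n * inverse (real k ^ n)"
      unfolding power_divide inverse_divide by (rule divide_inverse)
    finally show ?case by (simp add: norm_inverse norm_power)
  qed
qed

lemma has_sum_int_split:
  fixes f :: "int \<Rightarrow> 'a :: topological_comm_monoid_add"
  assumes "((\<lambda>k. f (int k)) has_sum a) UNIV" "((\<lambda>k. f (- int (Suc k))) has_sum b) UNIV"
  shows "(f has_sum (a + b)) UNIV"
proof -
  have "bij_betw int UNIV {0..}"
    by (rule bij_betwI[of _ _ _ nat]) auto
  hence 1: "(f has_sum a) {0..}"
    using assms(1) by (simp only: has_sum_reindex_bij_betw)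
  have "bij_betw (\<lambda>k. - int (Suc k)) UNIV {..<0}"
    by (rule bij_betwI[of _ _ _ "\<lambda>d. nat (- d - 1)"]) auto
  from has_sum_reindex_bij_betw[OF this, of f b] have 2: "(f has_sum b) {..<0}"
    using assms(2) by (simp only:)
  have "(f has_sum (a + b)) ({0..} \<union> {..<0})"
    by (rule has_sum_Un_disjoint[OF 1 2]) auto
  moreover have "{0..} \<union> {..<0} = (UNIV :: int set)" by auto
  ultimately show ?thesis by (simp only:)
qed

text \<open>For d = -(k + 1) one has z + d = -(1 - z + k). The bilateral sum therefore consists of
  two Hurwitz type series at z and 1 - z, the two arguments of the reflection formula.\<close>

lemma has_sum_inverse_shift_power_int:
  fixes z :: complex
  assumes "n \<ge> 2"
  shows "((\<lambda>d. 1 / (z + of_int d) ^ n) has_sum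
            (\<Sum>k. inverse ((z + of_nat k) ^ n)) + (-1) ^ n * (\<Sum>k. inverse ((1 - z + of_nat k) ^ n))) UNIV"
proof (rule has_sum_int_split)
  have *: "((\<lambda>k. inverse ((w + of_nat k) ^ n)) has_sum (\<Sum>k. inverse ((w + of_nat k) ^ n))) UNIV"
    for w :: complex
    by (rule norm_summable_imp_has_sum[OF summable_norm_inverse_shift_power[OF assms]])
       (rule summable_sums[OF summable_norm_cancel[OF summable_norm_inverse_shift_power[OF assms]]])
  show "((\<lambda>k. 1 / (z + of_int (int k)) ^ n) has_sum (\<Sum>k. inverse ((z + of_nat k) ^ n))) UNIV"
    using *[of z] by (simp only: of_int_of_nat_eq inverse_eq_divide)
  have eq: "1 / (z + of_int (- int (Suc k))) ^ n = (-1) ^ n * inverse ((1 - z + of_nat k) ^ n)" for k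
  proof -
    have minus: "1 / (- u) ^ n = (-1) ^ n * inverse (u ^ n)" for u :: complex
    proof -
      have "1 / (- u) ^ n = inverse (- u) ^ n"
        unfolding power_inverse by (rule inverse_eq_divide [symmetric])
      also have "\<dots> = (- inverse u) ^ n" by (simp only: inverse_minus_eq)
      also have "\<dots> = (-1) ^ n * inverse u ^ n" by (rule power_minus)
      finally show ?thesis unfolding power_inverse .
    qed
    have "z + of_int (- int (Suc k)) = - (1 - z + of_nat k)" by simp
    thus ?thesis by (metis minus)
  qed
  show "((\<lambda>k. 1 / (z + of_int (- int (Suc k))) ^ n) has_sum
          (-1) ^ n * (\<Sum>k. inverse ((1 - z + of_nat k) ^ n))) UNIV"
    using has_sum_cmult_right[OF *[of "1 - z"], of "(-1) ^ n"] by (simp only: eq)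
qed

text \<open>Two factors meet here: \<open>(-1) ^ n / fact n\<close> from the n-th derivative of 1 /
  (w + d), and -2 pi i from the kernel in the expansion of pi cot(pi w).\<close>

definition lipschitz_const :: "nat \<Rightarrow> complex" where
  "lipschitz_const n = - 2 * of_real pi * \<i> * (-1) ^ n / fact n"

text \<open>For n > 0 \<open>Polygamma n\<close> is itself a series of inverse powers, up to the
  factor \<open>- (-1) ^ n * fact n\<close>, so the reflection formula is this statement. The right
  side stays an unexpanded derivative because the averaging below works on the kernel
  itself.\<close>

theorem Lipschitz_formula:
  assumes "Im w > 0" "n > 0"
  shows "((\<lambda>d. 1 / (w + of_int d) ^ Suc n) has_sum
            lipschitz_const n * (deriv ^^ n) (geom_kernel 1) w) UNIV"
proof -
  define A where "A = (\<lambda>z::complex. \<Sum>k. inverse ((z + of_nat k) ^ Suc n))"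
  define u where "u = (-1 :: complex) ^ n"
  have P: "Polygamma n z = - u * fact n * A z" for z :: complex
    using assms(2) by (simp add: Polygamma_def A_def u_def)
  have u: "u * u = 1" by (simp add: u_def flip: power_mult_distrib)
  have refl: "- u * fact n * A w - u * (- u * fact n * A (1 - w)) =
           2 * of_real pi * \<i> * (deriv ^^ n) (geom_kernel 1) w"
    using Polygamma_reflection[OF assms] unfolding P u_def .
  have "A w + - u * A (1 - w) = - K * u / F"
    if "F \<noteq> 0" "- u * F * A w - u * (- u * F * A (1 - w)) = K" for F K
  proof -
    have "- K * u = (u * u) * F * (A w - u * A (1 - w))"
      unfolding that(2) [symmetric] by (simp add: algebra_simps)
    thus ?thesis using that(1) unfolding u by simp
  qed
  from this[OF _ refl] have "A w + - u * A (1 - w) =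
           - (2 * of_real pi * \<i> * (deriv ^^ n) (geom_kernel 1) w) * u / fact n"
    by simp
  hence eq: "A w + - u * A (1 - w) =
           lipschitz_const n * (deriv ^^ n) (geom_kernel 1) w"
    by (simp add: lipschitz_const_def u_def mult_ac)
  have "((\<lambda>d. 1 / (w + of_int d) ^ Suc n) has_sum (A w + (-1) ^ Suc n * A (1 - w))) UNIV"
    unfolding A_def by (rule has_sum_inverse_shift_power_int) (use assms(2) in simp)
  moreover have "(-1) ^ Suc n = - u" by (simp add: u_def)
  ultimately show ?thesis using eq unfolding u_def by metis
qed

section \<open>Averages over residue classes\<close>

text \<open>The representative of x modulo 1 in the half-open interval from 0 (excluded) to 1
  (included). Written through \<open>frac (- x)\<close>, it gives
  \<open>upper_frac (- x) = 1 - frac x\<close> at once, the exponent that belongs to negative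
  indices.\<close>

definition upper_frac :: "real \<Rightarrow> real" where
  "upper_frac x = 1 - frac (- x)"

lemma upper_frac_pos: "upper_frac x > 0" and upper_frac_le_1: "upper_frac x \<le> 1"
  using frac_lt_1[of "- x"] frac_ge_0[of "- x"] by (auto simp: upper_frac_def)

lemma upper_frac_diff_Ints: "x - upper_frac x \<in> \<int>"
proof -
  have "x - upper_frac x = of_int (- 1 - \<lfloor>- x\<rfloor>)"
    by (simp add: upper_frac_def frac_def)
  thus ?thesis by (simp only: Ints_of_int)
qed

lemma upper_frac_unique:
  assumes "0 < y" "y \<le> 1" "x - y \<in> \<int>"
  shows "upper_frac x = y"
proof -
  obtain k where k: "x - y = of_int k" using assms(3) by (elim Ints_cases)
  obtain l where l: "x - upper_frac x = of_int l" using upper_frac_diff_Ints[of x] by (elim Ints_cases)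
  have "of_int (k - l) = upper_frac x - y" using k l by simp
  moreover have "\<bar>upper_frac x - y\<bar> < 1"
    using assms upper_frac_pos[of x] upper_frac_le_1[of x] by linarith
  ultimately have "\<bar>real_of_int (k - l)\<bar> < 1" by metis
  hence "k = l" by linarith
  thus ?thesis using k l by simp
qed

lemma upper_frac_eq: "upper_frac x = (if x \<in> \<int> then 1 else frac x)"
proof (cases "x \<in> \<int>")
  case True
  thus ?thesis by (intro upper_frac_unique) auto
next
  case False
  hence "frac x > 0" using frac_eq_0_iff[of x] frac_ge_0[of x] by linarith
  moreover have "x - frac x \<in> \<int>" by (simp add: frac_def)
  ultimately show ?thesis using False frac_lt_1[of x] by (intro upper_frac_unique) auto
qed

lemma higher_deriv_sum:
  fixes f :: "'i \<Rightarrow> complex \<Rightarrow> complex"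
  assumes "finite I" "\<And>i. i \<in> I \<Longrightarrow> f i holomorphic_on S" "open S" "z \<in> S"
  shows "(deriv ^^ n) (\<lambda>w. \<Sum>i\<in>I. f i w) z = (\<Sum>i\<in>I. (deriv ^^ n) (f i) z)"
  using assms(1,2)
proof (induction I rule: finite_induct)
  case empty
  show ?case by simp
next
  case (insert i I)
  have "(deriv ^^ n) (\<lambda>w. f i w + (\<Sum>i\<in>I. f i w)) z =
          (deriv ^^ n) (f i) z + (deriv ^^ n) (\<lambda>w. \<Sum>i\<in>I. f i w) z"
    using insert.prems by (intro higher_deriv_add[of _ S] holomorphic_on_sum assms(3,4)) auto
  thus ?case using insert by simp
qed

lemma sum_power_root_of_unity:
  fixes x :: "'a :: field_char_0"
  assumes "x ^ N = 1"
  shows "(\<Sum>m<N. x ^ m) = (if x = 1 then of_nat N else 0)"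
  using assms by (simp add: sum_gp_strict)

text \<open>Finite Fourier inversion. Over the common denominator 1 - \<open>e2pi w\<close>, the
  kernel at (w + m) / N is a sum of powers j = 1, ..., N of an N-th root of \<open>e2pi w\<close>;
  averaging against the character of lam keeps only the j with j / N congruent to lam modulo
  1.\<close>

lemma geom_kernel_root_average:
  assumes "Im w > 0" "N > 0" "of_nat N * lam \<in> \<int>"
  shows "geom_kernel (upper_frac lam) w =
           (\<Sum>m<N. e2pi (- (of_nat m * of_real lam)) / of_nat N * geom_kernel 1 ((w + of_nat m) / of_nat N))"
proof -
  define s where "s = upper_frac lam"
  obtain l where l: "of_nat N * lam = of_int l" using assms(3) by (elim Ints_cases)
  obtain k where k: "lam - s = of_int k"
    using upper_frac_diff_Ints[of lam] unfolding s_def by (elim Ints_cases)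
  have s: "0 < s" "s \<le> 1" using upper_frac_pos upper_frac_le_1 by (auto simp: s_def)
  have Ns: "of_nat N * s = of_int (l - int N * k)"
    using k l by (simp add: algebra_simps)
  \<comment> \<open>The surviving exponent N * s. It lies between 1 and N since
    \<open>0 < s \<le> 1\<close>, which is why the powers are numbered from 1 to N and not from 0 to
    N - 1.\<close>
  define j0 where "j0 = nat (l - int N * k)"
  have "real N * s > 0" "real N * s \<le> real N" using s assms(2) by auto
  hence j0: "real j0 = real N * s" "0 < j0" "j0 \<le> N"
    unfolding j0_def Ns by linarith+
  have "complex_of_real (real j0) = of_real (real N * s)" by (simp only: j0)
  hence j0_div: "of_nat j0 / of_nat N = complex_of_real s"
    using assms(2) by (simp add: divide_simps mult.commute)
  define x where "x = (\<lambda>m. e2pi ((w + of_nat m) / of_nat N))"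
  have xN: "x m ^ N = e2pi w" for m
  proof -
    have "of_nat N * ((w + of_nat m) / of_nat N) = w + of_nat m" using assms(2) by simp
    hence "x m ^ N = e2pi (w + of_nat m)" by (simp only: x_def e2pi_of_nat_mult [symmetric])
    thus ?thesis by (simp add: e2pi_add)
  qed
  have w1: "e2pi w \<noteq> 1" by (rule e2pi_neq_1) fact
  have x1: "x m \<noteq> 1" for m using xN[of m] w1 by auto
  \<comment> \<open>x / (1 - x) is extended by 1 + x + ... + x^(N-1), so that the denominator 1 -
    x^N no longer depends on m.\<close>
  have ker: "geom_kernel 1 ((w + of_nat m) / of_nat N) = (\<Sum>j=1..N. x m ^ j) / (1 - e2pi w)" for m
  proof -
    have "(\<Sum>j=1..N. x m ^ j) = x m * (1 - x m ^ N) / (1 - x m)"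
      using x1[of m] assms(2) by (subst sum_gp) (simp add: algebra_simps)
    thus ?thesis using w1 x1[of m] unfolding geom_kernel_def xN by (simp add: x_def)
  qed
  have inner: "(\<Sum>m<N. e2pi (- (of_nat m * of_real lam)) * x m ^ j) =
                 (if j = j0 then of_nat N * e2pi (of_real s * w) else 0)" if j: "j \<in> {1..N}" for j
  proof -
    define u where "u = of_nat j / of_nat N - complex_of_real lam"
    have "e2pi (- (of_nat m * of_real lam)) * x m ^ j = e2pi (of_nat j * w / of_nat N) * e2pi u ^ m" for m
      unfolding x_def e2pi_of_nat_mult [symmetric] e2pi_add [symmetric]
      by (rule arg_cong[of _ _ e2pi]) (use assms(2) in \<open>simp add: u_def field_simps\<close>)
    hence "(\<Sum>m<N. e2pi (- (of_nat m * of_real lam)) * x m ^ j) =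
             e2pi (of_nat j * w / of_nat N) * (\<Sum>m<N. e2pi u ^ m)"
      by (simp add: sum_distrib_left)
    also have "(\<Sum>m<N. e2pi u ^ m) = (if e2pi u = 1 then of_nat N else 0)"
    proof (rule sum_power_root_of_unity)
      have "of_nat N * u = of_nat j - of_real (of_nat N * lam)"
        using assms(2) by (simp add: u_def right_diff_distrib)
      hence "of_nat N * u = of_int (int j - l)" unfolding l by simp
      thus "e2pi u ^ N = 1" unfolding e2pi_of_nat_mult [symmetric] by (simp only: e2pi_of_int)
    qed
    also have "(e2pi u = 1) = (j = j0)"
    proof
      assume "j = j0"
      hence "u = complex_of_real (s - lam)"
        by (simp add: u_def j0_div)
      also have "s - lam = of_int (- k)" using k by simp
      finally show "e2pi u = 1" by (simp only: of_real_of_int_eq e2pi_of_int)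
    next
      assume "e2pi u = 1"
      hence "u \<in> \<int>" by (simp add: e2pi_eq_1_iff)
      moreover have "u = complex_of_real (real j / real N - lam)" by (simp add: u_def)
      ultimately obtain i where "complex_of_real (real j / real N - lam) = of_int i"
        by (metis Ints_cases)
      hence "real j / real N - lam = of_int i" by (metis of_real_eq_iff of_real_of_int_eq)
      hence "lam - real j / real N = of_int (- i)" by simp
      hence "lam - real j / real N \<in> \<int>" by (metis Ints_of_int)
      hence "s = real j / real N" unfolding s_def using j assms(2)
        by (intro upper_frac_unique) auto
      hence "real j = real j0" using j0(1) assms(2) by simp
      thus "j = j0" by simp
    qed
    also have "e2pi (of_nat j * w / of_nat N) * (if j = j0 then of_nat N else 0) =
                 (if j = j0 then of_nat N * e2pi (of_real s * w) else 0)"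
    proof -
      have "of_nat j0 * w / of_nat N = complex_of_real s * w"
        unfolding j0_div [symmetric] by simp
      thus ?thesis by auto
    qed
    finally show ?thesis .
  qed
  have "(\<Sum>m<N. e2pi (- (of_nat m * of_real lam)) / of_nat N * geom_kernel 1 ((w + of_nat m) / of_nat N)) =
          (\<Sum>j=1..N. \<Sum>m<N. e2pi (- (of_nat m * of_real lam)) * x m ^ j) / (of_nat N * (1 - e2pi w))"
    unfolding ker by (subst sum.swap) (simp add: sum_distrib_left sum_divide_distrib)
  also have "(\<Sum>j=1..N. \<Sum>m<N. e2pi (- (of_nat m * of_real lam)) * x m ^ j) = of_nat N * e2pi (of_real s * w)"
    using inner j0 by (simp add: sum.delta)
  finally show ?thesis using assms(2) by (simp add: geom_kernel_def s_def)
qed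

lemma higher_deriv_geom_kernel_linear:
  assumes "Im w > 0" "r > 0" 
  shows "(deriv ^^ n) (\<lambda>w. geom_kernel s (of_real r * w + of_real c)) w =
           of_real r ^ n * (deriv ^^ n) (geom_kernel s) (of_real r * w + of_real c)"
  by (rule higher_deriv_compose_linear'[OF holomorphic_geom_kernel, of upper_half_plane]) (use assms in auto)

text \<open>One factor 1 / N is the averaging weight, the other n come from the chain rule. The
  resulting power N^(-(n+1)) is the one produced by scaling a residue class in the Lipschitz
  formula.\<close>

lemma higher_deriv_geom_kernel_root_average:
  assumes "Im w > 0" "N > 0" "of_nat N * lam \<in> \<int>"
  shows "(\<Sum>m<N. e2pi (- (of_nat m * of_real lam)) *
            (1 / of_nat N ^ Suc n * (deriv ^^ n) (geom_kernel 1) ((w + of_nat m) / of_nat N))) =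
         (deriv ^^ n) (geom_kernel (upper_frac lam)) w"
proof -
  let ?g = "\<lambda>m w. geom_kernel 1 ((w + of_nat m) / of_nat N)"
  let ?f = "\<lambda>m w. e2pi (- (of_nat m * of_real lam)) / of_nat N * ?g m w"
  have hol: "?g m holomorphic_on upper_half_plane" for m
    by (rule holomorphic_on_compose_gen[OF _ holomorphic_geom_kernel, unfolded o_def])
       (use assms(2) in \<open>auto intro!: holomorphic_intros simp: Im_divide_of_nat\<close>)
  have eq: "of_real (1 / real N) * w + of_real (real m / real N) = (w + of_nat m) / of_nat N"
    for w :: complex and m
    by (simp add: add_divide_distrib)
  have g: "(deriv ^^ n) (?g m) w = of_real (1 / real N) ^ n * (deriv ^^ n) (geom_kernel 1) ((w + of_nat m) / of_nat N)" for m
    using higher_deriv_geom_kernel_linear[OF assms(1), of "1 / real N" n 1 "real m / real N"] assms(2)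
    unfolding eq by simp
  have "(deriv ^^ n) (geom_kernel (upper_frac lam)) w = (deriv ^^ n) (\<lambda>w. \<Sum>m<N. ?f m w) w"
  proof (rule higher_deriv_transform_within_open[of _ upper_half_plane])
    show "geom_kernel (upper_frac lam) w = (\<Sum>m<N. ?f m w)" if "w \<in> upper_half_plane" for w
      by (rule geom_kernel_root_average) (use that assms in auto)
    show "(\<lambda>w. \<Sum>m<N. ?f m w) holomorphic_on upper_half_plane"
      by (intro holomorphic_on_sum holomorphic_on_mult hol) auto
  qed (use assms in \<open>auto intro!: holomorphic_geom_kernel\<close>)
  also have "(deriv ^^ n) (\<lambda>w. \<Sum>m<N. ?f m w) w = (\<Sum>m<N. (deriv ^^ n) (?f m) w)"
    by (rule higher_deriv_sum[of _ _ upper_half_plane])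
       (use assms in \<open>auto intro!: holomorphic_on_mult[OF holomorphic_on_const hol] simp del: times_divide_eq_left\<close>)
  also have "\<dots> = (\<Sum>m<N. e2pi (- (of_nat m * of_real lam)) *
            (1 / of_nat N ^ Suc n * (deriv ^^ n) (geom_kernel 1) ((w + of_nat m) / of_nat N)))"
  proof (rule sum.cong[OF refl])
    fix m
    show "(deriv ^^ n) (?f m) w = e2pi (- (of_nat m * of_real lam)) *
            (1 / of_nat N ^ Suc n * (deriv ^^ n) (geom_kernel 1) ((w + of_nat m) / of_nat N))"
      using higher_deriv_cmult[OF hol[of m], of w n "e2pi (- (of_nat m * of_real lam)) / of_nat N"] assms
      by (simp add: g power_one_over mult_ac)
  qed
  finally show ?thesis ..
qed

text \<open>With d = m + N k one has w + d = N ((w + m) / N + k), so the class sum is a scaled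
  instance of the full formula at (w + m) / N.\<close>

lemma has_sum_residue_class:
  assumes "Im w > 0" "n > 0" "N > 0"
  shows "((\<lambda>d. 1 / (w + of_int d) ^ Suc n) has_sum
            lipschitz_const n *
            (1 / of_nat N ^ Suc n * (deriv ^^ n) (geom_kernel 1) ((w + of_int m) / of_nat N)))
          {d. [d = m] (mod int N)}"
proof -
  have "bij_betw (\<lambda>k. m + int N * k) UNIV {d. [d = m] (mod int N)}"
  proof (rule bij_betwI[of _ _ _ "\<lambda>d. (d - m) div int N"])
    show "(\<lambda>k. m + int N * k) \<in> UNIV \<rightarrow> {d. [d = m] (mod int N)}"
      by (simp add: cong_def)
    show "m + int N * ((d - m) div int N) = d" if "d \<in> {d. [d = m] (mod int N)}" for d
    proof -
      have "int N dvd d - m" using that by (simp only: mem_Collect_eq cong_iff_dvd_diff)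
      from dvd_mult_div_cancel[OF this] show ?thesis by linarith
    qed
    show "(m + int N * k - m) div int N = k" for k
      using assms(3) by simp
  qed auto
  note reindex = has_sum_reindex_bij_betw[OF this, of "\<lambda>d. 1 / (w + of_int d) ^ Suc n"]
  have "Im ((w + of_int m) / of_nat N) > 0"
    using assms by (simp add: Im_divide_of_nat)
  note L = Lipschitz_formula[OF this assms(2)]
  have factor: "1 / (w + of_int (m + int N * k)) ^ Suc n =
               1 / of_nat N ^ Suc n * (1 / ((w + of_int m) / of_nat N + of_int k) ^ Suc n)" for k
  proof -
    have "c * (x / c + y) = x + c * y" if "c \<noteq> 0" for c x y :: complex
      using that by (simp add: distrib_left)
    from this[of "of_nat N" "w + of_int m" "of_int k"]
    have "w + of_int (m + int N * k) = of_nat N * ((w + of_int m) / of_nat N + of_int k)"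
      using assms(3) by simp
    moreover have "1 / (c * x) ^ Suc n = 1 / c ^ Suc n * (1 / x ^ Suc n)" for c x :: complex
      by (simp add: power_mult_distrib)
    ultimately show ?thesis by presburger
  qed
  from has_sum_cmult_right[OF L, of "1 / of_nat N ^ Suc n"]
  have "((\<lambda>k. 1 / (w + of_int (m + int N * k)) ^ Suc n) has_sum
          1 / of_nat N ^ Suc n * (lipschitz_const n *
            (deriv ^^ n) (geom_kernel 1) ((w + of_int m) / of_nat N))) UNIV"
    unfolding factor .
  hence "((\<lambda>d. 1 / (w + of_int d) ^ Suc n) has_sum
          1 / of_nat N ^ Suc n * (lipschitz_const n *
            (deriv ^^ n) (geom_kernel 1) ((w + of_int m) / of_nat N))) {d. [d = m] (mod int N)}"
    unfolding reindex .
  thus ?thesis unfolding mult.left_commute[of "1 / of_nat N ^ Suc n"] .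
qed

section \<open>Termwise differentiation\<close>

lemma higher_deriv_e2pi_mult:
  "(deriv ^^ k) (\<lambda>w. e2pi (c * w)) = (\<lambda>w. (2 * of_real pi * \<i> * c) ^ k * e2pi (c * w))"
proof (induction k)
  case (Suc k)
  have "deriv (\<lambda>w. (2 * of_real pi * \<i> * c) ^ k * e2pi (c * w)) w =
          (2 * of_real pi * \<i> * c) ^ Suc k * e2pi (c * w)" for w
    by (rule DERIV_imp_deriv) (auto intro!: derivative_eq_intros)
  thus ?case by (simp only: funpow.simps o_apply Suc.IH) 
qed auto

text \<open>The Weierstrass test yields uniform convergence on the whole of A, and every derivative
  commutes with uniform limits of holomorphic functions on an open set.\<close>

lemma
  fixes f :: "nat \<Rightarrow> complex \<Rightarrow> complex"
  assumes A: "open A" and f: "\<And>i. f i holomorphic_on A"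
    and bound: "\<And>i x. x \<in> A \<Longrightarrow> norm (f i x) \<le> M i" and M: "summable M"
  shows holomorphic_on_series: "(\<lambda>x. \<Sum>i. f i x) holomorphic_on A"
    and higher_deriv_series_sums: "z \<in> A \<Longrightarrow> (\<lambda>i. (deriv ^^ k) (f i) z) sums (deriv ^^ k) (\<lambda>x. \<Sum>i. f i x) z"
proof -
  have ulim: "uniform_limit A (\<lambda>n x. \<Sum>i<n. f i x) (\<lambda>x. \<Sum>i. f i x) sequentially"
    by (rule Weierstrass_m_test[OF bound M])
  have hol: "(\<lambda>x. \<Sum>i<n. f i x) holomorphic_on A" for n
    by (intro holomorphic_on_sum f)
  show "(\<lambda>x. \<Sum>i. f i x) holomorphic_on A"
  proof (rule holomorphic_uniform_sequence[OF A hol])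
    fix x assume "x \<in> A"
    then obtain d where "d > 0" "cball x d \<subseteq> A"
      using A open_contains_cball by blast
    thus "\<exists>d>0. cball x d \<subseteq> A \<and>
            uniform_limit (cball x d) (\<lambda>n x. \<Sum>i<n. f i x) (\<lambda>x. \<Sum>i. f i x) sequentially"
      using ulim uniform_limit_on_subset by blast
  qed
  assume z: "z \<in> A"
  have "(\<lambda>n. (deriv ^^ k) (\<lambda>x. \<Sum>i<n. f i x) z) \<longlonglongrightarrow> (deriv ^^ k) (\<lambda>x. \<Sum>i. f i x) z"
    by (rule higher_deriv_complex_uniform_limit[OF ulim]) (use hol A z in auto)
  moreover have "(deriv ^^ k) (\<lambda>x. \<Sum>i<n. f i x) z = (\<Sum>i<n. (deriv ^^ k) (f i) z)" for n
    by (rule higher_deriv_sum) (use f A z in auto)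
  ultimately show "(\<lambda>i. (deriv ^^ k) (f i) z) sums (deriv ^^ k) (\<lambda>x. \<Sum>i. f i x) z"
    by (simp add: sums_def)
qed

lemma power_div_fact_le_exp:
  assumes "(x::real) \<ge> 0"
  shows "x ^ n / fact n \<le> exp x"
proof -
  have "(\<lambda>n. x ^ n / fact n) sums exp x"
    using exp_converges[of x] by (simp add: field_simps)
  hence "(\<Sum>i\<in>{n}. x ^ i / fact i) \<le> exp x"
    using assms unfolding sums_iff by (metis (no_types, lifting) finite.emptyI finite.insertI sum_le_suminf
      divide_nonneg_nonneg zero_le_power fact_ge_zero)
  thus ?thesis by simp
qed

lemma summable_power_times_exp:
  fixes s y :: real
  assumes "s > 0" "y > 0"
  shows "summable (\<lambda>l. (real l + s) ^ k * exp (- (y * (real l + s))))"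
proof (rule summable_comparison_test_ev)
  \<comment> \<open>The bound exp x \<ge> x^n / n! with n = k + 2 absorbs the power k and leaves the
    summable 1 / l^2.\<close>
  define n where "n = k + 2"
  have "summable (\<lambda>l. inverse (real l ^ 2))"
    using inverse_power_summable[of 2, where 'a = real] by simp
  thus "summable (\<lambda>l. fact n / y ^ n * inverse (real l ^ 2))" by (rule summable_mult)
  show "\<forall>\<^sub>F l in sequentially. norm ((real l + s) ^ k * exp (- (y * (real l + s)))) \<le>
          fact n / y ^ n * inverse (real l ^ 2)"
    using eventually_gt_at_top[of 0]
  proof eventually_elim
    case (elim l)
    define x where "x = real l + s"
    have x: "x > 0" "x \<ge> real l" using assms elim by (auto simp: x_def)
    have "x ^ k * exp (- (y * x)) = x ^ k / exp (y * x)"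
      by (simp add: exp_minus divide_inverse)
    also have "\<dots> \<le> x ^ k / ((y * x) ^ n / fact n)"
      by (intro divide_left_mono power_div_fact_le_exp) (use assms x in auto)
    also have "(y * x) ^ n = y ^ n * (x ^ k * x ^ 2)"
      by (simp only: n_def power_mult_distrib power_add mult_ac)
    also have "x ^ k / (y ^ n * (x ^ k * x ^ 2) / fact n) = fact n / y ^ n * inverse (x ^ 2)"
      using x by (simp add: divide_simps)
    also have "\<dots> \<le> fact n / y ^ n * inverse (real l ^ 2)"
      using x assms elim by (intro mult_left_mono le_imp_inverse_le power_mono) auto
    finally show ?case using x by (simp add: x_def abs_mult)
  qed
qed

lemma norm_geom_kernel_term:
  assumes "s > 0"
  shows "norm ((2 * of_real pi * \<i> * of_real (real l + s)) ^ k * e2pi (of_real (real l + s) * w)) =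
           (2 * pi) ^ k * ((real l + s) ^ k * exp (- (2 * pi * Im w * (real l + s))))"
proof -
  define x where "x = real l + s"
  have "x > 0" using assms by (simp add: x_def)
  hence "norm (2 * of_real pi * \<i> * of_real x) = 2 * pi * x"
    by (simp add: norm_mult)
  thus ?thesis unfolding x_def [symmetric]
    by (simp add: norm_mult norm_power norm_e2pi power_mult_distrib mult_ac)
qed

lemma summable_norm_geom_kernel_term:
  assumes "s > 0" "Im w > 0"
  shows "summable (\<lambda>l. norm ((2 * of_real pi * \<i> * of_real (real l + s)) ^ k * e2pi (of_real (real l + s) * w)))"
  unfolding norm_geom_kernel_term[OF assms(1)]
  by (intro summable_mult summable_power_times_exp) (use assms in auto)

lemma geom_kernel_sums:
  assumes "Im w > 0"
  shows "(\<lambda>l. e2pi (of_real (real l + s) * w)) sums geom_kernel s w"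
proof -
  have "(\<lambda>l. e2pi (of_real s * w) * e2pi w ^ l) sums (e2pi (of_real s * w) * (1 / (1 - e2pi w)))"
    by (intro sums_mult geometric_sums norm_e2pi_less_1 assms)
  moreover have "e2pi (of_real (real l + s) * w) = e2pi (of_real s * w) * e2pi w ^ l" for l
    by (simp add: distrib_right e2pi_add e2pi_of_nat_mult)
  ultimately show ?thesis by (simp add: geom_kernel_def)
qed

lemma higher_deriv_geom_kernel_sums:
  assumes "s > 0" "Im w > 0"
  shows "(\<lambda>l. (2 * of_real pi * \<i> * of_real (real l + s)) ^ k * e2pi (of_real (real l + s) * w))
           sums (deriv ^^ k) (geom_kernel s) w"
proof -
  \<comment> \<open>A half plane that stays away from the real axis, so that one majorant serves all
    its points.\<close>
  define A where "A = {z. Im z > Im w / 2}"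
  have A: "open A" "w \<in> A" using assms open_halfspace_Im_gt[of "Im w / 2"] by (auto simp: A_def)
  have "(\<lambda>l. (deriv ^^ k) (\<lambda>w. e2pi (of_real (real l + s) * w)) w) sums
          (deriv ^^ k) (\<lambda>w. \<Sum>l. e2pi (of_real (real l + s) * w)) w"
  proof (rule higher_deriv_series_sums[OF A(1) _ _ _ A(2)])
    show "summable (\<lambda>l. (real l + s) ^ 0 * exp (- (2 * pi * (Im w / 2) * (real l + s))))"
      by (intro summable_power_times_exp) (use assms in auto)
    show "norm (e2pi (of_real (real l + s) * z)) \<le> (real l + s) ^ 0 * exp (- (2 * pi * (Im w / 2) * (real l + s)))"
      if "z \<in> A" for l z
    proof -
      have "2 * pi * (Im w / 2) * (real l + s) \<le> 2 * pi * Im z * (real l + s)"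
        using that assms by (intro mult_right_mono mult_left_mono) (auto simp: A_def)
      moreover have "Im (of_real (real l + s) * z) = Im z * (real l + s)" by simp
      ultimately show ?thesis unfolding norm_e2pi power_0 mult_1 by (simp add: mult_ac)
    qed
  qed (auto intro!: holomorphic_intros)
  also have "(deriv ^^ k) (\<lambda>w. \<Sum>l. e2pi (of_real (real l + s) * w)) w = (deriv ^^ k) (geom_kernel s) w"
  proof (rule higher_deriv_cong_ev)
    have "\<forall>\<^sub>F z in nhds w. z \<in> upper_half_plane"
      using assms by (intro eventually_nhds_in_open) auto
    thus "\<forall>\<^sub>F z in nhds w. (\<Sum>l. e2pi (of_real (real l + s) * z)) = geom_kernel s z"
      by eventually_elim (use geom_kernel_sums in \<open>auto simp: sums_iff\<close>)
  qed auto
  finally show ?thesis by (simp only: higher_deriv_e2pi_mult)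
qed

text \<open>Every exponent l + s is at least s. Raising the height from y to Im w thus shrinks each
  term of the majorant at y by at least the same exponential factor, and K is the sum of that
  majorant.\<close>

lemma norm_higher_deriv_geom_kernel_le:
  assumes "s > 0" "y > 0"
  obtains K where "K \<ge> 0"
    "\<And>w. Im w \<ge> y \<Longrightarrow> norm ((deriv ^^ k) (geom_kernel s) w) \<le> K * exp (- (2 * pi * s * (Im w - y)))"
proof -
  define T where "T = (\<lambda>y l. (2 * pi) ^ k * ((real l + s) ^ k * exp (- (2 * pi * y * (real l + s)))))"
  have T: "summable (T y)" "suminf (T y) \<ge> 0"
    unfolding T_def using assms by (auto intro!: summable_mult summable_power_times_exp suminf_nonneg)
  have "norm ((deriv ^^ k) (geom_kernel s) w) \<le> suminf (T y) * exp (- (2 * pi * s * (Im w - y)))"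
    if w: "Im w \<ge> y" for w
  proof -
    have le: "T (Im w) l \<le> T y l * exp (- (2 * pi * s * (Im w - y)))" for l
    proof -
      have "pi * s * (Im w - y) \<le> pi * (real l + s) * (Im w - y)"
        using w assms by (intro mult_right_mono mult_left_mono) auto
      hence "exp (- (2 * pi * Im w * (real l + s))) \<le> 
               exp (- (2 * pi * y * (real l + s)) + - (2 * pi * s * (Im w - y)))"
        by (simp add: algebra_simps)
      thus ?thesis unfolding T_def exp_add using assms
        by (simp add: mult.assoc mult_left_mono)
    qed
    have "norm ((deriv ^^ k) (geom_kernel s) w) \<le> suminf (T (Im w))"
    proof -
      note sums = higher_deriv_geom_kernel_sums[OF assms(1), of w k]
      have "norm (\<Sum>l. (2 * of_real pi * \<i> * of_real (real l + s)) ^ k * e2pi (of_real (real l + s) * w)) \<le> suminf (T (Im w))"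
        unfolding T_def norm_geom_kernel_term[OF assms(1), symmetric]
        by (rule summable_norm[OF summable_norm_geom_kernel_term]) (use assms w in auto)
      thus ?thesis using sums w assms by (simp add: sums_iff)
    qed
    also have "\<dots> \<le> (\<Sum>l. T y l * exp (- (2 * pi * s * (Im w - y))))"
    proof (rule suminf_le[OF le])
      show "summable (T (Im w))" unfolding T_def using assms w
        by (intro summable_mult summable_power_times_exp) auto
      show "summable (\<lambda>l. T y l * exp (- (2 * pi * s * (Im w - y))))"
        by (intro summable_mult2 T)
    qed
    also have "\<dots> = suminf (T y) * exp (- (2 * pi * s * (Im w - y)))"
      by (rule suminf_mult2 [symmetric]) (rule T)
    finally show ?thesis .
  qed
  with T(2) that show ?thesis by blast
qed

text \<open>The constant does not depend on w: this is the geometric majorant in m for summing the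
  kernel over all multiples of w. It uses (m + 1) Im w - y \<ge> m y.\<close>

lemma norm_higher_deriv_geom_kernel_multiple_le:
  assumes "s > 0" "y > 0"
  obtains K where "\<And>m w. Im w \<ge> y \<Longrightarrow>
    norm ((deriv ^^ k) (geom_kernel s) (of_nat (Suc m) * w)) \<le> K * exp (- (2 * pi * s * y)) ^ m"
proof -
  obtain K where K: "K \<ge> 0"
    "\<And>w. Im w \<ge> y \<Longrightarrow> norm ((deriv ^^ k) (geom_kernel s) w) \<le> K * exp (- (2 * pi * s * (Im w - y)))"
    using norm_higher_deriv_geom_kernel_le[OF assms, of k] by metis
  have "norm ((deriv ^^ k) (geom_kernel s) (of_nat (Suc m) * w)) \<le> K * exp (- (2 * pi * s * y)) ^ m"
    if w: "Im w \<ge> y" for m w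
  proof -
    have my: "real (Suc m) * y \<le> real (Suc m) * Im w"
      using w by (intro mult_left_mono) auto
    have "real (Suc m) * y \<ge> 1 * y"
      using assms by (intro mult_right_mono) auto
    hence "y \<le> real (Suc m) * Im w" using my by linarith
    hence "Im (of_nat (Suc m) * w) \<ge> y" by simp
    from K(2)[OF this] have "norm ((deriv ^^ k) (geom_kernel s) (of_nat (Suc m) * w)) \<le> 
        K * exp (- (2 * pi * s * (real (Suc m) * Im w - y)))" by simp
    also have "\<dots> \<le> K * exp (- (2 * pi * s * (real m * y)))"
    proof -
      have "2 * pi * s * (real m * y) \<le> 2 * pi * s * (real (Suc m) * Im w - y)"
        using my assms by (intro mult_left_mono) (auto simp: algebra_simps)
      thus ?thesis using K(1) by (intro mult_left_mono) auto
    qed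
    also have "exp (- (2 * pi * s * (real m * y))) = exp (- (2 * pi * s * y)) ^ m"
      by (simp add: exp_of_nat_mult [symmetric] mult_ac)
    finally show ?thesis .
  qed
  with that show ?thesis by blast
qed

lemma summable_higher_deriv_geom_kernel_multiples:
  assumes "s > 0" "Im w > 0"
  shows "summable (\<lambda>m. norm ((deriv ^^ k) (geom_kernel s) (of_nat (Suc m) * w)))"
proof -
  obtain K where K: "\<And>m z. Im z \<ge> Im w \<Longrightarrow>
    norm ((deriv ^^ k) (geom_kernel s) (of_nat (Suc m) * z)) \<le> K * exp (- (2 * pi * s * Im w)) ^ m"
    using norm_higher_deriv_geom_kernel_multiple_le[OF assms, of k] by metis
  show ?thesis
  proof (rule summable_comparison_test)
    show "summable (\<lambda>m. K * exp (- (2 * pi * s * Im w)) ^ m)"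
      using assms by (intro summable_mult summable_geometric) auto
  qed (use K[of w] in auto)
qed

section \<open>Series of kernels at positive integer multiples of the argument\<close>

definition kernel_series :: "(nat \<Rightarrow> complex) \<Rightarrow> real \<Rightarrow> complex \<Rightarrow> complex" where
  "kernel_series c s w = (\<Sum>m. c m * geom_kernel s (of_nat (Suc m) * w))"

text \<open>Bounded coefficients suffice because the kernels decay geometrically in m. The chain
  rule factor \<open>of_nat (Suc m) ^ k\<close> is what later cancels the denominators of
  \<open>polylog_coeff\<close> when k equals their exponent.\<close>

lemma
  assumes s: "s > 0" and c: "\<And>m. norm (c m) \<le> 1"
  shows holomorphic_kernel_series: "kernel_series c s holomorphic_on upper_half_plane"
    and higher_deriv_kernel_series_sums:
      "Im w > 0 \<Longrightarrow> (\<lambda>m. c m * (of_nat (Suc m) ^ k * (deriv ^^ k) (geom_kernel s) (of_nat (Suc m) * w)))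
         sums (deriv ^^ k) (kernel_series c s) w"
proof -
  let ?f = "\<lambda>m w. c m * geom_kernel s (of_nat (Suc m) * w)"
  have eq: "kernel_series c s = (\<lambda>w. \<Sum>m. ?f m w)"
    by (simp add: kernel_series_def fun_eq_iff)
  have hol0: "(\<lambda>w. geom_kernel s (of_nat (Suc m) * w)) holomorphic_on upper_half_plane" for m
    by (rule holomorphic_on_compose_gen[OF _ holomorphic_geom_kernel, unfolded o_def])
       (auto intro!: holomorphic_intros)
  \<comment> \<open>The majorant is uniform only above a positive height y. Since holomorphy and
    derivatives are local, these half planes exhaust the problem.\<close>
  have *: "kernel_series c s holomorphic_on {z. Im z > y} \<and>
           (\<forall>w\<in>{z. Im z > y}. (\<lambda>m. (deriv ^^ k) (?f m) w) sums (deriv ^^ k) (kernel_series c s) w)"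
    if y: "y > 0" for y k
  proof -
    obtain K where K: "\<And>m w. Im w \<ge> y \<Longrightarrow>
       norm (geom_kernel s (of_nat (Suc m) * w)) \<le> K * exp (- (2 * pi * s * y)) ^ m"
      using norm_higher_deriv_geom_kernel_multiple_le[OF s y, of 0] by auto
    have bound: "norm (?f m w) \<le> K * exp (- (2 * pi * s * y)) ^ m" if "w \<in> {z. Im z > y}" for m w
    proof -
      have "norm (?f m w) \<le> 1 * (K * exp (- (2 * pi * s * y)) ^ m)"
        unfolding norm_mult using that c by (intro mult_mono K) auto
      thus ?thesis by simp
    qed
    have sub: "{z. Im z > y} \<subseteq> upper_half_plane" using y by auto
    have hol: "?f m holomorphic_on {z. Im z > y}" for m
      by (intro holomorphic_on_mult holomorphic_on_const holomorphic_on_subset[OF hol0 sub])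
    have M: "summable (\<lambda>m. K * exp (- (2 * pi * s * y)) ^ m)"
      using s y by (intro summable_mult summable_geometric) auto
    show ?thesis unfolding eq
      using holomorphic_on_series[OF open_halfspace_Im_gt hol bound M]
            higher_deriv_series_sums[OF open_halfspace_Im_gt hol bound M] by blast
  qed
  show "kernel_series c s holomorphic_on upper_half_plane"
    unfolding holomorphic_on_def
  proof
    fix w assume "w \<in> upper_half_plane"
    hence "kernel_series c s holomorphic_on {z. Im z > Im w / 2}" "w \<in> {z. Im z > Im w / 2}"
      using *[of "Im w / 2"] by auto
    hence "kernel_series c s field_differentiable (at w)"
      using holomorphic_on_imp_differentiable_at open_halfspace_Im_gt by blast
    thus "kernel_series c s field_differentiable (at w within upper_half_plane)"
      by (rule field_differentiable_at_within)
  qed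
  assume w: "Im w > 0"
  have deriv: "(deriv ^^ k) (?f m) w = c m * (of_nat (Suc m) ^ k * (deriv ^^ k) (geom_kernel s) (of_nat (Suc m) * w))" for m
  proof -
    have "(deriv ^^ k) (?f m) w = c m * (deriv ^^ k) (\<lambda>w. geom_kernel s (of_nat (Suc m) * w)) w"
      by (rule higher_deriv_cmult[OF hol0]) (use w in auto)
    also have "(deriv ^^ k) (\<lambda>w. geom_kernel s (of_nat (Suc m) * w)) w =
                 of_nat (Suc m) ^ k * (deriv ^^ k) (geom_kernel s) (of_nat (Suc m) * w)"
      by (rule higher_deriv_compose_linear[OF holomorphic_geom_kernel, of upper_half_plane]) (use w in auto)
    finally show ?thesis .
  qed
  have "w \<in> {z. Im z > Im w / 2}" "Im w / 2 > 0" using w by auto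
  thus "(\<lambda>m. c m * (of_nat (Suc m) ^ k * (deriv ^^ k) (geom_kernel s) (of_nat (Suc m) * w)))
         sums (deriv ^^ k) (kernel_series c s) w"
    using *[of "Im w / 2" k] unfolding deriv [symmetric] by blast
qed

section \<open>Iterating the differential operator\<close>

lemma has_vector_derivative_Complex_Re:
  "((\<lambda>u. Complex u v) has_vector_derivative 1) (at u)"
proof -
  have "(\<lambda>u. Complex u v) = (\<lambda>u. of_real u + \<i> * of_real v)"
    by (simp add: fun_eq_iff complex_eq_iff)
  thus ?thesis by (auto intro!: derivative_eq_intros)
qed

lemma has_vector_derivative_Complex_Im:
  "((\<lambda>v. Complex u v) has_vector_derivative \<i>) (at v)"
proof -
  have "(\<lambda>v. Complex u v) = (\<lambda>v. of_real u + \<i> * of_real v)"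
    by (simp add: fun_eq_iff complex_eq_iff)
  thus ?thesis by (auto intro!: derivative_eq_intros)
qed

lemma has_vector_derivative_Complex_minus_Re:
  "((\<lambda>u. Complex (- u) v) has_vector_derivative - 1) (at u)"
proof -
  have "(\<lambda>u. Complex (- u) v) = (\<lambda>u. - of_real u + \<i> * of_real v)"
    by (simp add: fun_eq_iff complex_eq_iff)
  thus ?thesis by (auto intro!: derivative_eq_intros)
qed

lemma Dop_eqI:
  assumes "((\<lambda>u. f (Complex u v)) has_vector_derivative A) (at u)"
    and "((\<lambda>v. f (Complex u v)) has_vector_derivative B) (at v)"
  shows "Dop f (Complex u v) = (A - \<i> * B) / (4 * of_real pi * \<i>)"
  using assms by (simp add: Dop_def wirtinger_def partial_u_def partial_v_def vector_derivative_at)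

text \<open>The map t to \<open>- cnj t\<close> is antiholomorphic and preserves the upper half
  plane, so \<open>wirtinger\<close> does not see the functions g and acts only on the powers of v,
  with D v = -1 / (4 pi). The exponent is a function p of j so that the lemma can be iterated while
  the index j stays fixed.\<close>

lemma Dop_holomorphic_plus_antiholomorphic:
  fixes g :: "nat \<Rightarrow> complex \<Rightarrow> complex"
  assumes f: "\<And>t. Im t > 0 \<Longrightarrow> f t = h t + (\<Sum>j\<in>J. of_real (Im t) ^ p j * g j (- cnj t))"
    and h: "h holomorphic_on upper_half_plane"
    and g: "\<And>j. j \<in> J \<Longrightarrow> g j holomorphic_on upper_half_plane"
    and J: "finite J" and t: "Im t > 0"
  shows "Dop f t = deriv h t / (2 * of_real pi * \<i>)
           + (\<Sum>j\<in>J. of_real (Im t) ^ (p j - 1) * (- of_nat (p j) / (4 * of_real pi) * g j (- cnj t)))"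
proof -
  define u v where "u = Re t" and "v = Im t"
  have t_eq: "t = Complex u v" and v: "v > 0" using t by (simp_all add: u_def v_def)
  define w where "w = Complex (- u) v"
  have w: "- cnj t = w" by (simp add: w_def t_eq complex_eq_iff)
  have h': "(h has_field_derivative deriv h t) (at t)"
    using h t by (auto intro: holomorphic_derivI)
  have g': "(g j has_field_derivative deriv (g j) w) (at w)" if "j \<in> J" for j
    using g[OF that] v by (auto intro!: holomorphic_derivI simp: w_def)
  have hu: "((\<lambda>u. h (Complex u v)) has_vector_derivative 1 * deriv h t) (at u)"
    using field_vector_diff_chain_at[OF has_vector_derivative_Complex_Re, of h "deriv h t" u v] h'
    by (simp add: t_eq o_def)
  have hv: "((\<lambda>v. h (Complex u v)) has_vector_derivative \<i> * deriv h t) (at v)"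
    using field_vector_diff_chain_at[OF has_vector_derivative_Complex_Im, of h "deriv h t" u v] h'
    by (simp add: t_eq o_def)
  have gu: "((\<lambda>u. g j (Complex (- u) v)) has_vector_derivative - 1 * deriv (g j) w) (at u)" if "j \<in> J" for j
    using field_vector_diff_chain_at[OF has_vector_derivative_Complex_minus_Re, of "g j" "deriv (g j) w" u v] g'[OF that]
    by (simp add: w_def o_def)
  have gv: "((\<lambda>v. g j (Complex (- u) v)) has_vector_derivative \<i> * deriv (g j) w) (at v)" if "j \<in> J" for j
    using field_vector_diff_chain_at[OF has_vector_derivative_Complex_Im, of "g j" "deriv (g j) w" "- u" v] g'[OF that]
    by (simp add: w_def o_def)
  have pv: "((\<lambda>v. of_real v ^ k :: complex) has_vector_derivative of_nat k * of_real v ^ (k - 1)) (at v)" for k :: nat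
    by (rule has_vector_derivative_real_field) (auto intro!: derivative_eq_intros)
  have cnj: "- cnj (Complex u v) = Complex (- u) v" for u v by (simp add: complex_eq_iff)
  define A where "A = deriv h t + (\<Sum>j\<in>J. of_real v ^ p j * (- 1 * deriv (g j) w))"
  define B where "B = \<i> * deriv h t + (\<Sum>j\<in>J. of_real v ^ p j * (\<i> * deriv (g j) w)
                        + of_nat (p j) * of_real v ^ (p j - 1) * g j w)"
  have "((\<lambda>u. h (Complex u v) + (\<Sum>j\<in>J. of_real v ^ p j * g j (Complex (- u) v))) has_vector_derivative A) (at u)"
    unfolding A_def
    by (intro has_vector_derivative_add has_vector_derivative_sum has_vector_derivative_mult_right gu)
       (use hu in auto)
  moreover have "f (Complex u v) = h (Complex u v) + (\<Sum>j\<in>J. of_real v ^ p j * g j (Complex (- u) v))" for u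
    using f[of "Complex u v"] v by (simp only: cnj complex.sel)
  ultimately have A: "((\<lambda>u. f (Complex u v)) has_vector_derivative A) (at u)" by simp
  have B: "((\<lambda>v. h (Complex u v) + (\<Sum>j\<in>J. of_real v ^ p j * g j (Complex (- u) v))) has_vector_derivative B) (at v)"
    unfolding B_def w_def using hv gv
    by (intro has_vector_derivative_add has_vector_derivative_sum has_vector_derivative_mult pv)
       (auto simp: w_def)
  have B: "((\<lambda>v. f (Complex u v)) has_vector_derivative B) (at v)"
  \<comment> \<open>The decomposition of f is known only for positive imaginary part; unlike
    variation of u, variation of v can leave that region.\<close>
  proof (rule has_vector_derivative_transform_within_open[OF B, of "{0<..}"])
    show "h (Complex u v) + (\<Sum>j\<in>J. of_real v ^ p j * g j (Complex (- u) v)) = f (Complex u v)"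
      if "v \<in> {0<..}" for v
      using f[of "Complex u v"] that by (simp only: cnj complex.sel greaterThan_iff)
  qed (use v in auto)
  \<comment> \<open>The derivatives of the functions g cancel: -1 from the u-direction and -\<i> *
    \<i> = 1 from the v-direction. For h the two contributions agree and double.\<close>
  have "A - \<i> * B = 2 * deriv h t - \<i> * (\<Sum>j\<in>J. of_nat (p j) * of_real v ^ (p j - 1) * g j w)"
    unfolding A_def B_def sum.distrib by (simp add: algebra_simps sum_distrib_left sum_negf)
  moreover have "Dop f t = (A - \<i> * B) / (4 * of_real pi * \<i>)"
    using Dop_eqI[OF A B] by (simp add: t_eq)
  ultimately have "Dop f t = deriv h t / (2 * of_real pi * \<i>) -
                     (\<Sum>j\<in>J. of_nat (p j) * of_real v ^ (p j - 1) * g j w) / (4 * of_real pi)"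
    by (simp add: diff_divide_distrib)
  thus ?thesis unfolding w v_def [symmetric]
    by (simp add: sum_divide_distrib sum_negf [symmetric] mult_ac)
qed

text \<open>The coefficient is the falling factorial j (j - 1) ... (j - k + 1). Truncated
  subtraction is harmless: for j < k the product contains the factor j - j = 0, so the false
  exponent 0 occurs only with coefficient 0.\<close>

lemma funpow_Dop:
  fixes g :: "nat \<Rightarrow> complex \<Rightarrow> complex"
  assumes f: "\<And>t. Im t > 0 \<Longrightarrow> f t = h t + (\<Sum>j\<in>J. of_real (Im t) ^ j * g j (- cnj t))"
    and h: "h holomorphic_on upper_half_plane"
    and g: "\<And>j. j \<in> J \<Longrightarrow> g j holomorphic_on upper_half_plane"
    and J: "finite J" and t: "Im t > 0"
  shows "(Dop ^^ k) f t = (deriv ^^ k) h t / (2 * of_real pi * \<i>) ^ k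
           + (\<Sum>j\<in>J. of_real (Im t) ^ (j - k) *
                (of_nat (\<Prod>i<k. j - i) * (- 1 / (4 * of_real pi)) ^ k * g j (- cnj t)))"
  using t
proof (induction k arbitrary: t)
  case 0
  thus ?case using f by simp
next
  case (Suc k)
  have "Dop ((Dop ^^ k) f) t = deriv (\<lambda>t. (deriv ^^ k) h t / (2 * of_real pi * \<i>) ^ k) t / (2 * of_real pi * \<i>)
           + (\<Sum>j\<in>J. of_real (Im t) ^ (j - k - 1) * (- of_nat (j - k) / (4 * of_real pi) *
                (of_nat (\<Prod>i<k. j - i) * (- 1 / (4 * of_real pi)) ^ k * g j (- cnj t))))"
    by (rule Dop_holomorphic_plus_antiholomorphic[OF Suc.IH])
       (use h g J Suc.prems in \<open>auto intro!: holomorphic_intros holomorphic_higher_deriv\<close>)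
  also have "deriv (\<lambda>t. (deriv ^^ k) h t / (2 * of_real pi * \<i>) ^ k) t = (deriv ^^ Suc k) h t / (2 * of_real pi * \<i>) ^ k"
  proof -
    have "(deriv ^^ k) h field_differentiable at t"
      using holomorphic_higher_deriv[OF h, of k] Suc.prems
      by (auto intro: holomorphic_on_imp_differentiable_at[OF _ open_upper_half_plane])
    from deriv_cdivide_right[OF this] show ?thesis by simp
  qed
  finally show ?case by (simp add: mult_ac)
qed

corollary funpow_Dop_top_degree:
  fixes g :: "nat \<Rightarrow> complex \<Rightarrow> complex"
  assumes "\<And>t. Im t > 0 \<Longrightarrow> f t = h t + (\<Sum>j\<le>M. of_real (Im t) ^ j * g j (- cnj t))"
    and "h holomorphic_on upper_half_plane"
    and "\<And>j. j \<le> M \<Longrightarrow> g j holomorphic_on upper_half_plane" and "Im t > 0"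
  shows "(Dop ^^ M) f t = (deriv ^^ M) h t / (2 * of_real pi * \<i>) ^ M
           + fact M * (- 1 / (4 * of_real pi)) ^ M * g M (- cnj t)"
proof -
  have "(\<Prod>i<M. j - i) = 0" if "j < M" for j
    using that by (auto simp: prod_zero_iff)
  moreover have "(\<Prod>i<M. M - i) = fact M"
    by (simp add: fact_prod_rev lessThan_atLeast0)
  ultimately have "(\<Sum>j\<le>M. of_real (Im t) ^ (j - M) *
                (of_nat (\<Prod>i<M. j - i) * (- 1 / (4 * of_real pi)) ^ M * g j (- cnj t))) =
             (\<Sum>j\<le>M. if j = M then fact M * (- 1 / (4 * of_real pi)) ^ M * g M (- cnj t) else 0)"
    by (intro sum.cong) (auto simp del: of_nat_prod simp: of_nat_fact order_le_less)
  moreover have "(Dop ^^ M) f t = (deriv ^^ M) h t / (2 * of_real pi * \<i>) ^ M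
           + (\<Sum>j\<le>M. of_real (Im t) ^ (j - M) *
                (of_nat (\<Prod>i<M. j - i) * (- 1 / (4 * of_real pi)) ^ M * g j (- cnj t)))"
    by (rule funpow_Dop) (use assms in auto)
  ultimately show ?thesis by (simp del: of_nat_prod)
qed

section \<open>The functions as kernel series\<close>

lemma e2pi_of_real_norm [simp]: "norm (e2pi (of_real x)) = 1"
  by (simp add: norm_e2pi)

text \<open>The term of index m + 1 in the polylogarithm of order M at
  \<open>e2pi \<theta>\<close>.\<close>

definition polylog_coeff :: "nat \<Rightarrow> real \<Rightarrow> nat \<Rightarrow> complex" where
  "polylog_coeff M \<theta> m = e2pi (of_nat (Suc m) * of_real \<theta>) / of_nat (Suc m) ^ M"

lemma norm_polylog_coeff: "norm (polylog_coeff M \<theta> m) = inverse (real (Suc m) ^ M)"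
proof -
  have "norm (e2pi (of_nat (Suc m) * of_real \<theta>)) = 1"
    using e2pi_of_real_norm[of "real (Suc m) * \<theta>"] by (simp only: of_real_mult of_real_of_nat_eq)
  thus ?thesis by (simp only: polylog_coeff_def norm_divide norm_power norm_of_nat inverse_eq_divide)
qed

lemma norm_polylog_coeff_le_1: "norm (polylog_coeff M \<theta> m) \<le> 1"
proof -
  have "1 \<le> real (Suc m) ^ M" by (rule one_le_power) simp
  thus ?thesis unfolding norm_polylog_coeff by (intro inverse_le_1_iff[THEN iffD2]) auto
qed

lemma summable_inverse_Suc_square: "summable (\<lambda>m. inverse (real (Suc m) ^ 2))"
  using inverse_power_summable[of 2, where 'a = real]
  by (subst summable_Suc_iff[of "\<lambda>m. inverse (real m ^ 2)"]) simp

text \<open>For \<open>M = 1\<close> the series converges only conditionally; summation by parts works since the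
  partial sums of \<open>x ^ n\<close> are bounded when \<open>x \<noteq> 1\<close>.\<close>
lemma summable_polylog_coeff:
  assumes "M \<ge> 2 \<or> (M = 1 \<and> \<theta> \<notin> \<int>)"
  shows "summable (polylog_coeff M \<theta>)"
proof (cases "M \<ge> 2")
  case True
  show ?thesis
  proof (rule summable_comparison_test)
    have "real (Suc m) ^ 2 \<le> real (Suc m) ^ M" for m
      using True by (intro power_increasing) auto
    thus "\<exists>N. \<forall>m\<ge>N. norm (polylog_coeff M \<theta> m) \<le> inverse (real (Suc m) ^ 2)"
      unfolding norm_polylog_coeff by (intro exI[of _ 0] allI impI le_imp_inverse_le) auto
  qed (rule summable_inverse_Suc_square)
next
  case False
  hence M: "M = 1" and \<theta>: "\<theta> \<notin> \<int>" using assms by auto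
  define x where "x = e2pi (of_real \<theta>)"
  have x: "norm (x ^ k) = 1" for k by (simp add: x_def norm_power)
  have "complex_of_real \<theta> \<notin> \<int>"
    using \<theta> by (metis Ints_cases Ints_of_int of_real_eq_iff of_real_of_int_eq)
  hence x1: "x \<noteq> 1" by (simp add: x_def e2pi_eq_1_iff)
  define b where "b = (\<lambda>m. x ^ Suc m / of_nat (Suc m))"
  have b: "b m = polylog_coeff M \<theta> m" for m
    unfolding b_def polylog_coeff_def M e2pi_of_nat_mult x_def by simp
  have "(\<lambda>m. norm (b m)) \<longlonglongrightarrow> 0"
    using LIMSEQ_inverse_real_of_nat by (simp only: b_def norm_divide x norm_of_nat inverse_eq_divide)
  hence "b \<longlonglongrightarrow> 0" by (rule tendsto_norm_zero_cancel)
  hence 1: "summable (\<lambda>m. b m - b (Suc m))"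
    by (rule telescope_summable')
  have 2: "summable (\<lambda>m. x ^ (m + 2) * of_real (1 / real (Suc m) - 1 / real (m + 2)))"
  proof (rule summable_comparison_test)
    have "norm (x ^ (m + 2) * of_real (1 / real (Suc m) - 1 / real (m + 2))) \<le> inverse (real (Suc m) ^ 2)" for m
    proof -
      have "1 / real (Suc m) - 1 / real (m + 2) = 1 / (real (Suc m) * real (m + 2))"
        by (simp add: divide_simps)
      moreover have "1 / (real (Suc m) * real (m + 2)) \<le> 1 / (real (Suc m) * real (Suc m))"
        by (intro divide_left_mono mult_left_mono) auto
      ultimately show ?thesis unfolding norm_mult x norm_of_real mult_1
        by (simp add: power2_eq_square inverse_eq_divide del: of_nat_Suc)
    qed
    thus "\<exists>N. \<forall>m\<ge>N. norm (x ^ (m + 2) * of_real (1 / real (Suc m) - 1 / real (m + 2))) \<le> inverse (real (Suc m) ^ 2)"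
      by blast
  qed (rule summable_inverse_Suc_square)
  \<comment> \<open>Here (1 - x) b_m is written as a telescoping difference minus an absolutely
    summable correction of size 1 / ((m + 1) (m + 2)).\<close>
  have "summable (\<lambda>m. 1 / (1 - x) * ((b m - b (Suc m)) - x ^ (m + 2) * of_real (1 / real (Suc m) - 1 / real (m + 2))))"
    by (intro summable_mult summable_diff 1 2)
  also have "(\<lambda>m. 1 / (1 - x) * ((b m - b (Suc m)) - x ^ (m + 2) * of_real (1 / real (Suc m) - 1 / real (m + 2)))) = b"
  proof
    fix m
    define n where "n = complex_of_nat (Suc m)"
    have "n + 1 \<noteq> 0" unfolding n_def by (metis of_nat_Suc of_nat_eq_0_iff nat.distinct(1) add.commute)
    have n: "complex_of_nat (Suc (Suc m)) = n + 1" "complex_of_nat (m + 2) = n + 1" by (simp_all add: n_def)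
    have "(b m - b (Suc m)) - x ^ (m + 2) * of_real (1 / real (Suc m) - 1 / real (m + 2)) =
            x ^ Suc m / n - x ^ (m + 2) / n"
      unfolding b_def of_real_diff of_real_divide of_real_of_nat_eq n n_def [symmetric]
      by (simp add: right_diff_distrib)
    also have "\<dots> = (1 - x) * (x ^ Suc m / n)"
      by (simp add: left_diff_distrib diff_divide_distrib)
    finally show "1 / (1 - x) * ((b m - b (Suc m)) - x ^ (m + 2) * of_real (1 / real (Suc m) - 1 / real (m + 2))) = b m"
      using x1 by (simp add: b_def n_def)
  qed
  also have "b = polylog_coeff M \<theta>" by (rule ext) (rule b)
  finally show ?thesis .
qed

lemma kernel_series_sums:
  assumes "s > 0" "\<And>m. norm (c m) \<le> 1" "Im w > 0"
  shows "(\<lambda>m. c m * geom_kernel s (of_nat (Suc m) * w)) sums kernel_series c s w"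
  using higher_deriv_kernel_series_sums[of s c w 0] assms by simp

text \<open>Splits off the one exponent without decay; this is how integral lam passes from s = 0 to
  s = 1.\<close>

lemma geom_kernel_0:
  assumes "Im w > 0"
  shows "geom_kernel 0 w = 1 + geom_kernel 1 w"
  using e2pi_neq_1[OF assms] by (simp add: geom_kernel_def divide_simps)

text \<open>Negative indices turn s into 1 - s at the cost of a sign. Together with the sign of n^M
  this produces the factor \<open>(-1) ^ Suc M\<close> in all later formulas.\<close>

lemma geom_kernel_minus:
  assumes "Im w > 0"
  shows "e2pi (- (of_real s * w)) / (1 - e2pi (- w)) = - geom_kernel (1 - s) w"
proof -
  have "e2pi (of_real (1 - s) * w) = e2pi w * e2pi (- (of_real s * w))"
    by (simp add: e2pi_add [symmetric] algebra_simps)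
  moreover have "x / (1 - inverse y) = - (y * x / (1 - y))" if "y \<noteq> 0" "y \<noteq> 1" for x y :: complex
    using that by (simp add: divide_simps) (simp add: algebra_simps)
  ultimately show ?thesis using e2pi_neq_1[OF assms] by (simp add: geom_kernel_def e2pi_minus)
qed

text \<open>Positive n give the kernel with exponent s, negative n the one with 1 - s. Only for s =
  0 does a series without decay remain, whence the summability hypothesis in that case.\<close>

lemma calE_eq_kernel_series:
  assumes t: "Im t > 0" and s: "0 \<le> s" "s < 1"
    and summable: "s = 0 \<Longrightarrow> summable (polylog_coeff M \<mu>)"
  shows "calE (Suc M) (of_real s * t + of_real \<mu>) t =
           (if s = 0 then suminf (polylog_coeff M \<mu>) else 0)
           + kernel_series (polylog_coeff M \<mu>) (if s = 0 then 1 else s) t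
           + (-1) ^ Suc M * kernel_series (polylog_coeff M (- \<mu>)) (1 - s) t"
proof -
  define z where "z = of_real s * t + of_real \<mu>"
  define f where "f = (\<lambda>n::int. e2pi z powi n / (of_int n ^ M * (1 - e2pi t powi n)))"
  have tm: "Im (of_nat (Suc m) * t) > 0" for m using t by simp
  have f1: "f (int (Suc m)) = polylog_coeff M \<mu> m * geom_kernel s (of_nat (Suc m) * t)" for m
  proof -
    have "e2pi z powi int (Suc m) = e2pi (of_nat (Suc m) * of_real \<mu>) * e2pi (of_real s * (of_nat (Suc m) * t))"
      unfolding e2pi_of_int_mult [symmetric] e2pi_add [symmetric] z_def
      by (rule arg_cong[of _ _ e2pi]) (simp add: algebra_simps)
    moreover have "e2pi t powi int (Suc m) = e2pi (of_nat (Suc m) * t)"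
      unfolding e2pi_of_int_mult [symmetric] by (simp only: of_int_of_nat_eq)
    ultimately show ?thesis
      by (simp only: f_def polylog_coeff_def geom_kernel_def times_divide_times_eq of_int_of_nat_eq)
  qed
  have f2: "f (- int (Suc m)) = (-1) ^ Suc M * (polylog_coeff M (- \<mu>) m * geom_kernel (1 - s) (of_nat (Suc m) * t))" for m
  proof -
    have 1: "e2pi z powi (- int (Suc m)) = e2pi (of_nat (Suc m) * of_real (- \<mu>)) * e2pi (- (of_real s * (of_nat (Suc m) * t)))"
      unfolding e2pi_of_int_mult [symmetric] e2pi_add [symmetric] z_def
      by (rule arg_cong[of _ _ e2pi]) (simp add: algebra_simps)
    have 2: "e2pi t powi (- int (Suc m)) = e2pi (- (of_nat (Suc m) * t))"
      unfolding e2pi_of_int_mult [symmetric] by (simp only: of_int_minus of_int_of_nat_eq minus_mult_left)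
    have 3: "of_int (- int (Suc m)) ^ M = (-1) ^ M * (of_nat (Suc m) ^ M :: complex)"
      by (simp only: of_int_minus of_int_of_nat_eq power_minus[of "of_nat (Suc m)"])
    have 4: "a * b / ((-1) ^ M * c * d) = (-1) ^ M * (a / c * (b / d))" for a b c d :: complex
      by (cases "even M") auto
    show ?thesis
      unfolding f_def 1 2 3 4 geom_kernel_minus[OF tm] polylog_coeff_def by simp
  qed
  have "calE (Suc M) z t = (\<Sum>n. f (int (Suc n))) + (\<Sum>n. f (- int (Suc n)))"
    by (simp only: calE_def Let_def f_def diff_Suc_1)
  also have "(\<Sum>n. f (- int (Suc n))) = (-1) ^ Suc M * kernel_series (polylog_coeff M (- \<mu>)) (1 - s) t"
    unfolding f2 using kernel_series_sums[of "1 - s" "polylog_coeff M (- \<mu>)" t] s t norm_polylog_coeff_le_1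
    by (intro sums_unique [symmetric] sums_mult) auto
  also have "(\<Sum>n. f (int (Suc n))) = (if s = 0 then suminf (polylog_coeff M \<mu>) else 0)
                + kernel_series (polylog_coeff M \<mu>) (if s = 0 then 1 else s) t"
  proof (cases "s = 0")
    case True
    have "(\<lambda>n. polylog_coeff M \<mu> n + polylog_coeff M \<mu> n * geom_kernel 1 (of_nat (Suc n) * t)) sums
            (suminf (polylog_coeff M \<mu>) + kernel_series (polylog_coeff M \<mu>) 1 t)"
      by (intro sums_add summable_sums kernel_series_sums summable True t norm_polylog_coeff_le_1) auto
    also have "(\<lambda>n. polylog_coeff M \<mu> n + polylog_coeff M \<mu> n * geom_kernel 1 (of_nat (Suc n) * t)) = (\<lambda>n. f (int (Suc n)))"
      unfolding f1 True geom_kernel_0[OF tm] by (simp add: distrib_left)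
    finally show ?thesis using True by (simp add: sums_iff)
  next
    case False
    thus ?thesis unfolding f1 using kernel_series_sums[of s "polylog_coeff M \<mu>" t] s t norm_polylog_coeff_le_1
      by (simp add: sums_iff)
  qed
  finally show ?thesis unfolding z_def .
qed

section \<open>The nonholomorphic part as truncated Taylor polynomials\<close>

lemma has_sum_nat_Suc:
  fixes f :: "nat \<Rightarrow> 'a :: topological_comm_monoid_add"
  assumes "((\<lambda>j. f (Suc j)) has_sum S) UNIV"
  shows "(f has_sum (f 0 + S)) UNIV"
proof -
  have "bij_betw Suc UNIV {0<..}"
    by (rule bij_betwI[of _ _ _ "\<lambda>j. j - 1"]) auto
  hence "(f has_sum S) {0<..}" using assms by (simp only: has_sum_reindex_bij_betw)
  moreover have "(f has_sum f 0) {0}" by (rule has_sum_finiteI) auto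
  ultimately have "(f has_sum (f 0 + S)) ({0} \<union> {0<..})"
    by (intro has_sum_Un_disjoint) auto
  moreover have "{0} \<union> {0<..} = (UNIV :: nat set)" by auto
  ultimately show ?thesis by simp
qed

lemma has_sum_sum:
  fixes f :: "'i \<Rightarrow> 'b \<Rightarrow> 'a :: topological_comm_monoid_add"
  assumes "finite I" "\<And>i. i \<in> I \<Longrightarrow> (f i has_sum S i) A"
  shows "((\<lambda>x. \<Sum>i\<in>I. f i x) has_sum (\<Sum>i\<in>I. S i)) A"
  using assms by (induction I rule: finite_induct) (auto intro: has_sum_add)

text \<open>The factor \<open>exp (- 4 \<pi> n p v)\<close> of the incomplete Gamma function turns the
  exponentially growing holomorphic term into a decaying antiholomorphic one.\<close>
lemma Gamma_star_times_e2pi: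
  "of_real (Gamma_star M (4 * pi * real n * p * Im t)) * e2pi (- (of_nat n * of_real p * t)) =
     (\<Sum>k<M. (- 2 * \<i> * of_real (Im t)) ^ k / fact k *
        (of_nat n ^ k * ((2 * of_real pi * \<i> * of_real p) ^ k * e2pi (of_real p * (of_nat n * - cnj t)))))"
proof -
  have "complex_of_real (exp (- (4 * pi * real n * p * Im t))) * e2pi (- (of_nat n * of_real p * t)) =
          e2pi (of_real p * (of_nat n * - cnj t))"
    unfolding e2pi_def exp_of_real [symmetric] exp_add [symmetric]
    by (rule arg_cong[of _ _ exp]) (simp add: complex_eq_iff algebra_simps)
  moreover have "complex_of_real (4 * pi * real n * p * Im t) ^ k / fact k =
          (- 2 * \<i> * of_real (Im t)) ^ k / fact k * (of_nat n ^ k * (2 * of_real pi * \<i> * of_real p) ^ k)" for k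
  proof -
    have "complex_of_real (4 * pi * real n * p * Im t) =
            (- 2 * \<i> * of_real (Im t)) * (of_nat n * (2 * of_real pi * \<i> * of_real p))"
      by (simp add: complex_eq_iff)
    thus ?thesis by (simp only: power_mult_distrib times_divide_eq_left)
  qed
  ultimately show ?thesis
    unfolding Gamma_star_def of_real_mult[of "exp _"] of_real_sum of_real_divide of_real_power of_real_fact
    by (simp only: mult.commute[of "of_real (exp _)"] mult.assoc sum_distrib_right)
qed

text \<open>The Taylor polynomial of degree M - 1 (for M > 0) of the function w to
  \<open>geom_kernel s (of_nat n * w)\<close> about \<open>- cnj t\<close>, evaluated at
  \<open>- t\<close>: the two points differ by \<open>- 2 * \<i> * Im t\<close>.
  \<open>nonhol_series\<close> is the same polynomial for \<open>kernel_series c s\<close>.\<close>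

definition nonhol_kernel :: "nat \<Rightarrow> real \<Rightarrow> complex \<Rightarrow> nat \<Rightarrow> complex" where
  "nonhol_kernel M s t n = (\<Sum>k<M. (- 2 * \<i> * of_real (Im t)) ^ k / fact k *
     (of_nat n ^ k * (deriv ^^ k) (geom_kernel s) (of_nat n * - cnj t)))"

definition nonhol_series :: "nat \<Rightarrow> (nat \<Rightarrow> complex) \<Rightarrow> real \<Rightarrow> complex \<Rightarrow> complex" where
  "nonhol_series M c s t =
     (\<Sum>k<M. (- 2 * \<i> * of_real (Im t)) ^ k / fact k * (deriv ^^ k) (kernel_series c s) (- cnj t))"

lemma nonhol_series_sums:
  assumes "s > 0" "\<And>m. norm (c m) \<le> 1" "Im t > 0"
  shows "(\<lambda>m. c m * nonhol_kernel M s t (Suc m)) sums nonhol_series M c s t"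
proof -
  have "(\<lambda>m. \<Sum>k<M. (- 2 * \<i> * of_real (Im t)) ^ k / fact k *
            (c m * (of_nat (Suc m) ^ k * (deriv ^^ k) (geom_kernel s) (of_nat (Suc m) * - cnj t))))
          sums nonhol_series M c s t"
    unfolding nonhol_series_def
    by (intro sums_sum sums_mult higher_deriv_kernel_series_sums) (use assms in auto)
  thus ?thesis unfolding nonhol_kernel_def sum_distrib_left
    by (simp only: mult.left_commute)
qed

text \<open>After the rewriting of a single term, the powers of 2 pi i (j + s) are those of the
  termwise k-th derivative of the kernel, and the sum over k is finite.\<close>

lemma Gamma_star_has_sum:
  assumes "s > 0" "n > 0" "Im t > 0"
  shows "((\<lambda>j. of_real (Gamma_star M (4 * pi * real n * (real j + s) * Im t)) *
             e2pi (- (of_nat n * of_real (real j + s) * t))) has_sum nonhol_kernel M s t n) UNIV"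
proof -
  have "((\<lambda>j. (2 * of_real pi * \<i> * of_real (real j + s)) ^ k * e2pi (of_real (real j + s) * (of_nat n * - cnj t)))
          has_sum (deriv ^^ k) (geom_kernel s) (of_nat n * - cnj t)) UNIV" for k
    by (rule norm_summable_imp_has_sum[OF summable_norm_geom_kernel_term higher_deriv_geom_kernel_sums])
       (use assms in auto)
  thus ?thesis unfolding Gamma_star_times_e2pi nonhol_kernel_def
    by (intro has_sum_sum has_sum_cmult_right) auto
qed

lemma infsum_int_atLeast:
  fixes f :: "int \<Rightarrow> 'a :: {topological_comm_monoid_add, t2_space}"
  assumes "((\<lambda>j. f (b + int j)) has_sum S) UNIV"
  shows "infsum f {b..} = S"
proof -
  have "bij_betw (\<lambda>j. b + int j) UNIV {b..}"
    by (rule bij_betwI[of _ _ _ "\<lambda>l. nat (l - b)"]) auto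
  hence "(f has_sum S) {b..}"
    using assms by (simp only: has_sum_reindex_bij_betw[of "\<lambda>j. b + int j"])
  thus ?thesis by (rule infsumI)
qed

text \<open>The lower bounds of l turn l - lam and l + lam into j + (1 - s) and j + s with j \<ge> 0
  and s the fractional part of lam. For s = 0 the term j = 0 of the second sum does not decay and
  yields the polylogarithm constant.\<close>

lemma calE_minus_eq_nonhol_series:
  assumes t: "Im t > 0" and M: "M > 0"
    and summable: "lam \<in> \<int> \<Longrightarrow> summable (polylog_coeff M (- \<mu>))"
  shows "calE_minus (Suc M) (of_real lam * t + of_real \<mu>) t =
           nonhol_series M (polylog_coeff M \<mu>) (1 - frac lam) t
           + (-1) ^ Suc M * ((if lam \<in> \<int> then suminf (polylog_coeff M (- \<mu>)) else 0)
               + nonhol_series M (polylog_coeff M (- \<mu>)) (if lam \<in> \<int> then 1 else frac lam) t)"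
proof -
  define z where "z = of_real lam * t + of_real \<mu>"
  define t1 where "t1 = (\<lambda>m l::int. complex_of_real (Gamma_star M (4 * pi * of_int m * (of_int l - lam) * Im t))
                 / of_int m ^ M * e2pi (of_int m * (z - of_int l * t)))"
  define t2 where "t2 = (\<lambda>m l::int. complex_of_real (Gamma_star M (4 * pi * of_int m * (of_int l + lam) * Im t))
                 / of_int m ^ M * e2pi (- of_int m * (z + of_int l * t)))"
  define s where "s = frac lam"
  have s: "0 \<le> s" "s < 1" "s = 0 \<longleftrightarrow> lam \<in> \<int>" by (auto simp: s_def frac_lt_1)
  define K where "K = (\<lambda>n p. complex_of_real (Gamma_star M (4 * pi * real n * p * Im t)) *
                        e2pi (- (of_nat n * of_real p * t)))"
  have r: "Im z / Im t = lam" using t by (simp add: z_def)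
  have t1: "t1 (int (Suc m)) l = polylog_coeff M \<mu> m * K (Suc m) (real_of_int l - lam)" for m l
  proof -
    have "e2pi (of_int (int (Suc m)) * (z - of_int l * t)) =
            e2pi (of_nat (Suc m) * of_real \<mu>) * e2pi (- (of_nat (Suc m) * of_real (real_of_int l - lam) * t))"
      unfolding e2pi_add [symmetric] z_def
      by (rule arg_cong[of _ _ e2pi]) (simp add: algebra_simps)
    thus ?thesis by (simp add: t1_def polylog_coeff_def K_def del: of_nat_Suc)
  qed
  have t2: "t2 (int (Suc m)) l = polylog_coeff M (- \<mu>) m * K (Suc m) (real_of_int l + lam)" for m l
  proof -
    have "e2pi (- of_int (int (Suc m)) * (z + of_int l * t)) =
            e2pi (of_nat (Suc m) * of_real (- \<mu>)) * e2pi (- (of_nat (Suc m) * of_real (real_of_int l + lam) * t))"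
      unfolding e2pi_add [symmetric] z_def
      by (rule arg_cong[of _ _ e2pi]) (simp add: algebra_simps)
    thus ?thesis by (simp add: t2_def polylog_coeff_def K_def del: of_nat_Suc)
  qed
  have sum1: "infsum (t1 (int (Suc m))) {1 + \<lfloor>lam\<rfloor>..} = polylog_coeff M \<mu> m * nonhol_kernel M (1 - s) t (Suc m)" for m
  proof (rule infsum_int_atLeast)
    have l1: "real_of_int (1 + \<lfloor>lam\<rfloor> + int j) - lam = real j + (1 - s)" for j
      by (simp add: s_def frac_def)
    have "((\<lambda>j. K (Suc m) (real j + (1 - s))) has_sum nonhol_kernel M (1 - s) t (Suc m)) UNIV"
      unfolding K_def by (rule Gamma_star_has_sum) (use s t in auto)
    thus "((\<lambda>j. t1 (int (Suc m)) (1 + \<lfloor>lam\<rfloor> + int j)) has_sum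
             polylog_coeff M \<mu> m * nonhol_kernel M (1 - s) t (Suc m)) UNIV"
      unfolding t1 l1 by (rule has_sum_cmult_right)
  qed
  have l2: "real_of_int (- \<lfloor>lam\<rfloor> + int j) + lam = real j + s" for j
    by (simp add: s_def frac_def)
  have sum2: "infsum (t2 (int (Suc m))) {- \<lfloor>lam\<rfloor>..} = (if s = 0 then polylog_coeff M (- \<mu>) m else 0)
                + polylog_coeff M (- \<mu>) m * nonhol_kernel M (if s = 0 then 1 else s) t (Suc m)" for m
  proof (rule infsum_int_atLeast)
    have "((\<lambda>j. K (Suc m) (real j + s)) has_sum (if s = 0 then 1 else 0) + nonhol_kernel M (if s = 0 then 1 else s) t (Suc m)) UNIV"
    proof (cases "s = 0")
      case True
      \<comment> \<open>At p = 0 both exponentials are 1, and of the truncated exponential sum only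
        the term k = 0 survives; it is present because M > 0.\<close>
      have K0: "K (Suc m) (real 0) = 1"
        using M by (simp add: K_def Gamma_star_def power_0_left lessThan_Suc_eq_insert_0
                     sum.remove[of "{..<M}" 0])
      have "((\<lambda>j. K (Suc m) (real (Suc j))) has_sum nonhol_kernel M 1 t (Suc m)) UNIV"
        using Gamma_star_has_sum[of 1 "Suc m" t M] t by (simp add: K_def add.commute)
      from has_sum_nat_Suc[where f = "\<lambda>j. K (Suc m) (real j)", OF this] K0 True show ?thesis by simp
    next
      case False
      thus ?thesis using Gamma_star_has_sum[of s "Suc m" t M] s t by (simp add: K_def)
    qed
    from has_sum_cmult_right[OF this, of "polylog_coeff M (- \<mu>) m"]
    show "((\<lambda>j. t2 (int (Suc m)) (- \<lfloor>lam\<rfloor> + int j)) has_sum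
             (if s = 0 then polylog_coeff M (- \<mu>) m else 0)
                + polylog_coeff M (- \<mu>) m * nonhol_kernel M (if s = 0 then 1 else s) t (Suc m)) UNIV"
      unfolding t2 l2 by (simp add: distrib_left split: if_splits)
  qed
  have "calE_minus (Suc M) z t = (\<Sum>m. infsum (t1 (int (Suc m))) {1 + \<lfloor>lam\<rfloor>..})
          + (- 1) ^ Suc M * (\<Sum>m. infsum (t2 (int (Suc m))) {- \<lfloor>lam\<rfloor>..})"
    by (simp only: calE_minus_def Let_def r t1_def t2_def diff_Suc_1)
  also have "(\<Sum>m. infsum (t1 (int (Suc m))) {1 + \<lfloor>lam\<rfloor>..}) = nonhol_series M (polylog_coeff M \<mu>) (1 - s) t"
    unfolding sum1 using s t norm_polylog_coeff_le_1
    by (intro sums_unique [symmetric] nonhol_series_sums) auto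
  also have "(\<Sum>m. infsum (t2 (int (Suc m))) {- \<lfloor>lam\<rfloor>..}) =
               (if s = 0 then suminf (polylog_coeff M (- \<mu>)) else 0)
               + nonhol_series M (polylog_coeff M (- \<mu>)) (if s = 0 then 1 else s) t"
    unfolding sum2
  proof (intro sums_unique [symmetric] sums_add nonhol_series_sums norm_polylog_coeff_le_1 t)
    show "(\<lambda>m. if s = 0 then polylog_coeff M (- \<mu>) m else 0) sums
            (if s = 0 then suminf (polylog_coeff M (- \<mu>)) else 0)"
      using summable s by (auto intro: summable_sums)
  qed (use s in auto)
  finally show ?thesis unfolding z_def s(3) by (simp add: s_def)
qed

text \<open>The completed function splits into a holomorphic h, a polynomial in v of degree below M
  with antiholomorphic coefficients, and the Bernoulli term in degree exactly M. M applications of D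
  keep the derivative of h and the constant from the top degree.\<close>

lemma funpow_Dop_calE_hat:
  assumes M: "M > 0" and nonint: "M = 1 \<Longrightarrow> \<not> (lam \<in> \<int> \<and> \<mu> \<in> \<int>)" and \<tau>: "Im \<tau> > 0"
  shows "(Dop ^^ M) (\<lambda>t. calE_hat (Suc M) (of_real lam * t + of_real \<mu>) t) \<tau> =
           ((deriv ^^ M) (kernel_series (polylog_coeff M \<mu>) (upper_frac lam)) \<tau>
            + (-1) ^ Suc M * (deriv ^^ M) (kernel_series (polylog_coeff M (- \<mu>)) (upper_frac (- lam))) \<tau>)
             / (2 * of_real pi * \<i>) ^ M
           - of_real (bernpoly (Suc M) (frac lam)) / of_nat (Suc M)"
proof -
  define s s1 s2 where "s = frac lam" and "s1 = upper_frac lam" and "s2 = upper_frac (- lam)"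
  have s: "0 \<le> s" "s < 1" "s = 0 \<longleftrightarrow> lam \<in> \<int>" by (auto simp: s_def frac_lt_1)
  have s1: "s1 = (if lam \<in> \<int> then 1 else frac lam)"
    by (simp add: s1_def upper_frac_eq)
  have s2: "s2 = 1 - frac lam" by (simp add: s2_def upper_frac_def)
  have s_pos: "s1 > 0" "s2 > 0" by (simp_all add: s1_def s2_def upper_frac_pos)
  define F1 where "F1 = kernel_series (polylog_coeff M \<mu>)"
  define F2 where "F2 = kernel_series (polylog_coeff M (- \<mu>))"
  have holF: "F1 s holomorphic_on upper_half_plane" "F2 s holomorphic_on upper_half_plane" if "s > 0" for s
    unfolding F1_def F2_def using that norm_polylog_coeff_le_1 by (auto intro!: holomorphic_kernel_series)
  define b where "b = - ((- 4 * of_real pi) ^ M) * of_real (bernpoly (Suc M) s) / (fact (Suc M) :: complex)"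
  \<comment> \<open>The contributions of exponent 0 from \<open>calE\<close> and
    \<open>calE_minus\<close>. They do not depend on t and vanish under the M > 0
    derivatives.\<close>
  define C where "C = (if s = 0 then suminf (polylog_coeff M \<mu>) else 0)
                        + (-1) ^ Suc M * (if s = 0 then suminf (polylog_coeff M (- \<mu>)) else 0)"
  define h where "h = (\<lambda>t. C + (F1 s1 t + (-1) ^ Suc M * F2 s2 t))"
  \<comment> \<open>Compared with h the exponents are interchanged: F1 now occurs with s2 and F2
    with s1. The default value b is the coefficient of v^M.\<close>
  define g where "g = (\<lambda>j t. if j < M then (- 2 * \<i>) ^ j / fact j *
                    ((deriv ^^ j) (F1 s2) t + (-1) ^ Suc M * (deriv ^^ j) (F2 s1) t) else b)"
  \<comment> \<open>For M = 1 integral lam forces nonintegral \<mu>, which is what conditional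
    convergence requires.\<close>
  have summable: "summable (polylog_coeff M \<mu>)" "summable (polylog_coeff M (- \<mu>))" if "lam \<in> \<int>"
    using that M nonint by (auto intro!: summable_polylog_coeff simp: minus_in_Ints_iff)
  have decomp: "calE_hat (Suc M) (of_real lam * t + of_real \<mu>) t =
                  h t + (\<Sum>j\<le>M. of_real (Im t) ^ j * g j (- cnj t))" if t: "Im t > 0" for t
  proof -
    have r: "Im (of_real lam * t + of_real \<mu>) / Im t = lam" using t by simp
    have "of_real lam * t + of_real \<mu> - of_int \<lfloor>lam\<rfloor> * t = of_real s * t + of_real \<mu>"
      by (simp add: s_def frac_def algebra_simps)
    hence "calE_hat (Suc M) (of_real lam * t + of_real \<mu>) t =
             calE (Suc M) (of_real s * t + of_real \<mu>) t
             - of_real ((- 4 * pi * Im t) ^ M * bernpoly (Suc M) s / fact (Suc M))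
             + calE_minus (Suc M) (of_real lam * t + of_real \<mu>) t"
      by (simp only: calE_hat_def Let_def r s_def [symmetric] diff_Suc_1)
    also have "calE (Suc M) (of_real s * t + of_real \<mu>) t =
                 (if s = 0 then suminf (polylog_coeff M \<mu>) else 0) + F1 s1 t + (-1) ^ Suc M * F2 s2 t"
      using calE_eq_kernel_series[OF t s(1,2), of M \<mu>] summable s s1 s2
      by (simp add: F1_def F2_def s_def)
    also have "calE_minus (Suc M) (of_real lam * t + of_real \<mu>) t =
                 nonhol_series M (polylog_coeff M \<mu>) s2 t
                 + (-1) ^ Suc M * ((if s = 0 then suminf (polylog_coeff M (- \<mu>)) else 0)
                     + nonhol_series M (polylog_coeff M (- \<mu>)) s1 t)"
      using calE_minus_eq_nonhol_series[OF t M, of lam \<mu>] summable s s1 s2 by simp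
    also have "of_real ((- 4 * pi * Im t) ^ M * bernpoly (Suc M) s / fact (Suc M)) =
                 - (of_real (Im t) ^ M * b)"
      unfolding power_mult_distrib[of "- 4 * pi"] by (simp add: b_def)
    finally have 1: "calE_hat (Suc M) (of_real lam * t + of_real \<mu>) t = h t + of_real (Im t) ^ M * b
           + (nonhol_series M (polylog_coeff M \<mu>) s2 t + (-1) ^ Suc M * nonhol_series M (polylog_coeff M (- \<mu>)) s1 t)"
      by (simp add: h_def C_def distrib_left)
    have pow: "(- 2 * \<i> * of_real (Im t)) ^ j = of_real (Im t) ^ j * (- 2 * \<i>) ^ j" for j
      by (simp only: power_mult_distrib mult.commute)
    have "(\<Sum>j<M. of_real (Im t) ^ j * g j (- cnj t)) =
            (nonhol_series M (polylog_coeff M \<mu>) s2 t + (-1) ^ Suc M * nonhol_series M (polylog_coeff M (- \<mu>)) s1 t)"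
      unfolding nonhol_series_def sum_distrib_left sum.distrib [symmetric] pow
      by (intro sum.cong) (auto simp: g_def F1_def F2_def algebra_simps)
    thus ?thesis unfolding 1 lessThan_Suc_atMost [symmetric] by (simp add: g_def)
  qed
  have hol_h: "h holomorphic_on upper_half_plane"
    unfolding h_def using s_pos holF by (intro holomorphic_intros) auto
  have "(Dop ^^ M) (\<lambda>t. calE_hat (Suc M) (of_real lam * t + of_real \<mu>) t) \<tau> =
          (deriv ^^ M) h \<tau> / (2 * of_real pi * \<i>) ^ M
           + fact M * (- 1 / (4 * of_real pi)) ^ M * g M (- cnj \<tau>)"
  proof (rule funpow_Dop_top_degree[OF decomp hol_h _ \<tau>])
    show "g j holomorphic_on upper_half_plane" for j
      unfolding g_def using s_pos holF
      by (cases "j < M") (auto intro!: holomorphic_intros holomorphic_higher_deriv)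
  qed
  also have "fact M * (- 1 / (4 * of_real pi)) ^ M * g M (- cnj \<tau>) = - of_real (bernpoly (Suc M) s) / of_nat (Suc M)"
  proof -
    have "(- 1 / (4 * of_real pi)) ^ M * (- 4 * of_real pi) ^ M = (1 :: complex)"
      by (simp flip: power_mult_distrib)
    hence "F * (- 1 / (4 * of_real pi)) ^ M * (- ((- 4 * of_real pi) ^ M) * B / (S * F)) = - B / S"
      if "F \<noteq> 0" for F S B :: complex
      using that by (simp add: mult.assoc [symmetric])
    from this[of "fact M" "of_real (bernpoly (Suc M) s)" "of_nat (Suc M)", OF fact_nonzero]
    show ?thesis by (simp only: g_def b_def fact_Suc of_nat_mult of_nat_fact less_irrefl if_False)
  qed
  also have "(deriv ^^ M) h \<tau> = (deriv ^^ M) (F1 s1) \<tau> + (-1) ^ Suc M * (deriv ^^ M) (F2 s2) \<tau>"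
  proof -
    have "(deriv ^^ M) h \<tau> = (deriv ^^ M) (\<lambda>t. C) \<tau> + (deriv ^^ M) (\<lambda>t. F1 s1 t + (-1) ^ Suc M * F2 s2 t) \<tau>"
      unfolding h_def using s_pos holF \<tau>
      by (intro higher_deriv_add[of _ upper_half_plane] holomorphic_intros) auto
    also have "(deriv ^^ M) (\<lambda>t. F1 s1 t + (-1) ^ Suc M * F2 s2 t) \<tau> =
                 (deriv ^^ M) (F1 s1) \<tau> + (deriv ^^ M) (\<lambda>t. (-1) ^ Suc M * F2 s2 t) \<tau>"
      using s_pos holF \<tau>
      by (intro higher_deriv_add[of _ upper_half_plane] holomorphic_intros) auto
    also have "(deriv ^^ M) (\<lambda>t. (-1) ^ Suc M * F2 s2 t) \<tau> = (-1) ^ Suc M * (deriv ^^ M) (F2 s2) \<tau>"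
      using s_pos holF \<tau> by (intro higher_deriv_cmult[of _ upper_half_plane]) auto
    finally show ?thesis using M by simp
  qed
  finally show ?thesis by (simp add: F1_def F2_def s1_def s2_def s_def)
qed

section \<open>Fourier series of the Bernoulli polynomials\<close>

definition bernoulli_fps :: "complex fps" where
  "bernoulli_fps = Abs_fps (\<lambda>n. of_real (bernoulli n) / fact n)"

definition bernpoly_fps :: "real \<Rightarrow> complex fps" where
  "bernpoly_fps x = Abs_fps (\<lambda>n. of_real (bernpoly n x) / fact n)"

text \<open>The defining recursion in its implicit form: for n = m + 2 the top summand has binomial
  coefficient m + 2, which clears the denominator.\<close>

lemma sum_binomial_bernoulli:
  "(\<Sum>k<n. real (n choose k) * bernoulli k) = (if n = 1 then 1 else 0)"
proof -
  consider "n = 0" | "n = 1" | m where "n = m + 2"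
    by (metis One_nat_def add_2_eq_Suc' not0_implies_Suc)
  thus ?thesis
  proof cases
    case 3
    have "(\<Sum>k<n. real (n choose k) * bernoulli k) =
            real (n choose Suc m) * bernoulli (Suc m) + (\<Sum>k\<le>m. real (n choose k) * bernoulli k)"
      by (simp add: 3 lessThan_Suc_atMost)
    also have "n choose Suc m = m + 2"
      using binomial_symmetric[of "Suc m" n] by (simp add: 3)
    also have "real (m + 2) * bernoulli (Suc m) = - (\<Sum>k\<le>m. real (n choose k) * bernoulli k)"
      by (simp add: 3 del: binomial_Suc_Suc)
    finally show ?thesis by (simp add: 3)
  qed auto
qed

lemma bernoulli_fps_times_exp: "bernoulli_fps * (fps_exp 1 - 1) = fps_X"
proof (rule fps_ext)
  fix n
  have "fps_nth (bernoulli_fps * (fps_exp 1 - 1)) n =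
          (\<Sum>k\<le>n. of_real (bernoulli k) / fact k * (1 / fact (n - k) - (if n - k = 0 then 1 else 0)))"
    by (simp add: fps_mult_nth bernoulli_fps_def atLeast0AtMost)
  also have "\<dots> = (\<Sum>k<n. of_real (bernoulli k) / fact k * (1 / fact (n - k)))"
    unfolding lessThan_Suc_atMost [symmetric] by (simp add: mult.commute)
  also have "\<dots> = of_real (\<Sum>k<n. real (n choose k) * bernoulli k) / fact n"
    unfolding of_real_sum sum_divide_distrib
    by (intro sum.cong refl) (simp add: binomial_fact field_simps)
  finally show "fps_nth (bernoulli_fps * (fps_exp 1 - 1)) n = fps_nth fps_X n"
    by (simp add: sum_binomial_bernoulli)
qed

lemma bernpoly_fps_eq: "bernpoly_fps x = bernoulli_fps * fps_exp (of_real x)"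
proof (rule fps_ext)
  fix n
  have "fps_nth (bernoulli_fps * fps_exp (of_real x)) n =
          (\<Sum>k\<le>n. of_real (bernoulli k) / fact k * (of_real x ^ (n - k) / fact (n - k)))"
    by (simp add: fps_mult_nth bernoulli_fps_def atLeast0AtMost)
  also have "\<dots> = of_real (bernpoly n x) / fact n"
    unfolding bernpoly_def of_real_sum sum_divide_distrib
    by (intro sum.cong) (auto simp: binomial_fact field_simps)
  finally show "fps_nth (bernpoly_fps x) n = fps_nth (bernoulli_fps * fps_exp (of_real x)) n"
    by (simp add: bernpoly_fps_def)
qed

lemma bernpoly_fps_times_exp:
  "bernpoly_fps x * (fps_exp 1 - 1) = fps_X * fps_exp (of_real x)"
  using bernoulli_fps_times_exp by (simp add: bernpoly_fps_eq mult.commute mult.left_commute)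

lemma bernpoly_0: "bernpoly n 0 = bernoulli n"
proof -
  have "complex_of_real (bernpoly n 0) / fact n = of_real (bernoulli n) / fact n"
    using arg_cong[OF bernpoly_fps_eq[of 0], of "\<lambda>F. fps_nth F n"]
    by (simp add: bernpoly_fps_def bernoulli_fps_def)
  thus ?thesis by simp
qed

lemma bernpoly_1:
  assumes "n \<noteq> 1"
  shows "bernpoly n 1 = bernpoly n 0"
proof -
  have "bernpoly_fps 1 - bernpoly_fps 0 = fps_X"
    using bernoulli_fps_times_exp by (simp add: bernpoly_fps_eq right_diff_distrib)
  hence "fps_nth (bernpoly_fps 1) n - fps_nth (bernpoly_fps 0) n = (if n = 1 then 1 else 0)"
    by (metis fps_X_nth fps_sub_nth)
  thus ?thesis using assms by (simp add: bernpoly_fps_def)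
qed

text \<open>Kernels use representatives up to and including 1, the Bernoulli polynomial uses
  \<open>frac\<close>. They differ only at integers, where the values at 1 and 0 agree except in
  degree 1.\<close>

lemma bernpoly_upper_frac:
  assumes "n \<noteq> 1"
  shows "bernpoly n (upper_frac x) = bernpoly n (frac x)"
  using bernpoly_1[OF assms] by (cases "x \<in> \<int>") (simp_all add: upper_frac_eq frac_eq_0_iff[THEN iffD2])

text \<open>t exp(s t) / (exp t - 1) has constant term 1, so subtracting the pole 1 / t after
  division by t leaves a function analytic at 0 with coefficients B_(n+1)(s) / (n+1)!.\<close>

lemma bernpoly_generating_function:
  "\<exists>f. f has_fps_expansion fps_shift 1 (bernpoly_fps s) \<and>
      (\<forall>t. t \<noteq> 0 \<and> exp t \<noteq> 1 \<longrightarrow> f t = exp (of_real s * t) / (exp t - 1) - 1 / t)"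
proof -
  define F :: "complex fps" where "F = fps_X * fps_exp (of_real s) - (fps_exp 1 - 1)"
  define G :: "complex fps" where "G = fps_X * (fps_exp 1 - 1)"
  have "fps_nth (fps_exp 1 - 1 :: complex fps) 1 = 1" by simp
  hence exp_nz: "fps_exp 1 - 1 \<noteq> (0 :: complex fps)" by force
  hence G_nz: "G \<noteq> 0" by (simp add: G_def)
  have "bernpoly_fps s = 1 + fps_X * fps_shift 1 (bernpoly_fps s)"
  proof (rule fps_ext)
    fix n show "fps_nth (bernpoly_fps s) n = fps_nth (1 + fps_X * fps_shift 1 (bernpoly_fps s)) n"
      by (cases n) (auto simp: bernpoly_fps_def bernpoly_def)
  qed
  hence "F = (1 + fps_X * fps_shift 1 (bernpoly_fps s)) * (fps_exp 1 - 1) - (fps_exp 1 - 1)"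
    unfolding F_def bernpoly_fps_times_exp [symmetric] by simp
  also have "\<dots> = G * fps_shift 1 (bernpoly_fps s)"
    by (simp add: G_def algebra_simps)
  finally have FG: "F = G * fps_shift 1 (bernpoly_fps s)" .
  have F: "(\<lambda>t. t * exp (of_real s * t) - (exp t - 1)) has_fps_expansion F"
    unfolding F_def by (intro fps_expansion_intros)
  have G: "(\<lambda>t. t * (exp t - 1)) has_fps_expansion G"
    unfolding G_def by (intro fps_expansion_intros)
  define f where "f = (\<lambda>t. if t = 0 then fps_nth F (subdegree G) / fps_nth G (subdegree G)
                           else (t * exp (of_real s * t) - (exp t - 1)) / (t * (exp t - 1)))"
  show ?thesis
  proof (cases "F = 0")
    case False
    hence "subdegree G \<le> subdegree F" unfolding FG by (subst subdegree_mult) auto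
    hence "f has_fps_expansion F / G" unfolding f_def
      by (intro has_fps_expansion_divide[OF F G _ G_nz]) auto
    also have "F / G = fps_shift 1 (bernpoly_fps s)"
      unfolding FG using G_nz by simp
    finally have "f has_fps_expansion fps_shift 1 (bernpoly_fps s)" .
    moreover have "f t = exp (of_real s * t) / (exp t - 1) - 1 / t" if "t \<noteq> 0" "exp t \<noteq> 1" for t
      using that by (simp add: f_def divide_simps) 
    ultimately show ?thesis by blast
  next
    case True
    \<comment> \<open>A zero numerator would defeat the comparison of subdegrees. It cannot occur:
      the coefficients s - 1/2 and s^2/2 - 1/6 have no common zero.\<close>
    hence "fps_nth F 3 = 0" "fps_nth F 2 = 0" by simp_all
    hence "of_real s = (1/2 :: complex)" and *: "(of_real s)\<^sup>2 / 2 = (1/6 :: complex)"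
      by (simp_all add: F_def fact_numeral eval_nat_numeral)
    from * have False unfolding \<open>of_real s = 1/2\<close> by (simp add: power2_eq_square)
    thus ?thesis ..
  qed
qed

lemma higher_deriv_inverse_id:
  assumes "w \<noteq> (0 :: complex)"
  shows "(deriv ^^ n) (\<lambda>w. 1 / w) w = (-1) ^ n * fact n / w ^ Suc n"
  using assms
proof (induction n arbitrary: w)
  case (Suc n)
  have "\<forall>\<^sub>F z in nhds w. z \<in> - {0}"
    using Suc.prems by (intro eventually_nhds_in_open) auto
  hence "\<forall>\<^sub>F z in nhds w. (deriv ^^ n) (\<lambda>w. 1 / w) z = (-1) ^ n * fact n / z ^ Suc n"
    by eventually_elim (use Suc.IH in auto)
  hence "deriv ((deriv ^^ n) (\<lambda>w. 1 / w)) w = deriv (\<lambda>z. (-1) ^ n * fact n / z ^ Suc n) w"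
    by (rule deriv_cong_ev) auto
  also have "\<dots> = (-1) ^ Suc n * fact (Suc n) / w ^ Suc (Suc n)"
  proof (rule DERIV_imp_deriv)
    define c :: complex where "c = (-1) ^ n * fact n"
    have "((\<lambda>z. c / z ^ Suc n) has_field_derivative
            (0 * w ^ Suc n - c * (of_nat (Suc n) * (1 * w ^ (Suc n - Suc 0)))) / (w ^ Suc n * w ^ Suc n)) (at w)"
      by (intro DERIV_divide DERIV_const DERIV_power DERIV_ident) (use Suc.prems in simp)
    also have "(0 * w ^ Suc n - c * (of_nat (Suc n) * (1 * w ^ (Suc n - Suc 0)))) / (w ^ Suc n * w ^ Suc n) =
                 - (c * of_nat (Suc n)) / w ^ Suc (Suc n)"
      using Suc.prems by (simp add: divide_simps del: of_nat_Suc)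
    also have "- (c * of_nat (Suc n)) = (-1) ^ Suc n * fact (Suc n)"
      by (simp add: c_def mult_ac)
    finally show "((\<lambda>z. (-1) ^ n * fact n / z ^ Suc n) has_field_derivative
            (-1) ^ Suc n * fact (Suc n) / w ^ Suc (Suc n)) (at w)"
      by (simp only: c_def)
  qed
  finally show ?case by simp
qed auto

section \<open>Twists by the character of a rational number\<close>

lemma e2pi_residue_class:
  assumes "[d = m] (mod int N)" "of_nat N * lam \<in> \<int>"
  shows "e2pi (- (of_int d * of_real lam)) = e2pi (- (of_int m * of_real lam))"
proof -
  obtain k where k: "d - m = int N * k"
    using assms(1) by (auto simp: cong_iff_dvd_diff elim!: dvdE)
  obtain l where l: "of_nat N * lam = of_int l" using assms(2) by (elim Ints_cases)
  have "complex_of_real (of_int (d - m) * lam) = of_real (of_int (k * l))"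
    unfolding k of_int_mult l [symmetric] by (simp add: mult_ac)
  hence "of_int d * complex_of_real lam = of_int (k * l) + of_int m * of_real lam"
    by (simp add: algebra_simps)
  hence "- (of_int d * complex_of_real lam) = of_int (- (k * l)) + - (of_int m * of_real lam)" by simp
  thus ?thesis by (simp only: e2pi_add e2pi_of_int mult_1)
qed

lemma Union_residue_classes:
  assumes "N > 0"
  shows "(\<Union>m\<in>{0..<int N}. {d. [d = m] (mod int N)}) = UNIV"
proof -
  have "d \<in> (\<Union>m\<in>{0..<int N}. {d. [d = m] (mod int N)})" for d
    using assms by (intro UN_I[of "d mod int N"]) (auto simp: cong_def)
  thus ?thesis by blast
qed

lemma has_sum_residue_classes:
  fixes f :: "int \<Rightarrow> 'a :: topological_comm_monoid_add"
  assumes "N > 0" "\<And>m. m \<in> {0..<int N} \<Longrightarrow> (f has_sum S m) {d. [d = m] (mod int N)}"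
  shows "(f has_sum (\<Sum>m\<in>{0..<int N}. S m)) UNIV"
proof -
  have "(f has_sum (\<Sum>m\<in>{0..<int N}. S m)) (\<Union>m\<in>{0..<int N}. {d. [d = m] (mod int N)})"
  proof (rule sum_has_sum)
    fix m m' :: int assume m: "m \<in> {0..<int N}" "m' \<in> {0..<int N}" "m \<noteq> m'"
    have False if "[d = m] (mod int N)" "[d = m'] (mod int N)" for d
    proof -
      have "m mod int N = m' mod int N" using that by (simp add: cong_def)
      thus False using m by (simp add: mod_pos_pos_trivial)
    qed
    thus "{d. [d = m] (mod int N)} \<inter> {d. [d = m'] (mod int N)} = {}" by blast
  qed (use assms(2) in auto)
  thus ?thesis unfolding Union_residue_classes[OF assms(1)] .
qed

lemma sum_int_interval: "(\<Sum>m\<in>{0..<int N}. f m) = (\<Sum>m<N. f (int m))"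
  by (rule sum.reindex_bij_witness[of _ int nat]) auto

text \<open>The twist is constant on each residue class. The class sums are kernel derivatives at (w
  + m) / N, and their weighted sum over m collapses to a single kernel with exponent
  \<open>upper_frac lam\<close>.\<close>

theorem twisted_Lipschitz_formula:
  assumes "Im w > 0" "n > 0" "N > 0" "of_nat N * lam \<in> \<int>"
  shows "((\<lambda>d. e2pi (- (of_int d * of_real lam)) * (1 / (w + of_int d) ^ Suc n)) has_sum
            lipschitz_const n * (deriv ^^ n) (geom_kernel (upper_frac lam)) w) UNIV"
proof -
  let ?K = "\<lambda>m::int. 1 / of_nat N ^ Suc n * (deriv ^^ n) (geom_kernel 1) ((w + of_int m) / of_nat N)"
  have "((\<lambda>d. e2pi (- (of_int d * of_real lam)) * (1 / (w + of_int d) ^ Suc n)) has_sum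
          (\<Sum>m\<in>{0..<int N}. e2pi (- (of_int m * of_real lam)) * (lipschitz_const n * ?K m))) UNIV"
  proof (rule has_sum_residue_classes[OF assms(3)])
    fix m
    have "((\<lambda>d. e2pi (- (of_int m * of_real lam)) * (1 / (w + of_int d) ^ Suc n)) has_sum
          e2pi (- (of_int m * of_real lam)) * (lipschitz_const n * ?K m)) {d. [d = m] (mod int N)}"
      by (intro has_sum_cmult_right has_sum_residue_class assms)
    also have "?this \<longleftrightarrow> ((\<lambda>d. e2pi (- (of_int d * of_real lam)) * (1 / (w + of_int d) ^ Suc n)) has_sum
          e2pi (- (of_int m * of_real lam)) * (lipschitz_const n * ?K m)) {d. [d = m] (mod int N)}"
      by (intro has_sum_cong) (use e2pi_residue_class[OF _ assms(4)] in auto)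
    finally show "((\<lambda>d. e2pi (- (of_int d * of_real lam)) * (1 / (w + of_int d) ^ Suc n)) has_sum
          e2pi (- (of_int m * of_real lam)) * (lipschitz_const n * ?K m)) {d. [d = m] (mod int N)}" .
  qed
  also have "(\<Sum>m\<in>{0..<int N}. e2pi (- (of_int m * of_real lam)) * (lipschitz_const n * ?K m)) =
               lipschitz_const n * (deriv ^^ n) (geom_kernel (upper_frac lam)) w"
    unfolding higher_deriv_geom_kernel_root_average[OF assms(1,3,4), symmetric] sum_int_interval sum_distrib_left
    by (intro sum.cong refl) (simp add: mult_ac)
  finally show ?thesis .
qed

text \<open>Brings a sum over the integers into the form needed for a limit under the sum: d = 0
  isolated, the rest a single series over the natural numbers.\<close>

lemma has_sum_int_symmetric:
  fixes f :: "int \<Rightarrow> complex"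
  assumes "summable M" "\<And>k. norm (f (int (Suc k))) \<le> M k" "\<And>k. norm (f (- int (Suc k))) \<le> M k"
  shows "(f has_sum (f 0 + (\<Sum>k. f (int (Suc k)) + f (- int (Suc k))))) UNIV"
proof -
  have s: "summable (\<lambda>k. norm (f (int (Suc k))))" "summable (\<lambda>k. norm (f (- int (Suc k))))"
    by (rule summable_comparison_test[OF _ assms(1)], use assms(2,3) in simp)+
  have 1: "((\<lambda>k. f (int (Suc k))) has_sum (\<Sum>k. f (int (Suc k)))) UNIV"
    by (rule norm_summable_imp_has_sum[OF s(1)]) (rule summable_sums[OF summable_norm_cancel[OF s(1)]])
  have 2: "((\<lambda>k. f (- int (Suc k))) has_sum (\<Sum>k. f (- int (Suc k)))) UNIV"
    by (rule norm_summable_imp_has_sum[OF s(2)]) (rule summable_sums[OF summable_norm_cancel[OF s(2)]])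
  have "(f has_sum (f 0 + (\<Sum>k. f (int (Suc k)))) + (\<Sum>k. f (- int (Suc k)))) UNIV"
    using has_sum_nat_Suc[where f = "\<lambda>k. f (int k)", OF 1] 2
    by (intro has_sum_int_split) (simp_all only: of_nat_0)
  moreover have "(\<Sum>k. f (int (Suc k)) + f (- int (Suc k))) = (\<Sum>k. f (int (Suc k))) + (\<Sum>k. f (- int (Suc k)))"
    by (rule suminf_add [OF summable_norm_cancel[OF s(1)] summable_norm_cancel[OF s(2)], symmetric])
  ultimately show ?thesis by (simp only: add.assoc)
qed

text \<open>On the imaginary axis |w + d| is at least |d|, so the majorant does not depend on
  w.\<close>

lemma norm_inverse_power_le:
  assumes "Re w = 0" "\<bar>d\<bar> = int (Suc k)" "n > 0"
  shows "norm (e2pi (- (of_int d * of_real lam)) * (1 / (w + of_int d) ^ Suc n)) \<le> inverse (real (Suc k) ^ 2)"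
proof -
  have "norm (e2pi (- (of_int d * of_real lam))) = 1"
    using e2pi_of_real_norm[of "- (of_int d * lam)"] by simp
  moreover have "real (Suc k) \<le> norm (w + of_int d)"
  proof -
    have "\<bar>real_of_int d\<bar> = real (Suc k)" using assms(2) by linarith
    thus ?thesis using abs_Re_le_cmod[of "w + of_int d"] assms(1) by simp
  qed
  moreover have "real (Suc k) ^ 2 \<le> real (Suc k) ^ Suc n"
    using assms(3) by (intro power_increasing) auto
  ultimately have "norm (e2pi (- (of_int d * of_real lam))) = 1" "real (Suc k) ^ 2 \<le> norm (w + of_int d) ^ Suc n"
    using power_mono[of "real (Suc k)" "norm (w + of_int d)" "Suc n"] by auto
  thus ?thesis
    by (simp add: norm_mult norm_divide norm_power inverse_eq_divide divide_left_mono del: of_nat_Suc power_Suc)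
       (metis (mono_tags) frac_le of_nat_0_less_iff zero_le_one zero_less_Suc zero_less_power order_refl)
qed

text \<open>The twisted Lipschitz formula with its term \<open>d = 0\<close> removed is continuous at \<open>w = 0\<close>;
  the limit along the imaginary axis is read off from the generating function
  of the Bernoulli polynomials.\<close>
theorem has_sum_bernpoly_Fourier:
  assumes "n > 0" "N > 0" "of_nat N * lam \<in> \<int>"
  shows "((\<lambda>d. e2pi (- (of_int d * of_real lam)) * (1 / of_int d ^ Suc n)) has_sum
            lipschitz_const n * - ((2 * of_real pi * \<i>) ^ n * of_real (bernpoly (Suc n) (frac lam)) / of_nat (Suc n))) UNIV"
proof -
  define s where "s = upper_frac lam"
  let ?p = "2 * of_real pi * \<i>"
  \<comment> \<open>Points on the imaginary axis, where the majorant applies, tending to 0 from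
    inside the upper half plane.\<close>
  define w where "w = (\<lambda>j::nat. \<i> * of_real (inverse (real (Suc j))))"
  have w: "Re (w j) = 0" "Im (w j) > 0" for j by (simp_all add: w_def)
  have w_lim: "w \<longlonglongrightarrow> 0"
    unfolding w_def using tendsto_mult_left[OF tendsto_of_real[OF LIMSEQ_inverse_real_of_nat], of \<i>] by simp
  define g where "g = (\<lambda>w d::int. e2pi (- (of_int d * of_real lam)) * (1 / (w + of_int d) ^ Suc n))"
  define a where "a = (\<lambda>w k. g w (int (Suc k)) + g w (- int (Suc k)))"
  have bound: "norm (g z (int (Suc k))) \<le> inverse (real (Suc k) ^ 2)"
              "norm (g z (- int (Suc k))) \<le> inverse (real (Suc k) ^ 2)" if "Re z = 0" for z k
    unfolding g_def by (intro norm_inverse_power_le that assms; simp)+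
  have sym: "(g z has_sum (g z 0 + suminf (a z))) UNIV" if "Re z = 0" for z
    unfolding a_def by (rule has_sum_int_symmetric[OF summable_inverse_Suc_square bound[OF that]])

  obtain f where f: "f has_fps_expansion fps_shift 1 (bernpoly_fps s)"
    and f_eq: "\<And>t. t \<noteq> 0 \<Longrightarrow> exp t \<noteq> 1 \<Longrightarrow> f t = exp (of_real s * t) / (exp t - 1) - 1 / t"
    using bernpoly_generating_function[of s] by blast
  obtain S where S: "open S" "0 \<in> S" "f holomorphic_on S"
    using has_fps_expansion_imp_holomorphic[OF f] by metis
  define S' where "S' = (\<lambda>w. ?p * w) -` S \<inter> upper_half_plane"
  have "open ((\<lambda>w. ?p * w) -` S)"
    by (intro open_vimage S continuous_intros)
  hence S': "open S'" by (simp add: S'_def open_Int)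
  \<comment> \<open>With p = 2 pi i, the function p f(p w) equals -p times the kernel minus 1 / w.
    The n-th derivative of this 1 / w is, up to the factor (-1)^n n!, the omitted term d = 0, so the
    pole cancels and the right side extends continuously to z = 0.\<close>
  have main: "suminf (a z) = (-1) ^ n / fact n * (?p * (?p ^ n * (deriv ^^ n) f (?p * z)))"
    if z: "z \<in> S'" "Re z = 0" for z
  proof -
    have z': "Im z > 0" "z \<noteq> 0" using z by (auto simp: S'_def)
    have "g z 0 + suminf (a z) = lipschitz_const n * (deriv ^^ n) (geom_kernel s) z"
      using sym[OF z(2)] twisted_Lipschitz_formula[OF z'(1) assms] unfolding g_def s_def
      by (rule has_sum_unique)
    hence 1: "suminf (a z) = lipschitz_const n * (deriv ^^ n) (geom_kernel s) z - 1 / z ^ Suc n"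
      by (simp add: g_def algebra_simps)
    have hol1: "geom_kernel s holomorphic_on S'"
      by (rule holomorphic_on_subset[OF holomorphic_geom_kernel]) (auto simp: S'_def)
    have hol2: "(\<lambda>w. 1 / w) holomorphic_on S'"
      by (intro holomorphic_intros) (auto simp: S'_def)
    have hol3: "(\<lambda>w. f (?p * w)) holomorphic_on S'"
      by (rule holomorphic_on_compose_gen[OF _ S(3), unfolded o_def])
         (auto intro!: holomorphic_intros simp: S'_def)
    have "(deriv ^^ n) (\<lambda>w. - ?p * geom_kernel s w - 1 / w) z = (deriv ^^ n) (\<lambda>w. ?p * f (?p * w)) z"
    proof (rule higher_deriv_transform_within_open[OF _ _ S' z(1)])
      fix w assume "w \<in> S'"
      hence "Im w > 0" "w \<noteq> 0" by (auto simp: S'_def)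
      hence "f (?p * w) = e2pi (of_real s * w) / (e2pi w - 1) - 1 / (?p * w)"
        using f_eq[of "?p * w"] e2pi_neq_1[of w] by (simp add: e2pi_def mult_ac)
      moreover have "e2pi (of_real s * w) / (e2pi w - 1) = - geom_kernel s w"
        unfolding geom_kernel_def by (metis minus_diff_eq minus_divide_right)
      ultimately show "- ?p * geom_kernel s w - 1 / w = ?p * f (?p * w)"
        using \<open>w \<noteq> 0\<close> by (simp add: right_diff_distrib)
    qed (intro holomorphic_intros hol1 hol2 hol3)+
    also have "(deriv ^^ n) (\<lambda>w. ?p * f (?p * w)) z = ?p * (deriv ^^ n) (\<lambda>w. f (?p * w)) z"
      by (rule higher_deriv_cmult[OF hol3 z(1) S'])
    also have "(deriv ^^ n) (\<lambda>w. f (?p * w)) z = ?p ^ n * (deriv ^^ n) f (?p * z)"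
      by (rule higher_deriv_compose_linear[OF S(3) S' S(1) z(1)]) (auto simp: S'_def)
    also have "(deriv ^^ n) (\<lambda>w. - ?p * geom_kernel s w - 1 / w) z =
                 (deriv ^^ n) (\<lambda>w. - ?p * geom_kernel s w) z - (deriv ^^ n) (\<lambda>w. 1 / w) z"
      by (rule higher_deriv_diff[OF _ hol2 S' z(1)]) (intro holomorphic_intros hol1)
    also have "(deriv ^^ n) (\<lambda>w. - ?p * geom_kernel s w) z = - ?p * (deriv ^^ n) (geom_kernel s) z"
      by (rule higher_deriv_cmult[OF hol1 z(1) S'])
    also have "(deriv ^^ n) (\<lambda>w. 1 / w) z = (-1) ^ n * fact n / z ^ Suc n"
      by (rule higher_deriv_inverse_id) fact
    finally have deriv_eq: "- ?p * (deriv ^^ n) (geom_kernel s) z - (-1) ^ n * fact n / z ^ Suc n =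
                   ?p * (?p ^ n * (deriv ^^ n) f (?p * z))" .
    have "(-1) ^ n / fact n * (?p * (?p ^ n * (deriv ^^ n) f (?p * z))) =
        (-1) ^ n / fact n * (- ?p * (deriv ^^ n) (geom_kernel s) z) - ((-1) ^ n * (-1) ^ n) / z ^ Suc n"
      unfolding deriv_eq [symmetric] right_diff_distrib by simp
    also have "(-1) ^ n * (-1) ^ n = (1 :: complex)" by (simp flip: power_mult_distrib)
    finally show ?thesis unfolding 1 lipschitz_const_def by (simp add: mult_ac)
  qed
  have "(\<lambda>j. suminf (a (w j))) \<longlonglongrightarrow> suminf (a 0)"
  \<comment> \<open>Dominated convergence for series: each paired term converges and is bounded by 2
    / (k + 1)^2 uniformly in j.\<close>
  proof (rule tannerys_theorem[THEN conjunct2, THEN conjunct2])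
    show "(\<lambda>j. a (w j) k) \<longlonglongrightarrow> a 0 k" for k
      unfolding a_def g_def by (intro tendsto_intros w_lim) (auto simp del: of_nat_Suc)
    have "norm (a (w j) k) \<le> 2 * inverse (real (Suc k) ^ 2)" for j k
      using norm_triangle_ineq[of "g (w j) (int (Suc k))" "g (w j) (- int (Suc k))"]
            bound[OF w(1), of j k] unfolding a_def by linarith
    thus "\<forall>\<^sub>F (k, j) in at_top \<times>\<^sub>F sequentially. norm (a (w j) k) \<le> 2 * inverse (real (Suc k) ^ 2)"
      by (simp add: case_prod_unfold)
  qed (auto intro!: summable_mult summable_inverse_Suc_square simp del: of_nat_Suc)
  moreover have "\<forall>\<^sub>F j in sequentially. w j \<in> S'"
  proof -
    have "(\<lambda>j. ?p * w j) \<longlonglongrightarrow> ?p * 0" by (intro tendsto_intros w_lim)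
    hence "\<forall>\<^sub>F j in sequentially. ?p * w j \<in> S"
      using S topological_tendstoD by fastforce
    thus ?thesis by eventually_elim (use w in \<open>auto simp: S'_def\<close>)
  qed
  hence "\<forall>\<^sub>F j in sequentially. suminf (a (w j)) = (-1) ^ n / fact n * (?p * (?p ^ n * (deriv ^^ n) f (?p * w j)))"
    by eventually_elim (use main w in auto)
  ultimately have lim1: "(\<lambda>j. (-1) ^ n / fact n * (?p * (?p ^ n * (deriv ^^ n) f (?p * w j)))) \<longlonglongrightarrow> suminf (a 0)"
    by (rule Lim_transform_eventually)
  have "isCont ((deriv ^^ n) f) 0"
    using holomorphic_on_imp_continuous_on[OF holomorphic_higher_deriv[OF S(3,1)]] S
    by (simp add: continuous_on_eq_continuous_at)
  moreover have "(\<lambda>j. ?p * w j) \<longlonglongrightarrow> 0" using tendsto_mult_left[OF w_lim, of ?p] by simp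
  ultimately have "(\<lambda>j. (deriv ^^ n) f (?p * w j)) \<longlonglongrightarrow> (deriv ^^ n) f 0"
    by (rule isCont_tendsto_compose)
  hence "(\<lambda>j. (-1) ^ n / fact n * (?p * (?p ^ n * (deriv ^^ n) f (?p * w j))))
           \<longlonglongrightarrow> (-1) ^ n / fact n * (?p * (?p ^ n * (deriv ^^ n) f 0))"
    by (intro tendsto_intros)
  from LIMSEQ_unique[OF lim1 this]
  have "suminf (a 0) = (-1) ^ n / fact n * (?p * (?p ^ n * (deriv ^^ n) f 0))" .
  also have "(deriv ^^ n) f 0 = fact n * fps_nth (fps_shift 1 (bernpoly_fps s)) n"
    using fps_nth_fps_expansion[OF f, of n] by simp
  also have "\<dots> = of_real (bernpoly (Suc n) s) / of_nat (Suc n)"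
    by (simp add: bernpoly_fps_def del: of_nat_Suc) 
  also have "bernpoly (Suc n) s = bernpoly (Suc n) (frac lam)"
    unfolding s_def using assms(1) by (intro bernpoly_upper_frac) auto
  finally have "suminf (a 0) = lipschitz_const n * - (?p ^ n * of_real (bernpoly (Suc n) (frac lam)) / of_nat (Suc n))"
    by (simp add: lipschitz_const_def del: of_nat_Suc)
  \<comment> \<open>At w = 0 the term d = 0 is a division by zero, hence 0, so summing over all
    integers is the same as summing over d \<noteq> 0.\<close>
  moreover have "(g 0 has_sum suminf (a 0)) UNIV"
    using sym[of 0] by (simp add: g_def)
  ultimately show ?thesis by (simp add: g_def del: of_nat_Suc power_Suc)
qed

section \<open>Lattice sums\<close>

lemma summable_on_int_symmetric:
  fixes h :: "nat \<Rightarrow> real"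
  assumes "summable h" "\<And>n. h n \<ge> 0"
  shows "(\<lambda>c::int. h (nat \<bar>c\<bar>)) summable_on UNIV"
proof -
  have "((\<lambda>k. h k) has_sum suminf h) UNIV"
    by (rule sums_nonneg_imp_has_sum[OF summable_sums]) (use assms in auto)
  moreover have "summable (\<lambda>k. h (Suc k))" using assms(1) by (simp add: summable_Suc_iff)
  hence "((\<lambda>k. h (Suc k)) has_sum suminf (\<lambda>k. h (Suc k))) UNIV"
    by (intro sums_nonneg_imp_has_sum[OF summable_sums]) (use assms in auto)
  ultimately have "((\<lambda>c::int. h (nat \<bar>c\<bar>)) has_sum (suminf h + suminf (\<lambda>k. h (Suc k)))) UNIV"
    by (intro has_sum_int_split) (simp_all only: abs_minus_cancel abs_of_nat nat_int)
  thus ?thesis by (rule has_sum_imp_summable)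
qed

text \<open>The imaginary part controls c, and the triangle inequality then controls d. For a
  nonzero pair one of |c|, |d| is at least 1, which absorbs the summand 1 after doubling the
  constant; that summand keeps negative real powers meaningful at 0.\<close>

lemma lattice_norm_bound:
  assumes "Im \<tau> > 0"
  obtains L where "L > 0"
    "\<And>c d::int. (c, d) \<noteq> (0, 0) \<Longrightarrow> 1 + \<bar>of_int c\<bar> \<le> L * norm (of_int c * \<tau> + of_int d)"
    "\<And>c d::int. (c, d) \<noteq> (0, 0) \<Longrightarrow> 1 + \<bar>of_int d\<bar> \<le> L * norm (of_int c * \<tau> + of_int d)"
proof -
  define L where "L = 1 + (1 + norm \<tau>) / Im \<tau>"
  have L: "L > 0" "L \<ge> 1" using assms by (auto simp: L_def add_pos_nonneg)
  have *: "\<bar>of_int c\<bar> \<le> L * norm (of_int c * \<tau> + of_int d) \<and> \<bar>of_int d\<bar> \<le> L * norm (of_int c * \<tau> + of_int d)" for c d :: int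
  proof -
    define r where "r = norm (of_int c * \<tau> + of_int d)"
    have "\<bar>of_int c\<bar> * Im \<tau> \<le> r"
      using abs_Im_le_cmod[of "of_int c * \<tau> + of_int d"] assms by (simp add: r_def abs_mult)
    hence c: "\<bar>of_int c\<bar> \<le> r / Im \<tau>" using assms by (simp add: field_simps)
    have "\<bar>of_int d\<bar> = norm ((of_int c * \<tau> + of_int d) - of_int c * \<tau>)"
      by simp
    also have "\<dots> \<le> r + \<bar>of_int c\<bar> * norm \<tau>"
      unfolding r_def by (rule order.trans[OF norm_triangle_ineq4]) (simp add: norm_mult)
    also have "\<dots> \<le> r + r / Im \<tau> * norm \<tau>"
      using c by (intro add_left_mono mult_right_mono) auto
    finally have d: "\<bar>of_int d\<bar> \<le> r + r / Im \<tau> * norm \<tau>" .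
    have "L * r = r + r / Im \<tau> + r / Im \<tau> * norm \<tau>"
      by (simp add: L_def algebra_simps add_divide_distrib)
    moreover have "r \<ge> 0" "r / Im \<tau> \<ge> 0" "r / Im \<tau> * norm \<tau> \<ge> 0" using assms by (auto simp: r_def)
    ultimately show ?thesis using c d unfolding r_def [symmetric] by linarith
  qed
  have **: "1 \<le> L * norm (of_int c * \<tau> + of_int d)" if "(c, d) \<noteq> (0, 0)" for c d :: int
  proof -
    have "1 \<le> \<bar>real_of_int c\<bar> \<or> 1 \<le> \<bar>real_of_int d\<bar>"
      using that by (cases "c = 0") auto
    thus ?thesis using *[of c d] by linarith
  qed
  show ?thesis
  proof (rule that[of "2 * L"])
    show "2 * L > 0" using L by simp
    show "1 + \<bar>of_int c\<bar> \<le> 2 * L * norm (of_int c * \<tau> + of_int d)"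
         "1 + \<bar>of_int d\<bar> \<le> 2 * L * norm (of_int c * \<tau> + of_int d)"
      if "(c, d) \<noteq> (0, 0)" for c d :: int
      using *[of c d] **[OF that] by linarith+
  qed
qed

text \<open>The exponent 3 is shared equally: (1 + |c|)^(-3/2) (1 + |d|)^(-3/2) is a majorant in
  product form, and each factor is summable.\<close>

lemma summable_on_lattice:
  assumes "Im \<tau> > 0" "k \<ge> 3"
  shows "(\<lambda>(c::int, d::int). 1 / (of_int c * \<tau> + of_int d) ^ k) summable_on UNIV \<times> UNIV"
proof -
  define h where "h = (\<lambda>n::nat. real (Suc n) powr (-3/2))"
  have "summable (\<lambda>n. real n powr (-3/2))" by (simp add: summable_real_powr_iff)
  hence "summable h" unfolding h_def by (subst summable_Suc_iff)
  hence h: "(\<lambda>c::int. h (nat \<bar>c\<bar>)) summable_on UNIV"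
    by (rule summable_on_int_symmetric) (simp add: h_def)
  obtain L where L: "L > 0"
    "\<And>c d::int. (c, d) \<noteq> (0, 0) \<Longrightarrow> 1 + \<bar>of_int c\<bar> \<le> L * norm (of_int c * \<tau> + of_int d)"
    "\<And>c d::int. (c, d) \<noteq> (0, 0) \<Longrightarrow> 1 + \<bar>of_int d\<bar> \<le> L * norm (of_int c * \<tau> + of_int d)"
    using lattice_norm_bound[OF assms(1)] by metis
  have bound: "norm (case x of (c, d) \<Rightarrow> 1 / (of_int c * \<tau> + of_int d) ^ k) \<le>
                 L ^ k * (case x of (c::int, d::int) \<Rightarrow> h (nat \<bar>c\<bar>) * h (nat \<bar>d\<bar>))" for x
  proof (cases x)
    case [simp]: (Pair c d)
    define r where "r = norm (of_int c * \<tau> + of_int d)"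
    have h_eq: "h (nat \<bar>e\<bar>) = (1 + \<bar>real_of_int e\<bar>) powr (-3/2)" for e :: int
      by (simp add: h_def add.commute)
    show ?thesis
    proof (cases "(c, d) = (0, 0)")
      \<comment> \<open>At the origin the summand is 1 / 0 = 0.\<close>
      case True
      thus ?thesis using L(1) assms(2) by (simp add: h_eq power_0_left)
    next
      case False
      have "1 \<le> 1 + \<bar>real_of_int c\<bar>" by simp
      also have "\<dots> \<le> L * r" using L(2)[OF False] by (simp add: r_def)
      finally have Lr: "L * r \<ge> 1" .
      hence r: "r > 0" using L(1) by (cases "r = 0") (auto simp: r_def)
      have "1 / r ^ k = L ^ k * (L * r) powr (- real k)"
        using L(1) r by (simp add: powr_minus powr_realpow power_mult_distrib divide_simps)
      also have "\<dots> \<le> L ^ k * (L * r) powr (- 3)"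
        using Lr L(1) assms(2) by (intro mult_left_mono powr_mono) auto
      also have "(L * r) powr (- 3) = (L * r) powr (-3/2) * (L * r) powr (-3/2)"
        by (simp flip: powr_add)
      also have "\<dots> \<le> (1 + \<bar>real_of_int c\<bar>) powr (-3/2) * (1 + \<bar>real_of_int d\<bar>) powr (-3/2)"
        using L(2,3)[OF False] Lr by (intro mult_mono powr_mono2') (auto simp: r_def)
      finally show ?thesis using L(1) by (simp add: norm_divide norm_power r_def h_eq)
    qed
  qed
  have "(\<lambda>(c::int, d::int). h (nat \<bar>c\<bar>) * h (nat \<bar>d\<bar>)) summable_on UNIV \<times> UNIV"
  proof (rule summable_on_SigmaI)
    show "((\<lambda>d. case (c, d) of (c, d) \<Rightarrow> h (nat \<bar>c\<bar>) * h (nat \<bar>d\<bar>)) has_sum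
             h (nat \<bar>c\<bar>) * infsum (\<lambda>d::int. h (nat \<bar>d\<bar>)) UNIV) UNIV" for c :: int
      using has_sum_cmult_right[OF has_sum_infsum[OF h]] by simp
    show "(\<lambda>c::int. h (nat \<bar>c\<bar>) * infsum (\<lambda>d::int. h (nat \<bar>d\<bar>)) UNIV) summable_on UNIV"
      by (rule summable_on_cmult_left[OF h])
  qed (auto simp: h_def)
  hence "(\<lambda>x. L ^ k * (case x of (c::int, d::int) \<Rightarrow> h (nat \<bar>c\<bar>) * h (nat \<bar>d\<bar>))) summable_on UNIV \<times> UNIV"
    by (rule summable_on_cmult_right)
  from Infinite_Sum.abs_summable_on_comparison_test'[OF this bound] show ?thesis
    by (rule abs_summable_summable)
qed

section \<open>Summation of the Eisenstein series by rows\<close>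

lemma summable_on_inverse_shift_power_int:
  fixes z :: complex
  assumes "n > 0"
  shows "(\<lambda>d. 1 / (z + of_int d) ^ Suc n) summable_on A"
  by (rule summable_on_subset_banach[OF has_sum_imp_summable[OF has_sum_inverse_shift_power_int]])
     (use assms in auto)

text \<open>The pair (0, 0) need not be excluded, since its term is 1 / 0 = 0.\<close>

definition row_sum :: "nat \<Rightarrow> nat \<Rightarrow> complex \<Rightarrow> int \<Rightarrow> int \<Rightarrow> complex" where
  "row_sum n N \<tau> c m = (\<Sum>\<^sub>\<infinity>d\<in>{d. [d = m] (mod int N)}. 1 / (of_int c * \<tau> + of_int d) ^ Suc n)"

text \<open>In weight 2 this is the prescribed order of summation. In higher weight it is Fubini,
  justified by absolute summability over the lattice.\<close>

lemma eisenstein_level_eq_row_sums: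
  assumes "n > 0" "Im \<tau> > 0"
  shows "eisenstein_level (Suc n) N (m1, m2) \<tau> =
           (\<Sum>\<^sub>\<infinity>c\<in>{c. [c = m1] (mod int N)}. row_sum n N \<tau> c m2)"
proof (cases "Suc n = 2")
  case True
  have "(\<Sum>\<^sub>\<infinity>d\<in>{d. [d = m2] (mod int N) \<and> (c, d) \<noteq> (0, 0)}. 1 / (of_int c * \<tau> + of_int d) ^ Suc n) =
          row_sum n N \<tau> c m2" for c
    unfolding row_sum_def by (rule infsum_cong_neutral) auto
  thus ?thesis
    using True by (simp only: eisenstein_level_def if_True fst_conv snd_conv simp_thms)
next
  case False
  let ?A = "\<lambda>m. {d::int. [d = m] (mod int N)}"
  have "(\<lambda>(c::int, d::int). 1 / (of_int c * \<tau> + of_int d) ^ Suc n) summable_on ?A m1 \<times> ?A m2"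
    by (rule summable_on_subset_banach[OF summable_on_lattice]) (use assms False in auto)
  note sum = infsum_Sigma'_banach[OF this]
  have "(\<Sum>\<^sub>\<infinity>(c, d)\<in>{(c, d). [c = m1] (mod int N) \<and> [d = m2] (mod int N) \<and> (c, d) \<noteq> (0, 0)}.
           1 / (of_int c * \<tau> + of_int d) ^ Suc n) =
        (\<Sum>\<^sub>\<infinity>(c, d)\<in>?A m1 \<times> ?A m2. 1 / (of_int c * \<tau> + of_int d) ^ Suc n)"
    by (rule infsum_cong_neutral) auto
  thus ?thesis using False sum by (simp add: eisenstein_level_def row_sum_def)
qed

lemma row_sum_has_sum:
  assumes "n > 0"
  shows "((\<lambda>d. 1 / (of_int c * \<tau> + of_int d) ^ Suc n) has_sum row_sum n N \<tau> c m) {d. [d = m] (mod int N)}"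
  unfolding row_sum_def by (intro has_sum_infsum summable_on_inverse_shift_power_int assms)

lemma row_sum_minus: "row_sum n N \<tau> (- c) m = (-1) ^ Suc n * row_sum n N \<tau> c (- m)"
proof -
  have "row_sum n N \<tau> (- c) m =
          (\<Sum>\<^sub>\<infinity>d\<in>{d. [d = - m] (mod int N)}. (-1) ^ Suc n * (1 / (of_int c * \<tau> + of_int d) ^ Suc n))"
    unfolding row_sum_def
  proof (rule infsum_reindex_bij_witness[of _ uminus uminus])
    fix d
    have minus: "1 / (- x) ^ Suc n = (-1) ^ Suc n * (1 / x ^ Suc n)" for x :: complex
      by (cases "even n") auto
    have neg: "of_int (- c) * \<tau> + of_int d = - (of_int c * \<tau> + of_int (- d))" by simp
    show "(-1) ^ Suc n * (1 / (of_int c * \<tau> + of_int (- d)) ^ Suc n) = 1 / (of_int (- c) * \<tau> + of_int d) ^ Suc n"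
      unfolding neg by (rule minus [symmetric])
    show "- d \<in> {d. [d = - m] (mod int N)}" if "d \<in> {d. [d = m] (mod int N)}"
      using that by (simp add: cong_minus_minus_iff)
    show "- d \<in> {d. [d = m] (mod int N)}" if "d \<in> {d. [d = - m] (mod int N)}"
      using that cong_minus_minus_iff[of d "- m" "int N"] by simp
  qed simp_all
  also have "\<dots> = (-1) ^ Suc n * row_sum n N \<tau> c (- m)"
    unfolding row_sum_def by (rule infsum_cmult_right')
  finally show ?thesis .
qed

lemma row_sum_pos:
  assumes "n > 0" "N > 0" "Im \<tau> > 0"
  shows "row_sum n N \<tau> (int (Suc k)) m =
           lipschitz_const n * (1 / of_nat N ^ Suc n *
             (deriv ^^ n) (geom_kernel 1) ((of_nat (Suc k) * \<tau> + of_int m) / of_nat N))"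
proof -
  have "Im (of_nat (Suc k) * \<tau>) > 0" using assms by simp
  from has_sum_residue_class[OF this assms(1,2), of m] show ?thesis
    unfolding row_sum_def by (simp only: of_int_of_nat_eq infsumI)
qed

text \<open>A positive row is a kernel derivative at height (k + 1) Im \<tau> / N and so decays
  geometrically in k. This makes the outer sum over c absolutely convergent even in weight
  2.\<close>

lemma summable_norm_row_sum_pos:
  assumes "n > 0" "N > 0" "Im \<tau> > 0"
  shows "summable (\<lambda>k. norm (row_sum n N \<tau> (int (Suc k)) m))"
proof -
  define y where "y = Im \<tau> / real N"
  have y: "y > 0" using assms by (simp add: y_def)
  obtain K where K: "\<And>w. Im w \<ge> y \<Longrightarrow>
      norm ((deriv ^^ n) (geom_kernel 1) w) \<le> K * exp (- (2 * pi * 1 * (Im w - y)))"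
    using norm_higher_deriv_geom_kernel_le[of 1 y n] y by (metis zero_less_one)
  have bound: "norm ((deriv ^^ n) (geom_kernel 1) ((of_nat (Suc k) * \<tau> + of_int m) / of_nat N)) \<le>
                 K * exp (- (2 * pi * y)) ^ k" for k
  proof -
    have Im: "Im ((of_nat (Suc k) * \<tau> + of_int m) / of_nat N) = real (Suc k) * y"
      by (simp add: y_def Im_divide_of_nat)
    have "1 * y \<le> real (Suc k) * y" using y by (intro mult_right_mono) auto
    from K[of "(of_nat (Suc k) * \<tau> + of_int m) / of_nat N", unfolded Im] this
    have "norm ((deriv ^^ n) (geom_kernel 1) ((of_nat (Suc k) * \<tau> + of_int m) / of_nat N)) \<le>
            K * exp (- (2 * pi * 1 * (real (Suc k) * y - y)))" by simp
    also have "exp (- (2 * pi * 1 * (real (Suc k) * y - y))) = exp (- (2 * pi * y)) ^ k"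
      by (simp add: exp_of_nat_mult [symmetric] algebra_simps)
    finally show ?thesis .
  qed
  show ?thesis
    unfolding row_sum_pos[OF assms] norm_mult
  proof (intro summable_mult)
    show "summable (\<lambda>k. norm ((deriv ^^ n) (geom_kernel 1) ((of_nat (Suc k) * \<tau> + of_int m) / of_nat N)))"
    proof (rule summable_comparison_test)
      show "summable (\<lambda>k. K * exp (- (2 * pi * y)) ^ k)"
        using y by (intro summable_mult summable_geometric) auto
    qed (use bound in auto)
  qed
qed

lemma summable_on_row_sum:
  assumes "n > 0" "N > 0" "Im \<tau> > 0"
  shows "(\<lambda>c. row_sum n N \<tau> c m) summable_on A"
proof -
  let ?R = "\<lambda>m k. row_sum n N \<tau> (int (Suc k)) m"
  have *: "((\<lambda>k. ?R m k) has_sum suminf (?R m)) UNIV" for m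
    by (rule norm_summable_imp_has_sum[OF summable_norm_row_sum_pos[OF assms]])
       (rule summable_sums[OF summable_norm_cancel[OF summable_norm_row_sum_pos[OF assms]]])
  have "((\<lambda>c. row_sum n N \<tau> c m) has_sum
          (row_sum n N \<tau> 0 m + suminf (?R m) + (-1) ^ Suc n * suminf (?R (- m)))) UNIV"
  proof (rule has_sum_int_split)
    show "((\<lambda>k. row_sum n N \<tau> (int k) m) has_sum (row_sum n N \<tau> 0 m + suminf (?R m))) UNIV"
      using has_sum_nat_Suc[where f = "\<lambda>k. row_sum n N \<tau> (int k) m", OF *] by (simp only: of_nat_0)
    show "((\<lambda>k. row_sum n N \<tau> (- int (Suc k)) m) has_sum (-1) ^ Suc n * suminf (?R (- m))) UNIV"
      unfolding row_sum_minus by (rule has_sum_cmult_right[OF *])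
  qed
  from has_sum_imp_summable[OF this] show ?thesis
    by (rule summable_on_subset_banach) auto
qed

lemma has_sum_eisenstein_level:
  assumes "n > 0" "N > 0" "Im \<tau> > 0"
  shows "((\<lambda>c. row_sum n N \<tau> c m2) has_sum eisenstein_level (Suc n) N (m1, m2) \<tau>) {c. [c = m1] (mod int N)}"
  unfolding eisenstein_level_eq_row_sums[OF assms(1,3)]
  by (intro has_sum_infsum summable_on_row_sum assms)

text \<open>The finite Fourier transform in m2. When N lam is an integer it equals the full row over
  all d with weight \<open>e2pi (- d * lam)\<close>, which the twisted formulas evaluate.\<close>

definition twisted_row_sum :: "nat \<Rightarrow> nat \<Rightarrow> real \<Rightarrow> complex \<Rightarrow> int \<Rightarrow> complex" where
  "twisted_row_sum n N lam \<tau> c = (\<Sum>m\<in>{0..<int N}. e2pi (- (of_int m * of_real lam)) * row_sum n N \<tau> c m)"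

lemma twisted_row_sum_eqI:
  assumes "n > 0" "N > 0" "of_nat N * lam \<in> \<int>"
    and "((\<lambda>d. e2pi (- (of_int d * of_real lam)) * (1 / (of_int c * \<tau> + of_int d) ^ Suc n)) has_sum S) UNIV"
  shows "twisted_row_sum n N lam \<tau> c = S"
proof -
  have "((\<lambda>d. e2pi (- (of_int d * of_real lam)) * (1 / (of_int c * \<tau> + of_int d) ^ Suc n)) has_sum
          twisted_row_sum n N lam \<tau> c) UNIV"
    unfolding twisted_row_sum_def
  proof (rule has_sum_residue_classes[OF assms(2)])
    fix m
    have "((\<lambda>d. e2pi (- (of_int m * of_real lam)) * (1 / (of_int c * \<tau> + of_int d) ^ Suc n)) has_sum
             e2pi (- (of_int m * of_real lam)) * row_sum n N \<tau> c m) {d. [d = m] (mod int N)}"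
      by (intro has_sum_cmult_right row_sum_has_sum assms)
    also have "?this \<longleftrightarrow> ((\<lambda>d. e2pi (- (of_int d * of_real lam)) * (1 / (of_int c * \<tau> + of_int d) ^ Suc n)) has_sum
             e2pi (- (of_int m * of_real lam)) * row_sum n N \<tau> c m) {d. [d = m] (mod int N)}"
      by (intro has_sum_cong) (use e2pi_residue_class[OF _ assms(3)] in auto)
    finally show "((\<lambda>d. e2pi (- (of_int d * of_real lam)) * (1 / (of_int c * \<tau> + of_int d) ^ Suc n)) has_sum
             e2pi (- (of_int m * of_real lam)) * row_sum n N \<tau> c m) {d. [d = m] (mod int N)}" .
  qed
  thus ?thesis using assms(4) by (rule has_sum_unique)
qed

lemma twisted_row_sum_0:
  assumes "n > 0" "N > 0" "of_nat N * lam \<in> \<int>"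
  shows "twisted_row_sum n N lam \<tau> 0 =
           lipschitz_const n * - ((2 * of_real pi * \<i>) ^ n * of_real (bernpoly (Suc n) (frac lam)) / of_nat (Suc n))"
  by (rule twisted_row_sum_eqI[OF assms]) (use has_sum_bernpoly_Fourier[OF assms] in simp)

lemma twisted_row_sum_pos:
  assumes "n > 0" "N > 0" "of_nat N * lam \<in> \<int>" "Im \<tau> > 0"
  shows "twisted_row_sum n N lam \<tau> (int (Suc k)) =
           lipschitz_const n * (deriv ^^ n) (geom_kernel (upper_frac lam)) (of_nat (Suc k) * \<tau>)"
proof (rule twisted_row_sum_eqI[OF assms(1-3)])
  have "Im (of_nat (Suc k) * \<tau>) > 0" using assms by simp
  from twisted_Lipschitz_formula[OF this assms(1-3)]
  show "((\<lambda>d. e2pi (- (of_int d * of_real lam)) * (1 / (of_int (int (Suc k)) * \<tau> + of_int d) ^ Suc n)) has_sum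
          lipschitz_const n * (deriv ^^ n) (geom_kernel (upper_frac lam)) (of_nat (Suc k) * \<tau>)) UNIV"
    by (simp only: of_int_of_nat_eq)
qed

text \<open>The substitution d to -d reduces a negative row to a positive one; it replaces lam by
  -lam and contributes the parity sign of the weight.\<close>

lemma twisted_row_sum_neg:
  assumes "n > 0" "N > 0" "of_nat N * lam \<in> \<int>" "Im \<tau> > 0"
  shows "twisted_row_sum n N lam \<tau> (- int (Suc k)) =
           (-1) ^ Suc n * (lipschitz_const n * (deriv ^^ n) (geom_kernel (upper_frac (- lam))) (of_nat (Suc k) * \<tau>))"
proof (rule twisted_row_sum_eqI[OF assms(1-3)])
  have "Im (of_nat (Suc k) * \<tau>) > 0" "of_nat N * (- lam) \<in> \<int>" using assms by simp_all
  note L = has_sum_cmult_right[OF twisted_Lipschitz_formula[OF this(1) assms(1,2) this(2)], of "(-1) ^ Suc n"]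
  have eq: "(-1) ^ Suc n * (e2pi (- (of_int (- d) * of_real (- lam))) * (1 / (of_nat (Suc k) * \<tau> + of_int (- d)) ^ Suc n)) =
              e2pi (- (of_int d * of_real lam)) * (1 / (of_int (- int (Suc k)) * \<tau> + of_int d) ^ Suc n)" for d
  proof -
    have neg: "of_int (- int (Suc k)) * \<tau> + of_int d = - (of_nat (Suc k) * \<tau> + of_int (- d))"
      by (simp add: algebra_simps)
    have minus: "1 / (- x) ^ Suc n = (-1) ^ Suc n * (1 / x ^ Suc n)" for x :: complex
      by (cases "even n") auto
    have exp: "e2pi (- (of_int (- d) * of_real (- lam))) = e2pi (- (of_int d * of_real lam))"
      by simp
    show ?thesis unfolding neg minus exp by (rule mult.left_commute)
  qed
  have "bij_betw uminus (UNIV :: int set) UNIV" by (rule bij_uminus)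
  note reindex = has_sum_reindex_bij_betw[OF this]
  show "((\<lambda>d. e2pi (- (of_int d * of_real lam)) * (1 / (of_int (- int (Suc k)) * \<tau> + of_int d) ^ Suc n)) has_sum
          (-1) ^ Suc n * (lipschitz_const n * (deriv ^^ n) (geom_kernel (upper_frac (- lam))) (of_nat (Suc k) * \<tau>))) UNIV"
    using L unfolding reindex [symmetric, of "\<lambda>d. _ * (_ d * _ d)"] eq .
qed

lemma polylog_coeff_mult_power:
  "polylog_coeff M \<theta> m * (of_nat (Suc m) ^ M * x) = e2pi (of_nat (Suc m) * of_real \<theta>) * x"
  by (simp add: polylog_coeff_def del: of_nat_Suc)

lemma has_sum_kernel_series:
  assumes "s > 0" "Im \<tau> > 0"
  shows "((\<lambda>k. e2pi (of_nat (Suc k) * of_real \<theta>) * (deriv ^^ M) (geom_kernel s) (of_nat (Suc k) * \<tau>)) has_sum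
            (deriv ^^ M) (kernel_series (polylog_coeff M \<theta>) s) \<tau>) UNIV"
proof (rule norm_summable_imp_has_sum)
  have "norm (e2pi (of_nat (Suc k) * of_real \<theta>)) = 1" for k
    using e2pi_of_real_norm[of "real (Suc k) * \<theta>"] by (simp only: of_real_mult of_real_of_nat_eq)
  thus "summable (\<lambda>k. norm (e2pi (of_nat (Suc k) * of_real \<theta>) * (deriv ^^ M) (geom_kernel s) (of_nat (Suc k) * \<tau>)))"
    using summable_higher_deriv_geom_kernel_multiples[OF assms, of M] by (simp only: norm_mult mult_1)
  show "(\<lambda>k. e2pi (of_nat (Suc k) * of_real \<theta>) * (deriv ^^ M) (geom_kernel s) (of_nat (Suc k) * \<tau>)) sums
            (deriv ^^ M) (kernel_series (polylog_coeff M \<theta>) s) \<tau>"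
    using higher_deriv_kernel_series_sums[where c = "polylog_coeff M \<theta>" and k = M,
            OF assms(1) norm_polylog_coeff_le_1 assms(2)]
    unfolding polylog_coeff_mult_power .
qed

text \<open>The weight in \<mu> is constant on c congruent to m1, so the sums over m1 and over c
  within a class merge into one sum over all c. The row c = 0 gives the Bernoulli term, c > 0 and c
  < 0 give the two kernel series.\<close>

lemma sum_eisenstein_level:
  assumes "n > 0" "N > 0" "of_nat N * lam \<in> \<int>" "of_nat N * \<mu> \<in> \<int>" "Im \<tau> > 0"
  shows "(\<Sum>(m1, m2)\<in>{0..<int N} \<times> {0..<int N}.
            e2pi (of_int m1 * of_real \<mu> - of_int m2 * of_real lam) * eisenstein_level (Suc n) N (m1, m2) \<tau>) =
         lipschitz_const n *
           ((deriv ^^ n) (kernel_series (polylog_coeff n \<mu>) (upper_frac lam)) \<tau>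
            + (-1) ^ Suc n * (deriv ^^ n) (kernel_series (polylog_coeff n (- \<mu>)) (upper_frac (- lam))) \<tau>
            - (2 * of_real pi * \<i>) ^ n * of_real (bernpoly (Suc n) (frac lam)) / of_nat (Suc n))"
    (is "?lhs = lipschitz_const n * (?D1 + (-1) ^ Suc n * ?D2 - ?B)")
proof -
  let ?T = "twisted_row_sum n N lam \<tau>"
  have "((\<lambda>c. e2pi (of_int c * of_real \<mu>) * ?T c) has_sum
          (\<Sum>m1\<in>{0..<int N}. \<Sum>m2\<in>{0..<int N}. e2pi (of_int m1 * of_real \<mu>) *
              (e2pi (- (of_int m2 * of_real lam)) * eisenstein_level (Suc n) N (m1, m2) \<tau>))) UNIV"
  proof (rule has_sum_residue_classes[OF assms(2)])
    fix m1
    have periodic: "e2pi (of_int c * of_real \<mu>) = e2pi (of_int m1 * of_real \<mu>)" if "[c = m1] (mod int N)" for c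
      using e2pi_residue_class[OF that, of "- \<mu>"] assms(4) by simp
    have "((\<lambda>c. \<Sum>m2\<in>{0..<int N}. e2pi (of_int m1 * of_real \<mu>) *
              (e2pi (- (of_int m2 * of_real lam)) * row_sum n N \<tau> c m2)) has_sum
           (\<Sum>m2\<in>{0..<int N}. e2pi (of_int m1 * of_real \<mu>) *
              (e2pi (- (of_int m2 * of_real lam)) * eisenstein_level (Suc n) N (m1, m2) \<tau>))) {c. [c = m1] (mod int N)}"
      by (intro has_sum_sum has_sum_cmult_right has_sum_eisenstein_level assms) auto
    also have "?this \<longleftrightarrow> ((\<lambda>c. e2pi (of_int c * of_real \<mu>) * ?T c) has_sum
           (\<Sum>m2\<in>{0..<int N}. e2pi (of_int m1 * of_real \<mu>) *
              (e2pi (- (of_int m2 * of_real lam)) * eisenstein_level (Suc n) N (m1, m2) \<tau>))) {c. [c = m1] (mod int N)}"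
    proof (rule has_sum_cong)
      fix c assume "c \<in> {c. [c = m1] (mod int N)}"
      hence "e2pi (of_int c * of_real \<mu>) = e2pi (of_int m1 * of_real \<mu>)" by (simp only: mem_Collect_eq periodic)
      thus "(\<Sum>m2\<in>{0..<int N}. e2pi (of_int m1 * of_real \<mu>) *
              (e2pi (- (of_int m2 * of_real lam)) * row_sum n N \<tau> c m2)) = e2pi (of_int c * of_real \<mu>) * ?T c"
        by (simp only: twisted_row_sum_def sum_distrib_left)
    qed
    finally show "((\<lambda>c. e2pi (of_int c * of_real \<mu>) * ?T c) has_sum
           (\<Sum>m2\<in>{0..<int N}. e2pi (of_int m1 * of_real \<mu>) *
              (e2pi (- (of_int m2 * of_real lam)) * eisenstein_level (Suc n) N (m1, m2) \<tau>))) {c. [c = m1] (mod int N)}" .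
  qed
  also have "(\<Sum>m1\<in>{0..<int N}. \<Sum>m2\<in>{0..<int N}. e2pi (of_int m1 * of_real \<mu>) *
              (e2pi (- (of_int m2 * of_real lam)) * eisenstein_level (Suc n) N (m1, m2) \<tau>)) = ?lhs"
    unfolding sum.cartesian_product
    by (intro sum.cong refl) (auto simp: e2pi_diff e2pi_minus divide_inverse mult.assoc)
  finally have 1: "((\<lambda>c. e2pi (of_int c * of_real \<mu>) * ?T c) has_sum ?lhs) UNIV" .
  have "((\<lambda>c. e2pi (of_int c * of_real \<mu>) * ?T c) has_sum
          (lipschitz_const n * - ?B + lipschitz_const n * ?D1) + (-1) ^ Suc n * (lipschitz_const n * ?D2)) UNIV"
  proof (rule has_sum_int_split)
    have pos: "e2pi (of_int (int (Suc k)) * of_real \<mu>) * ?T (int (Suc k)) =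
            lipschitz_const n * (e2pi (of_nat (Suc k) * of_real \<mu>) *
              (deriv ^^ n) (geom_kernel (upper_frac lam)) (of_nat (Suc k) * \<tau>))" for k
      unfolding twisted_row_sum_pos[OF assms(1-3,5)] of_int_of_nat_eq by (rule mult.left_commute)
    have "((\<lambda>k. e2pi (of_int (int (Suc k)) * of_real \<mu>) * ?T (int (Suc k))) has_sum lipschitz_const n * ?D1) UNIV"
      unfolding pos by (intro has_sum_cmult_right has_sum_kernel_series upper_frac_pos assms)
    from has_sum_nat_Suc[where f = "\<lambda>k. e2pi (of_int (int k) * of_real \<mu>) * ?T (int k)", OF this]
    show "((\<lambda>k. e2pi (of_int (int k) * of_real \<mu>) * ?T (int k)) has_sum
            (lipschitz_const n * - ?B + lipschitz_const n * ?D1)) UNIV"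
      by (simp only: of_nat_0 of_int_0 mult_zero_left e2pi_0 mult_1 twisted_row_sum_0[OF assms(1-3)])
    have minus: "e2pi (of_int (- int (Suc k)) * of_real \<mu>) = e2pi (of_nat (Suc k) * of_real (- \<mu>))" for k
      by (simp only: of_int_minus of_int_of_nat_eq of_real_minus mult_minus_left mult_minus_right)
    have neg: "e2pi (of_int (- int (Suc k)) * of_real \<mu>) * ?T (- int (Suc k)) =
            (-1) ^ Suc n * (lipschitz_const n * (e2pi (of_nat (Suc k) * of_real (- \<mu>)) *
              (deriv ^^ n) (geom_kernel (upper_frac (- lam))) (of_nat (Suc k) * \<tau>)))" for k
      unfolding twisted_row_sum_neg[OF assms(1-3,5)] minus
        mult.left_commute[of "lipschitz_const n" "e2pi _"] by (rule mult.left_commute)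
    show "((\<lambda>k. e2pi (of_int (- int (Suc k)) * of_real \<mu>) * ?T (- int (Suc k))) has_sum
             (-1) ^ Suc n * (lipschitz_const n * ?D2)) UNIV"
      unfolding neg by (intro has_sum_cmult_right has_sum_kernel_series upper_frac_pos assms)
  qed
  note has_sum_unique[OF 1 this]
  also have "L * - B + L * D1 + u * (L * D2) = L * (D1 + u * D2 - B)" for L B D1 D2 u :: complex
    by (simp add: algebra_simps)
  finally show ?thesis .
qed

text \<open>The factorials, the signs and one factor 2 pi i cancel; the remaining n factors are
  those in the definition of D.\<close>

lemma lipschitz_const_normalization:
  "fact n / (- 2 * of_real pi * \<i>) ^ Suc n * lipschitz_const n = 1 / (2 * of_real pi * \<i>) ^ n"
proof -
  define p where "p = 2 * of_real pi * \<i>"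
  have p: "p \<noteq> 0" by (simp add: p_def)
  have "- 2 * of_real pi * \<i> = - p" by (simp add: p_def)
  moreover have "(- p) ^ Suc n = - p * ((-1) ^ n * p ^ n)"
    unfolding power_Suc power_minus[of p] ..
  moreover have "F / (- p * (u * q)) * (- p * u / F) = 1 / q" if "F \<noteq> 0" "u \<noteq> 0" for F u q
    using that p by (simp add: divide_simps)
  from this[of "fact n" "(-1) ^ n" "p ^ n"]
  have "fact n / (- p * ((-1) ^ n * p ^ n)) * (- p * (-1) ^ n / fact n) = 1 / p ^ n"
    by simp
  ultimately show ?thesis unfolding lipschitz_const_def p_def [symmetric] by (simp only:)
qed

theorem funpow_Dop_calE_hat_eq_eisenstein_level:
  assumes "n > 0" "N > 0" "of_nat N * lam \<in> \<int>" "of_nat N * \<mu> \<in> \<int>" "Im \<tau> > 0"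
    and "n = 1 \<Longrightarrow> \<not> (lam \<in> \<int> \<and> \<mu> \<in> \<int>)"
  shows "(Dop ^^ n) (\<lambda>t. calE_hat (Suc n) (of_real lam * t + of_real \<mu>) t) \<tau>
           = fact n / (- 2 * of_real pi * \<i>) ^ Suc n
             * (\<Sum>(m1, m2)\<in>{0..<int N} \<times> {0..<int N}.
                  e2pi (of_int m1 * of_real \<mu> - of_int m2 * of_real lam)
                  * eisenstein_level (Suc n) N (m1, m2) \<tau>)"
proof -
  have factor: "1 / p * (D - p * B / S) = D / p - B / S" if "p \<noteq> 0" for D B S p :: complex
    using that by (simp add: right_diff_distrib)
  have "(2 * of_real pi * \<i>) ^ n \<noteq> 0" by simp
  note factor = factor[OF this]
  show ?thesis
    unfolding sum_eisenstein_level[OF assms(1-5)] mult.assoc [symmetric] lipschitz_const_normalization factor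
    by (rule funpow_Dop_calE_hat) (use assms in auto)
qed

text \<open>For lam = 0 and N = 1 the Fourier formula expresses the Bernoulli number through the sum
  of d^(-n) over all integers, which changes sign under d to -d when n is odd.\<close>

lemma bernoulli_odd_eq_0:
  assumes "odd n" "n \<ge> 3"
  shows "bernoulli n = 0"
proof -
  define k where "k = n - 1"
  have k: "n = Suc k" "k > 0" "even k" using assms by (auto simp: k_def)
  define S where "S = lipschitz_const k * - ((2 * of_real pi * \<i>) ^ k * of_real (bernpoly (Suc k) (frac 0)) / of_nat (Suc k))"
  have S: "((\<lambda>d. 1 / of_int d ^ Suc k) has_sum S) UNIV"
    using has_sum_bernpoly_Fourier[OF k(2), of 1 0] by (simp add: S_def)
  have "((\<lambda>d. 1 / of_int (- d) ^ Suc k) has_sum S) UNIV"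
    unfolding has_sum_reindex_bij_betw[OF bij_uminus, of "\<lambda>d::int. 1 / of_int d ^ Suc k"] by (rule S)
  also have "(\<lambda>d. 1 / of_int (- d) ^ Suc k) = (\<lambda>d. - (1 / of_int d ^ Suc k :: complex))"
    using k(3) by (simp add: fun_eq_iff)
  finally have "((\<lambda>d. 1 / of_int d ^ Suc k) has_sum - S) UNIV"
    by (simp only: has_sum_uminus)
  hence "S = - S" using S has_sum_unique by blast
  hence "S = 0" by simp
  thus ?thesis by (simp add: S_def lipschitz_const_def bernpoly_0 k(1) del: bernoulli.simps of_nat_Suc)
qed

section \<open>Lambert series and divisor sums for the untwisted case\<close>

lemma Lambert_inner_has_sum:
  assumes "Im \<tau> > 0"
  shows "((\<lambda>l. of_nat (Suc l) ^ n * e2pi \<tau> ^ (Suc m * Suc l)) has_sum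
            (deriv ^^ n) (geom_kernel 1) (of_nat (Suc m) * \<tau>) / (2 * of_real pi * \<i>) ^ n) UNIV"
proof -
  define p where "p = 2 * of_real pi * \<i>"
  have p: "p \<noteq> 0" by (simp add: p_def)
  define w where "w = of_nat (Suc m) * \<tau>"
  have w: "Im w > 0" using assms by (simp add: w_def)
  have "((\<lambda>l. (p * of_real (real l + 1)) ^ n * e2pi (of_real (real l + 1) * w)) has_sum
           (deriv ^^ n) (geom_kernel 1) w) UNIV"
    unfolding p_def by (rule norm_summable_imp_has_sum[OF summable_norm_geom_kernel_term higher_deriv_geom_kernel_sums])
      (use w in auto)
  hence "((\<lambda>l. inverse (p ^ n) * ((p * of_real (real l + 1)) ^ n * e2pi (of_real (real l + 1) * w))) has_sum
           inverse (p ^ n) * (deriv ^^ n) (geom_kernel 1) w) UNIV"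
    by (rule has_sum_cmult_right)
  moreover have "inverse (p ^ n) * ((p * of_real (real l + 1)) ^ n * e2pi (of_real (real l + 1) * w)) =
                   of_nat (Suc l) ^ n * e2pi \<tau> ^ (Suc m * Suc l)" for l
  proof -
    have l: "complex_of_real (real l + 1) = of_nat (Suc l)" by simp
    have "e2pi (of_nat (Suc l) * w) = e2pi \<tau> ^ (Suc m * Suc l)"
      unfolding w_def by (simp only: e2pi_of_nat_mult power_mult)
    thus ?thesis unfolding l power_mult_distrib using p by (simp del: of_nat_Suc)
  qed
  ultimately show ?thesis by (simp add: w_def p_def divide_inverse mult.commute del: of_nat_Suc)
qed

lemma Lambert_outer_has_sum:
  assumes "Im \<tau> > 0"
  shows "((\<lambda>m. (deriv ^^ n) (geom_kernel 1) (of_nat (Suc m) * \<tau>) / (2 * of_real pi * \<i>) ^ n) has_sum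
            (deriv ^^ n) (kernel_series (polylog_coeff n 0) 1) \<tau> / (2 * of_real pi * \<i>) ^ n) UNIV"
proof -
  have "((\<lambda>m. (deriv ^^ n) (geom_kernel 1) (of_nat (Suc m) * \<tau>)) has_sum
            (deriv ^^ n) (kernel_series (polylog_coeff n 0) 1) \<tau>) UNIV"
    using has_sum_kernel_series[of 1 \<tau> 0 n] assms by (simp del: of_nat_Suc)
  from has_sum_cmult_left[OF this, of "inverse ((2 * of_real pi * \<i>) ^ n)"]
  show ?thesis by (simp only: divide_inverse)
qed

text \<open>Absolute summability comes from the same formulas at the purely imaginary point with the
  same imaginary part, where all terms are positive.\<close>
lemma Lambert_summable_on:
  assumes "Im \<tau> > 0"
  shows "(\<lambda>(m, l). of_nat (Suc l) ^ n * e2pi \<tau> ^ (Suc m * Suc l)) summable_on (UNIV \<times> UNIV)"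
proof -
  define \<sigma> where "\<sigma> = \<i> * of_real (Im \<tau>)"
  have \<sigma>: "Im \<sigma> > 0" using assms by (simp add: \<sigma>_def)
  define r where "r = exp (- 2 * pi * Im \<tau>)"
  have r: "e2pi \<sigma> = of_real r"
    by (simp add: e2pi_def \<sigma>_def r_def exp_of_real [symmetric] mult_ac)
  have Re_eq_norm: "Re (of_nat (Suc l) ^ n * e2pi \<sigma> ^ (Suc m * Suc l)) =
                 norm (of_nat (Suc l) ^ n * e2pi \<tau> ^ (Suc m * Suc l))" for m l
  proof -
    have "of_nat (Suc l) ^ n * e2pi \<sigma> ^ (Suc m * Suc l) = complex_of_real (real (Suc l) ^ n * r ^ (Suc m * Suc l))"
      unfolding r by (simp only: of_real_mult of_real_power of_real_of_nat_eq)
    hence "Re (of_nat (Suc l) ^ n * e2pi \<sigma> ^ (Suc m * Suc l)) = real (Suc l) ^ n * r ^ (Suc m * Suc l)"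
      by (simp only: Re_complex_of_real)
    thus ?thesis by (simp only: norm_mult norm_power norm_of_nat norm_e2pi r_def)
  qed
  define K where "K = (\<lambda>m. (deriv ^^ n) (geom_kernel 1) (of_nat (Suc m) * \<sigma>) / (2 * of_real pi * \<i>) ^ n)"
  have "(\<lambda>x. norm (case x of (m, l) \<Rightarrow> of_nat (Suc l) ^ n * e2pi \<tau> ^ (Suc m * Suc l))) summable_on UNIV \<times> UNIV"
  proof (rule summable_on_SigmaI)
    show "((\<lambda>l. norm (case (m, l) of (m, l) \<Rightarrow> of_nat (Suc l) ^ n * e2pi \<tau> ^ (Suc m * Suc l))) has_sum Re (K m)) UNIV" for m
      using has_sum_Re[OF Lambert_inner_has_sum[OF \<sigma>, of n m]] unfolding Re_eq_norm K_def prod.case .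
    show "(\<lambda>m. Re (K m)) summable_on UNIV"
      using has_sum_Re[OF Lambert_outer_has_sum[OF \<sigma>, of n]] unfolding K_def by (rule has_sum_imp_summable)
  qed auto
  thus ?thesis by (rule abs_summable_summable)
qed

text \<open>Pairs (m, l) correspond to pairs (N, d) with d dividing N > 0 via N = (m + 1) (l + 1), d
  = l + 1. Collecting the terms with equal N gives the divisor sums.\<close>

lemma Lambert_series_divisor_sum:
  assumes "Im \<tau> > 0"
  shows "(\<Sum>k. of_nat (divisor_sum n (Suc k)) * e2pi \<tau> ^ Suc k) =
           (deriv ^^ n) (kernel_series (polylog_coeff n 0) 1) \<tau> / (2 * of_real pi * \<i>) ^ n" (is "_ = ?S")
proof -
  define h where "h = (\<lambda>(N, d). of_nat d ^ n * e2pi \<tau> ^ N)"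
  let ?D = "Sigma {0<..} (\<lambda>N::nat. {d. d dvd N})"
  have "((\<lambda>(m, l). of_nat (Suc l) ^ n * e2pi \<tau> ^ (Suc m * Suc l)) has_sum ?S) (UNIV \<times> UNIV)"
    by (rule has_sum_SigmaI[OF _ Lambert_outer_has_sum[OF assms] Lambert_summable_on[OF assms]])
       (unfold prod.case, rule Lambert_inner_has_sum[OF assms])
  also have "(\<lambda>(m, l). of_nat (Suc l) ^ n * e2pi \<tau> ^ (Suc m * Suc l)) = (\<lambda>x. h (case x of (m, l) \<Rightarrow> (Suc m * Suc l, Suc l)))"
    by (auto simp: h_def fun_eq_iff simp del: of_nat_Suc)
  finally have "((\<lambda>x. h (case x of (m, l) \<Rightarrow> (Suc m * Suc l, Suc l))) has_sum ?S) (UNIV \<times> UNIV)" .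
  moreover have "bij_betw (\<lambda>(m, l). (Suc m * Suc l, Suc l)) (UNIV \<times> UNIV) ?D"
  proof (rule bij_betwI[of _ _ _ "\<lambda>(N, d). (N div d - 1, d - 1)"])
    show "(\<lambda>(m, l). (Suc m * Suc l, Suc l)) \<in> UNIV \<times> UNIV \<rightarrow> ?D"
      by (auto simp del: mult_Suc mult_Suc_right)
    show "(case case x of (m, l) \<Rightarrow> (Suc m * Suc l, Suc l) of (N, d) \<Rightarrow> (N div d - 1, d - 1)) = x" for x
      by (cases x) (simp del: mult_Suc mult_Suc_right)
    show "(case case x of (N, d) \<Rightarrow> (N div d - 1, d - 1) of (m, l) \<Rightarrow> (Suc m * Suc l, Suc l)) = x" if "x \<in> ?D" for x
    proof (cases x)
      case (Pair N d)
      with that have "N > 0" "d dvd N" by auto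
      then obtain e where e: "N = d * e" by (elim dvdE)
      with \<open>N > 0\<close> have "d > 0" "e > 0" by auto
      thus ?thesis unfolding Pair e by (simp del: mult_Suc mult_Suc_right)
    qed
  qed auto
  ultimately have "(h has_sum ?S) ?D"
    using has_sum_reindex_bij_betw by blast
  moreover have "((\<lambda>d. h (N, d)) has_sum (of_nat (divisor_sum n N) * e2pi \<tau> ^ N)) {d. d dvd N}" if "N \<in> {0<..}" for N
    using that by (intro has_sum_finiteI) (auto simp: h_def divisor_sum_def sum_distrib_right)
  ultimately have "((\<lambda>N. of_nat (divisor_sum n N) * e2pi \<tau> ^ N) has_sum ?S) {0<..}"
    by (rule has_sum_Sigma')
  moreover have bij: "bij_betw Suc UNIV {0<..}"
    by (rule bij_betwI[of _ _ _ "\<lambda>j. j - 1"]) auto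
  ultimately have "((\<lambda>k. of_nat (divisor_sum n (Suc k)) * e2pi \<tau> ^ Suc k) has_sum ?S) UNIV"
    using has_sum_reindex_bij_betw[OF bij, of "\<lambda>N. of_nat (divisor_sum n N) * e2pi \<tau> ^ N"] by blast
  from sums_unique[OF has_sum_imp_sums[OF this]] show ?thesis ..
qed

text \<open>For lam = \<mu> = 0 the two kernel series coincide. In even weight they double and halve
  the Bernoulli constant inside the factor 2; in odd weight they cancel and the Bernoulli number
  vanishes.\<close>

theorem funpow_Dop_calE_hat_0:
  assumes "n \<ge> 2" "Im \<tau> > 0"
  shows "(Dop ^^ n) (\<lambda>t. calE_hat (Suc n) 0 t) \<tau> = 2 * eisenstein_G (Suc n) \<tau>"
proof -
  define D where "D = (deriv ^^ n) (kernel_series (polylog_coeff n 0) 1) \<tau> / (2 * of_real pi * \<i>) ^ n"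
  have "upper_frac 0 = 1" by (simp add: upper_frac_eq)
  hence Dop: "(Dop ^^ n) (\<lambda>t. calE_hat (Suc n) 0 t) \<tau> =
          D + (-1) ^ Suc n * D - of_real (bernoulli (Suc n)) / of_nat (Suc n)"
    using funpow_Dop_calE_hat[of n 0 0 \<tau>] assms
    by (simp add: bernpoly_0 D_def add_divide_distrib diff_divide_distrib del: bernoulli.simps of_nat_Suc)
  show ?thesis
  proof (cases "even (Suc n)")
    case True
    have "eisenstein_G (Suc n) \<tau> = - of_real (bernoulli (Suc n)) / (2 * of_nat (Suc n)) + D"
      using True Lambert_series_divisor_sum[OF assms(2), of n]
      by (simp only: eisenstein_G_def if_True diff_Suc_1 D_def)
    moreover have "(-1) ^ Suc n = (1 :: complex)" using True by (simp only: neg_one_even_power)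
    moreover have "D + 1 * D - b / c = 2 * (- b / (2 * c) + D)" for b c :: complex
      by (cases "c = 0") (simp_all add: field_simps)
    ultimately show ?thesis unfolding Dop by (simp only:)
  next
    case False
    moreover have "bernoulli (Suc n) = 0"
      by (rule bernoulli_odd_eq_0) (use False assms in auto)
    ultimately show ?thesis unfolding Dop
      by (simp add: eisenstein_G_def del: bernoulli.simps)
  qed
qed

lemma common_denominator:
  fixes x y :: real
  assumes "x \<in> \<rat>" "y \<in> \<rat>"
  shows "\<exists>n::nat. n > 0 \<and> of_nat n * x \<in> \<int> \<and> of_nat n * y \<in> \<int>"
proof -
  obtain i j where x: "x = of_int i / of_nat j" "j \<noteq> 0"
    using assms(1) unfolding Rats_eq_int_div_nat by blast
  obtain k l where y: "y = of_int k / of_nat l" "l \<noteq> 0"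
    using assms(2) unfolding Rats_eq_int_div_nat by blast
  have "of_nat (j * l) * x = of_int (int l * i)" "of_nat (j * l) * y = of_int (int j * k)"
    using x y by simp_all
  thus ?thesis using x(2) y(2) by (intro exI[of _ "j * l"]) (metis Ints_of_int mult_pos_pos not_gr_zero)
qed

theorem theorem1p7:
  fixes a N :: nat and lam \<mu> :: real and \<tau> :: complex
  assumes "a \<ge> 2"
    and "lam \<in> \<rat>" and "\<mu> \<in> \<rat>"
    and "N = (LEAST n::nat. n > 0 \<and> of_nat n * lam \<in> \<int> \<and> of_nat n * \<mu> \<in> \<int>)"
    and "a = 2 \<Longrightarrow> \<not> (lam \<in> \<int> \<and> \<mu> \<in> \<int>)"
    and "Im \<tau> > 0"
  shows "(Dop ^^ (a - 1)) (\<lambda>t. calE_hat a (of_real lam * t + of_real \<mu>) t) \<tau>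
           = fact (a - 1) / (- 2 * of_real pi * \<i>) ^ a
             * (\<Sum>(m1, m2)\<in>{0..<int N} \<times> {0..<int N}.
                  e2pi (of_int m1 * of_real \<mu> - of_int m2 * of_real lam)
                  * eisenstein_level a N (m1, m2) \<tau>)
         \<and> (a \<ge> 3 \<longrightarrow> (Dop ^^ (a - 1)) (\<lambda>t. calE_hat a 0 t) \<tau> = 2 * eisenstein_G a \<tau>)"
proof -
  define n where "n = a - 1"
  have n: "a = Suc n" "n > 0" using assms(1) by (auto simp: n_def)
  have N: "N > 0" "of_nat N * lam \<in> \<int>" "of_nat N * \<mu> \<in> \<int>"
    using LeastI_ex[OF common_denominator[OF assms(2,3)]] unfolding assms(4) by blast+
  have "n = 1 \<Longrightarrow> \<not> (lam \<in> \<int> \<and> \<mu> \<in> \<int>)" using assms(5) n by simp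
  from funpow_Dop_calE_hat_eq_eisenstein_level[OF n(2) N assms(6) this] funpow_Dop_calE_hat_0[OF _ assms(6), of n]
  show ?thesis unfolding n(1) diff_Suc_1 by auto
qed

end
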